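(* Let $A$ generate a strongly continuous semigroup on the Hilbert space $\mathbb{H}$, let $B\in\mathcal{L}(\mathbb{U},\mathcal{D}(A^* )')$ be an admissible control operator, and let $C\in\mathcal{L}(\mathbb{H})$. Assume: (1) The pairs $(A,C)$ and $(A^*,B^* )$ are finite-time observable in some time $T_0>0$, and $\ker A\cap\ker C=\{0\}$ and $\ker A^*\cap\ker B^*=\{0\}$. (2) There exists $\delta>0$ such that $\|C\eta\|_{\mathbb{H}}^2\ge\delta\|\eta\|_{\mathbb{H}}^2$ for all $\eta\in\mathbb{H}$. Then there exist $c>0$ and $\lambda>0$, depending only on $A,B,C$, such that for every $T>T_0$ and all $x_0,z\in\mathbb{H}$, $$\|x_{T,\mathrm{opt}}(t)-\bar x\|_{\mathbb{H}}+\|y_{T,\mathrm{opt}}(t)-\bar y\|_{\mathbb{H}}+\|u_{T,\mathrm{opt}}-\bar u\|_{L^2(I_t;\mathbb{U})}\le c\big(\|x_0-\bar x\|_{\mathbb{H}}+\|\bar y\|_{\mathbb{H}}\big)\big(e^{-\lambda t}+e^{-\lambda(T-t)}\big)\qquad\forall t\in[0,T],$$ where $I_t=(t,T-t)$ if $t\le T/2$ and $I_t=(T-t,t)$ if $t\ge T/2$. Here $u_{T,\mathrm{opt}}$ is the unique minimizer over $u\in L^2((0,T);\mathbb{U})$ of $\int_0^T(\|Cx(t)-z\|_{\mathbb{H}}^2+\|u(t)\|_{\mathbb{U}}^2)\,dt$, where $x$ solves $x'=Ax+Bu$, $x(0)=x_0$; $x_{T,\mathrm{opt}}$ is the corresponding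 solution; $y_{T,\mathrm{opt}}\in C([0,T];\mathbb{H})$ is the corresponding adjoint state, i.e. the solution of $y'=-A^*y-C^*(Cx_{T,\mathrm{opt}}-z)$ on $(0,T)$, $y(T)=0$; and $(\bar x,\bar u,\bar y)\in\mathbb{H}\times\mathbb{U}\times\mathcal{D}(A^* )$ is the unique triple such that $(\bar x,\bar u)$ minimizes $\|Cx-z\|_{\mathbb{H}}^2+\|u\|_{\mathbb{U}}^2$ over all $(x,u)\in\mathbb{H}\times\mathbb{U}$ with $Ax+Bu=0$, and $-A^*\bar y-C^*(C\bar x-z)=0$, $\bar u=-B^*\bar y$.
   Context: $\mathbb{H}$ and $\mathbb{U}$ are Hilbert spaces, identified with their duals. $A:\mathcal{D}(A)\to\mathbb{H}$ generates a strongly continuous semigroup $(e^{tA})_{t\ge0}$; $A^*$ generates the adjoint semigroup. $\mathcal{D}(A^* )$ carries the graph inner product and $\mathcal{D}(A^* )'$ is its dual with respect to the pivot space $\mathbb{H}$, so $\mathcal{D}(A^* )\subset\mathbb{H}\subset\mathcal{D}(A^* )'$; $e^{tA}$ extends to $\mathcal{D}(A^* )'$. For $B\in\mathcal{L}(\mathbb{U},\mathcal{D}(A^* )')$, $B^*\in\mathcal{L}(\mathcal{D}(A^* ),\mathbb{U})$. $B$ is admissible if for all $T>0$ and $u\in L^2((0,T);\mathbb{U})$ the function $t\mapsto\int_0^te^{(t-s)A}Bu(s)\,ds$ belongs to $C([0,T];\mathbb{H})$. Solutions of $x'=Ax+Bu$, $x(0)=x_0$ are given by $x(t)=e^{tA}x_0+\int_0^te^{(t-s)A}Bu(s)\,ds$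 (equivalently, weak solutions tested against $\mathcal{D}(A^* )$); backward adjoint equations are understood in the mild sense. $Ax+Bu=0$ means $\langle x,A^*\varphi\rangle_{\mathbb{H}}+\langle u,B^*\varphi\rangle_{\mathbb{U}}=0$ for all $\varphi\in\mathcal{D}(A^* )$. $(A,C)$ is finite-time observable in time $T_0$ if there is $c>0$ with $\int_0^{T_0}\|Ce^{tA}\xi\|_{\mathbb{H}}^2dt\ge c\|e^{T_0A}\xi\|_{\mathbb{H}}^2$ for all $\xi\in\mathbb{H}$; $(A^*,B^* )$ is finite-time observable in time $T_0$ if there is $c>0$ with $\int_0^{T_0}\|B^*e^{tA^*}\xi\|_{\mathbb{U}}^2dt\ge c\|e^{T_0A^*}\xi\|_{\mathbb{H}}^2$ for all $\xi\in\mathbb{H}$, where for $\xi\in\mathbb{H}$ the function $t\mapsto B^*e^{tA^*}\xi\in L^2((0,T_0);\mathbb{U})$ is defined by continuous extension from $\xi\in\mathcal{D}(A^* )$ (possible by admissibility). Under assumption (1), the triple $(\bar x,\bar u,\bar y)$ exists and is unique. *)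

theory Defs
  imports "HOL-Analysis.Analysis"
begin

section \<open>Semigroups, generators and adjoints\<close>

text \<open>Hilbert spaces are types of sort \<open>{real_inner, banach}\<close>. Complex Hilbert spaces are covered
  through their underlying real structure \<open>Re \<langle>x, y\<rangle>\<close>, which changes neither norms nor adjoints.\<close>

text \<open>An unbounded operator is a pair of its domain and a total function; the values of the
  function outside the domain are irrelevant.\<close>

type_synonym 'h unbounded_op = "'h set \<times> ('h \<Rightarrow> 'h)"

abbreviation op_dom :: "'h unbounded_op \<Rightarrow> 'h set" where "op_dom \<equiv> fst"

abbreviation op_app :: "'h unbounded_op \<Rightarrow> 'h \<Rightarrow> 'h" where "op_app \<equiv> snd"

definition C0_semigroup :: "(real \<Rightarrow> 'h::{real_inner, banach} \<Rightarrow>\<^sub>L 'h) \<Rightarrow> bool" where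
  "C0_semigroup S \<longleftrightarrow>
     S 0 = id_blinfun \<and>
     (\<forall>s\<ge>0. \<forall>t\<ge>0. S (s + t) = S s o\<^sub>L S t) \<and>
     (\<forall>x. ((\<lambda>t. S t x) \<longlongrightarrow> x) (at_right 0))"

text \<open>\<open>A\<close> is the infinitesimal generator of \<open>S\<close>, that is \<open>S t = e\<^sup>t\<^sup>A\<close>. Values \<open>S t\<close> with \<open>t < 0\<close> are
  unconstrained and never used.\<close>

definition generates :: "'h::{real_inner, banach} unbounded_op \<Rightarrow> (real \<Rightarrow> 'h \<Rightarrow>\<^sub>L 'h) \<Rightarrow> bool" where
  "generates A S \<longleftrightarrow>
     C0_semigroup S \<and>
     op_dom A = {x. \<exists>y. ((\<lambda>t. (S t x - x) /\<^sub>R t) \<longlongrightarrow> y) (at_right 0)} \<and>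
     (\<forall>x\<in>op_dom A. ((\<lambda>t. (S t x - x) /\<^sub>R t) \<longlongrightarrow> op_app A x) (at_right 0))"

text \<open>The adjoint of a densely defined operator.\<close>

definition op_adjoint :: "'h::{real_inner, banach} unbounded_op \<Rightarrow> 'h unbounded_op" where
  "op_adjoint A =
     ({\<phi>. \<exists>\<psi>. \<forall>x\<in>op_dom A. op_app A x \<bullet> \<phi> = x \<bullet> \<psi>},
      \<lambda>\<phi>. THE \<psi>. \<forall>x\<in>op_dom A. op_app A x \<bullet> \<phi> = x \<bullet> \<psi>)"

definition graph_norm :: "'h::{real_inner, banach} unbounded_op \<Rightarrow> 'h \<Rightarrow> real" where
  "graph_norm A x = sqrt ((norm x)\<^sup>2 + (norm (op_app A x))\<^sup>2)"

text \<open>\<open>e\<^sup>t\<^sup>A\<^sup>*\<close>\<close>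

definition adj_semigroup :: "(real \<Rightarrow> 'h::{real_inner, banach} \<Rightarrow>\<^sub>L 'h) \<Rightarrow> real \<Rightarrow> 'h \<Rightarrow> 'h" where
  "adj_semigroup S t = adjoint (blinfun_apply (S t))"


section \<open>The extrapolation space and control operators\<close>

text \<open>Elements of the dual \<open>D(A\<^sup>*)'\<close> with pivot space \<open>H\<close> are represented by functionals on \<open>H\<close>
  that are linear and graph-norm bounded on \<open>D(A\<^sup>*)\<close>, and are only ever evaluated on \<open>D(A\<^sup>*)\<close>;
  \<open>h \<in> H\<close> corresponds to \<open>\<lambda>\<phi>. h \<bullet> \<phi>\<close>.\<close>

definition adj_dom_dual :: "'h::{real_inner, banach} unbounded_op \<Rightarrow> ('h \<Rightarrow> real) set" where
  "adj_dom_dual A = {f.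
     (\<forall>\<phi>\<in>op_dom (op_adjoint A). \<forall>\<psi>\<in>op_dom (op_adjoint A). f (\<phi> + \<psi>) = f \<phi> + f \<psi>) \<and>
     (\<forall>a. \<forall>\<phi>\<in>op_dom (op_adjoint A). f (a *\<^sub>R \<phi>) = a * f \<phi>) \<and>
     (\<exists>K. \<forall>\<phi>\<in>op_dom (op_adjoint A). \<bar>f \<phi>\<bar> \<le> K * graph_norm (op_adjoint A) \<phi>)}"

text \<open>The equation \<open>f = h\<close> in \<open>D(A\<^sup>*)'\<close> for \<open>h \<in> H\<close>.\<close>

definition represented_by :: "'h::{real_inner, banach} unbounded_op \<Rightarrow> ('h \<Rightarrow> real) \<Rightarrow> 'h \<Rightarrow> bool" where
  "represented_by A f h \<longleftrightarrow> (\<forall>\<phi>\<in>op_dom (op_adjoint A). h \<bullet> \<phi> = f \<phi>)"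

text \<open>The extension of \<open>e\<^sup>t\<^sup>A\<close> to \<open>D(A\<^sup>*)'\<close>: the transpose of \<open>e\<^sup>t\<^sup>A\<^sup>*\<close> on \<open>D(A\<^sup>*)\<close>.\<close>

definition ext_semigroup ::
    "(real \<Rightarrow> 'h::{real_inner, banach} \<Rightarrow>\<^sub>L 'h) \<Rightarrow> real \<Rightarrow> ('h \<Rightarrow> real) \<Rightarrow> 'h \<Rightarrow> real" where
  "ext_semigroup S t f = (\<lambda>\<phi>. f (adj_semigroup S t \<phi>))"

text \<open>\<open>B \<in> L(U, D(A\<^sup>*)')\<close>\<close>

definition control_operator ::
    "'h::{real_inner, banach} unbounded_op \<Rightarrow> ('u::{real_inner, banach} \<Rightarrow> 'h \<Rightarrow> real) \<Rightarrow> bool" where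
  "control_operator A B \<longleftrightarrow>
     (\<forall>u. B u \<in> adj_dom_dual A) \<and>
     (\<forall>\<phi>\<in>op_dom (op_adjoint A). linear (\<lambda>u. B u \<phi>)) \<and>
     (\<exists>K. \<forall>u. \<forall>\<phi>\<in>op_dom (op_adjoint A). \<bar>B u \<phi>\<bar> \<le> K * norm u * graph_norm (op_adjoint A) \<phi>)"

text \<open>\<open>B\<^sup>* \<in> L(D(A\<^sup>*), U)\<close>; only used on \<open>D(A\<^sup>*)\<close>.\<close>

definition ctrl_adjoint :: "('u::{real_inner, banach} \<Rightarrow> 'h \<Rightarrow> real) \<Rightarrow> 'h \<Rightarrow> 'u" where
  "ctrl_adjoint B \<phi> = (THE v. \<forall>u. u \<bullet> v = B u \<phi>)"

text \<open>The function space \<open>L\<^sup>2((0,T);U)\<close>. The library's \<open>measurable_on\<close> (a.e. limit of continuous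
  functions) is strong measurability and does not require \<open>U\<close> to be separable.\<close>

definition L2 :: "real \<Rightarrow> (real \<Rightarrow> 'u::{real_inner, banach}) set" where
  "L2 T = {u. u measurable_on {0<..<T} \<and> set_integrable lebesgue {0<..<T} (\<lambda>t. (norm (u t))\<^sup>2)}"

definition L2_norm_on :: "real set \<Rightarrow> (real \<Rightarrow> 'u::{real_inner, banach}) \<Rightarrow> real" where
  "L2_norm_on I u = sqrt (LINT t:I|lebesgue. (norm (u t))\<^sup>2)"

text \<open>The convolution \<open>\<integral>\<^sub>0\<^sup>t e\<^sup>(\<^sup>t\<^sup>-\<^sup>s\<^sup>)\<^sup>A B u(s) ds\<close>, an integral with values in \<open>D(A\<^sup>*)'\<close>; the value of such
  an integral on a test element is the integral of the values.\<close>

definition input_functional ::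
    "(real \<Rightarrow> 'h::{real_inner, banach} \<Rightarrow>\<^sub>L 'h) \<Rightarrow> ('u::{real_inner, banach} \<Rightarrow> 'h \<Rightarrow> real)
      \<Rightarrow> (real \<Rightarrow> 'u) \<Rightarrow> real \<Rightarrow> 'h \<Rightarrow> real" where
  "input_functional S B u t =
     (\<lambda>\<phi>. LINT s:{0..t}|lebesgue. ext_semigroup S (t - s) (B (u s)) \<phi>)"

definition admissible ::
    "'h::{real_inner, banach} unbounded_op \<Rightarrow> (real \<Rightarrow> 'h \<Rightarrow>\<^sub>L 'h)
      \<Rightarrow> ('u::{real_inner, banach} \<Rightarrow> 'h \<Rightarrow> real) \<Rightarrow> bool" where
  "admissible A S B \<longleftrightarrow>
     (\<forall>T>0. \<forall>u\<in>L2 T. \<exists>f. continuous_on {0..T} f \<and>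
        (\<forall>t\<in>{0..T}. represented_by A (input_functional S B u t) (f t)))"


section \<open>Observability\<close>

definition observable ::
    "(real \<Rightarrow> 'h::{real_inner, banach} \<Rightarrow>\<^sub>L 'h) \<Rightarrow> ('h \<Rightarrow>\<^sub>L 'h) \<Rightarrow> real \<Rightarrow> bool" where
  "observable S C T \<longleftrightarrow>
     (\<exists>c>0. \<forall>\<xi>. (LINT t:{0..T}|lebesgue. (norm (C (S t \<xi>)))\<^sup>2) \<ge> c * (norm (S T \<xi>))\<^sup>2)"

text \<open>The function \<open>t \<mapsto> B\<^sup>* e\<^sup>t\<^sup>A\<^sup>* \<xi>\<close> in \<open>L\<^sup>2((0,T);U)\<close> for arbitrary \<open>\<xi> \<in> H\<close>, by continuous extension
  from \<open>D(A\<^sup>*)\<close>. It is determined up to null sets.\<close>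

definition adj_output ::
    "'h::{real_inner, banach} unbounded_op \<Rightarrow> (real \<Rightarrow> 'h \<Rightarrow>\<^sub>L 'h)
      \<Rightarrow> ('u::{real_inner, banach} \<Rightarrow> 'h \<Rightarrow> real) \<Rightarrow> real \<Rightarrow> 'h \<Rightarrow> real \<Rightarrow> 'u" where
  "adj_output A S B T \<xi> = (SOME g. g \<in> L2 T \<and>
     (\<forall>\<phi>. (\<forall>n. \<phi> n \<in> op_dom (op_adjoint A)) \<and> \<phi> \<longlonglongrightarrow> \<xi> \<longrightarrow>
        (\<lambda>n. L2_norm_on {0<..<T} (\<lambda>t. ctrl_adjoint B (adj_semigroup S t (\<phi> n)) - g t))
          \<longlonglongrightarrow> 0))"

definition adj_observable ::
    "'h::{real_inner, banach} unbounded_op \<Rightarrow> (real \<Rightarrow> 'h \<Rightarrow>\<^sub>L 'h)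
      \<Rightarrow> ('u::{real_inner, banach} \<Rightarrow> 'h \<Rightarrow> real) \<Rightarrow> real \<Rightarrow> bool" where
  "adj_observable A S B T \<longleftrightarrow>
     (\<exists>c>0. \<forall>\<xi>. (LINT t:{0<..<T}|lebesgue. (norm (adj_output A S B T \<xi> t))\<^sup>2)
                   \<ge> c * (norm (adj_semigroup S T \<xi>))\<^sup>2)"


section \<open>The dynamic and the static optimal control problem\<close>

text \<open>The solution of \<open>x' = A x + B u\<close>, \<open>x(0) = x\<^sub>0\<close>. For admissible \<open>B\<close> and \<open>u \<in> L\<^sup>2\<close> the definite
  description denotes the element of \<open>H\<close> given by the convolution.\<close>

definition state ::
    "'h::{real_inner, banach} unbounded_op \<Rightarrow> (real \<Rightarrow> 'h \<Rightarrow>\<^sub>L 'h)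
      \<Rightarrow> ('u::{real_inner, banach} \<Rightarrow> 'h \<Rightarrow> real) \<Rightarrow> 'h \<Rightarrow> (real \<Rightarrow> 'u) \<Rightarrow> real \<Rightarrow> 'h" where
  "state A S B x0 u t = S t x0 + (THE h. represented_by A (input_functional S B u t) h)"

text \<open>The mild solution of \<open>y' = - A\<^sup>* y - C\<^sup>*(C x - z)\<close> on \<open>(0,T)\<close>, \<open>y(T) = 0\<close>:
  \<open>y(t) = \<integral>\<^sub>t\<^sup>T e\<^sup>(\<^sup>s\<^sup>-\<^sup>t\<^sup>)\<^sup>A\<^sup>* C\<^sup>*(C x(s) - z) ds\<close>.\<close>

definition adjoint_state ::
    "(real \<Rightarrow> 'h::{real_inner, banach} \<Rightarrow>\<^sub>L 'h) \<Rightarrow> ('h \<Rightarrow>\<^sub>L 'h) \<Rightarrow> 'h \<Rightarrow> real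
      \<Rightarrow> (real \<Rightarrow> 'h) \<Rightarrow> real \<Rightarrow> 'h" where
  "adjoint_state S C z T x t =
     integral {t..T} (\<lambda>s. adj_semigroup S (s - t) (adjoint (blinfun_apply C) (C (x s) - z)))"

definition cost ::
    "'h::{real_inner, banach} unbounded_op \<Rightarrow> (real \<Rightarrow> 'h \<Rightarrow>\<^sub>L 'h)
      \<Rightarrow> ('u::{real_inner, banach} \<Rightarrow> 'h \<Rightarrow> real) \<Rightarrow> ('h \<Rightarrow>\<^sub>L 'h) \<Rightarrow> 'h \<Rightarrow> real \<Rightarrow> 'h
      \<Rightarrow> (real \<Rightarrow> 'u) \<Rightarrow> real" where
  "cost A S B C z T x0 u =
     (LINT t:{0<..<T}|lebesgue. (norm (C (state A S B x0 u t) - z))\<^sup>2 + (norm (u t))\<^sup>2)"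

definition optimal_control ::
    "'h::{real_inner, banach} unbounded_op \<Rightarrow> (real \<Rightarrow> 'h \<Rightarrow>\<^sub>L 'h)
      \<Rightarrow> ('u::{real_inner, banach} \<Rightarrow> 'h \<Rightarrow> real) \<Rightarrow> ('h \<Rightarrow>\<^sub>L 'h) \<Rightarrow> 'h \<Rightarrow> real \<Rightarrow> 'h
      \<Rightarrow> (real \<Rightarrow> 'u) \<Rightarrow> bool" where
  "optimal_control A S B C z T x0 u \<longleftrightarrow>
     u \<in> L2 T \<and> (\<forall>v\<in>L2 T. cost A S B C z T x0 u \<le> cost A S B C z T x0 v)"

text \<open>\<open>A x + B u = 0\<close>\<close>

definition steady_state ::
    "'h::{real_inner, banach} unbounded_op \<Rightarrow> ('u::{real_inner, banach} \<Rightarrow> 'h \<Rightarrow> real)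
      \<Rightarrow> 'h \<Rightarrow> 'u \<Rightarrow> bool" where
  "steady_state A B x u \<longleftrightarrow>
     (\<forall>\<phi>\<in>op_dom (op_adjoint A). x \<bullet> op_app (op_adjoint A) \<phi> + u \<bullet> ctrl_adjoint B \<phi> = 0)"

definition optimal_steady_triple ::
    "'h::{real_inner, banach} unbounded_op \<Rightarrow> ('u::{real_inner, banach} \<Rightarrow> 'h \<Rightarrow> real)
      \<Rightarrow> ('h \<Rightarrow>\<^sub>L 'h) \<Rightarrow> 'h \<Rightarrow> 'h \<times> 'u \<times> 'h \<Rightarrow> bool" where
  "optimal_steady_triple A B C z = (\<lambda>(x, u, y).
     steady_state A B x u \<and>
     (\<forall>x' u'. steady_state A B x' u' \<longrightarrow>
        (norm (C x - z))\<^sup>2 + (norm u)\<^sup>2 \<le> (norm (C x' - z))\<^sup>2 + (norm u')\<^sup>2) \<and>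
     y \<in> op_dom (op_adjoint A) \<and>
     - op_app (op_adjoint A) y - adjoint (blinfun_apply C) (C x - z) = 0 \<and>
     u = - ctrl_adjoint B y)"

definition turnpike_interval :: "real \<Rightarrow> real \<Rightarrow> real set" where
  "turnpike_interval T t = (if t \<le> T / 2 then {t<..<T - t} else {T - t<..<t})"

end

theory Submission
  imports Defs
begin

text \<open>Let \<open>p\<close>, \<open>v\<close>, \<open>q\<close> be the deviations of the optimal state, control and adjoint state from the steady
  triple. They solve the linear-quadratic optimality system, so
  \<open>\<langle>p a, q a\<rangle> - \<langle>p b, q b\<rangle> = \<integral>\<^sub>a\<^sup>b (\<parallel>C p\<parallel>\<^sup>2 + \<parallel>v\<parallel>\<^sup>2) =: E a b\<close>. Observability of the adjoint pair bounds
  \<open>\<parallel>q a\<parallel>\<^sup>2\<close> by a multiple of \<open>E a (a + T0)\<close>, and coercivity of \<open>C\<close> bounds \<open>\<parallel>p b\<parallel>\<^sup>2\<close> by a multiple of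
  \<open>E (b - T0) b\<close>. With these bounds the energy identity on \<open>[s, T - s]\<close> shows that \<open>E s (T - s)\<close> shrinks
  by a fixed factor whenever \<open>s\<close> grows by \<open>2 T0\<close>; no Riccati equation is involved. The same
  observability estimate gives the range of \<open>\<phi> \<mapsto> (A\<^sup>* \<phi>, B\<^sup>* \<phi>)\<close> closed, hence the Lagrange multiplier of the
  static problem.\<close>

section \<open>Hilbert spaces\<close>

text \<open>\<open>B\<close> is unbounded, and admissibility is a bare existence statement: for each
  control some continuous representative exists. Every quantitative bound on the input map comes
  from uniform boundedness on the space of square integrable controls, which is why that space is
  built here as a complete inner product type; the same completeness yields the optimal control.
  Values of the adjoint state are mere elements of the state space, where \<open>Bs\<close> makes no
  sense, so the optimality system is used only through duality with trajectories, and vectors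
  outside \<open>DA\<close> are reached by density. The contraction factor has a simple origin: on
  an interval slightly larger than the inner one, the energy is at most the sum of two boundary
  products, and each factor of a product is paid for by a window of length \<open>T0\<close>. The
  four windows lie side by side between the inner and the outer interval, so with energies F' and F
  one gets 2 F' \<le> K (F - F'). All constants come from estimates over times of length at most
  \<open>T0\<close>, hence do not see \<open>T\<close>.\<close>

lemma uniformly_midpoint_convex_attains_min:
  fixes K :: "'a::{real_inner, banach} set" and J :: "'a \<Rightarrow> real"
  assumes "closed K" "K \<noteq> {}" and cont: "continuous_on K J" and pos: "\<And>x. x \<in> K \<Longrightarrow> 0 \<le> J x"
    and "c > 0" and mid: "\<And>x y. x \<in> K \<Longrightarrow> y \<in> K \<Longrightarrow> (1/2) *\<^sub>R (x + y) \<in> K"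
    and conv: "\<And>x y. x \<in> K \<Longrightarrow> y \<in> K \<Longrightarrow>
      J ((1/2) *\<^sub>R (x + y)) \<le> (J x + J y) / 2 - c * (norm (x - y))\<^sup>2"
  shows "\<exists>x\<in>K. \<forall>y\<in>K. J x \<le> J y"
proof -
  define m where "m = Inf (J ` K)"
  have bdd: "bdd_below (J ` K)" using pos by (auto intro!: bdd_belowI)
  have m_le: "m \<le> J x" if "x \<in> K" for x
    unfolding m_def using bdd that by (auto intro: cInf_lower)
  have "\<exists>x\<in>K. J x < m + inverse (real (Suc n))" for n
    using cInf_lessD[of "J ` K" "m + inverse (real (Suc n))"] \<open>K \<noteq> {}\<close> by (auto simp: m_def)
  then obtain x where xK: "\<And>n. x n \<in> K" and xJ: "\<And>n. J (x n) < m + inverse (real (Suc n))"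
    by metis
  \<comment> \<open>The midpoint stays in \<open>K\<close>, so its value is at least
    \<open>m\<close>; the convexity gap then turns closeness of the values into closeness of the
    points.\<close>
  have bound: "c * (norm (x i - x j))\<^sup>2 < inverse (real (Suc N))" if "i \<ge> N" "j \<ge> N" for i j N
  proof -
    have "inverse (real (Suc i)) \<le> inverse (real (Suc N))" "inverse (real (Suc j)) \<le> inverse (real (Suc N))"
      using that by auto
    then show ?thesis
      using conv[OF xK[of i] xK[of j]] xJ[of i] xJ[of j] m_le[OF mid[OF xK[of i] xK[of j]]] by argo
  qed
  have "Cauchy x"
    unfolding Cauchy_iff
  proof (intro allI impI)
    fix e :: real assume "e > 0"
    obtain N where N: "inverse (real (Suc N)) < c * e\<^sup>2"
      using reals_Archimedean[of "c * e\<^sup>2"] \<open>c > 0\<close> \<open>e > 0\<close> by auto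
    have "norm (x i - x j) < e" if "i \<ge> N" "j \<ge> N" for i j
    proof -
      have "c * (norm (x i - x j))\<^sup>2 < c * e\<^sup>2" using bound[OF that] N by simp
      then show ?thesis using \<open>c > 0\<close> \<open>e > 0\<close> by (simp add: power2_less_imp_less)
    qed
    then show "\<exists>N. \<forall>i\<ge>N. \<forall>j\<ge>N. norm (x i - x j) < e" by blast
  qed
  then obtain l where l: "x \<longlonglongrightarrow> l" by (auto simp: Cauchy_convergent_iff convergent_def)
  have lK: "l \<in> K" using \<open>closed K\<close> l xK closed_sequentially by blast
  have "(\<lambda>n. J (x n)) \<longlonglongrightarrow> J l"
    using cont l lK xK by (simp add: continuous_on_sequentially o_def)
  moreover have "(\<lambda>n. m + inverse (real (Suc n))) \<longlonglongrightarrow> m"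
    using tendsto_add[OF tendsto_const LIMSEQ_inverse_real_of_nat, of m] by simp
  ultimately have "J l \<le> m"
    by (rule LIMSEQ_le) (use xJ less_imp_le in auto)
  with lK m_le show ?thesis by (meson order_trans)
qed

text \<open>The parallelogram law is midpoint convexity of the squared distance with modulus 1/4, so
  a nearest point exists by completeness alone. Varying it along a line in \<open>K\<close> gives
  orthogonality.\<close>

lemma orthogonal_projection_exists:
  fixes K :: "'a::{real_inner, banach} set"
  assumes "closed K" "subspace K"
  shows "\<exists>p\<in>K. \<forall>k\<in>K. (x - p) \<bullet> k = 0"
proof -
  have "\<exists>p\<in>K. \<forall>y\<in>K. (norm (x - p))\<^sup>2 \<le> (norm (x - y))\<^sup>2"
  proof (rule uniformly_midpoint_convex_attains_min[where c = "1/4"])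
    show "K \<noteq> {}" using assms(2) subspace_0 by auto
    show "(1/2) *\<^sub>R (a + b) \<in> K" if "a \<in> K" "b \<in> K" for a b
      using that assms(2) by (simp add: subspace_add subspace_scale)
    show "(norm (x - (1/2) *\<^sub>R (a + b)))\<^sup>2
        \<le> ((norm (x - a))\<^sup>2 + (norm (x - b))\<^sup>2) / 2 - 1/4 * (norm (a - b))\<^sup>2" for a b
      by (simp add: power2_norm_eq_inner inner_diff_left inner_diff_right inner_add_left
          inner_add_right inner_commute field_simps)
  qed (auto intro!: continuous_intros assms)
  then obtain p where p: "p \<in> K" and le: "\<And>y. y \<in> K \<Longrightarrow> (norm (x - p))\<^sup>2 \<le> (norm (x - y))\<^sup>2" by blast
  have "(x - p) \<bullet> k = 0" if k: "k \<in> K" for k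
  proof (cases "k = 0")
    case False
    \<comment> \<open>The vertex of the parabola that describes the squared distance along
      \<open>k\<close>; if it were not 0, that point would be closer than \<open>p\<close>.\<close>
    define t where "t = ((x - p) \<bullet> k) / (k \<bullet> k)"
    have kk: "k \<bullet> k > 0" using False by simp
    have "p + t *\<^sub>R k \<in> K" using p k assms(2) by (simp add: subspace_add subspace_scale)
    from le[OF this] have "2 * t * ((x - p) \<bullet> k) \<le> t * t * (k \<bullet> k)"
      by (simp add: power2_norm_eq_inner inner_diff_left inner_diff_right inner_add_left
          inner_add_right inner_commute algebra_simps)
    also have "t * t * (k \<bullet> k) = t * ((x - p) \<bullet> k)" using kk by (simp add: t_def)
    finally have "t * ((x - p) \<bullet> k) \<le> 0" by simp
    then have "((x - p) \<bullet> k)\<^sup>2 \<le> 0" using kk by (simp add: t_def power2_eq_square field_simps)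
    then show ?thesis by simp
  qed simp
  with p show ?thesis by blast
qed

text \<open>The residual of the projection of \<open>x\<close> is orthogonal to \<open>K\<close>,
  hence by hypothesis to \<open>x\<close> as well as to the projection, hence to itself. Applied to
  \<open>adj_range\<close> this yields the Lagrange multiplier of the static problem; applied to a
  closure it yields density.\<close>

lemma double_orthogonal_complement:
  fixes K :: "'a::{real_inner, banach} set"
  assumes "closed K" "subspace K" and orth: "\<And>y. (\<And>k. k \<in> K \<Longrightarrow> y \<bullet> k = 0) \<Longrightarrow> x \<bullet> y = 0"
  shows "x \<in> K"
proof -
  obtain p where p: "p \<in> K" "\<And>k. k \<in> K \<Longrightarrow> (x - p) \<bullet> k = 0"
    using orthogonal_projection_exists[OF assms(1,2), of x] by blast
  have "x \<bullet> (x - p) = 0" using orth p(2) by blast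
  moreover have "p \<bullet> (x - p) = 0" using p by (simp add: inner_commute)
  ultimately have "(x - p) \<bullet> (x - p) = 0" by (simp add: inner_diff_left)
  then show ?thesis using p(1) by simp
qed

lemma closure_subspace:
  fixes D :: "'a::real_normed_vector set"
  assumes "subspace D"
  shows "subspace (closure D)"
  unfolding subspace_def
proof (intro conjI ballI allI)
  show "0 \<in> closure D" using assms closure_subset subspace_0 by blast
  show "x + y \<in> closure D" if xy: "x \<in> closure D" "y \<in> closure D" for x y
  proof -
    obtain f g where "\<And>n. f n \<in> D" "f \<longlonglongrightarrow> x" "\<And>n. g n \<in> D" "g \<longlonglongrightarrow> y"
      using xy unfolding closure_sequential by metis
    then show ?thesis unfolding closure_sequential using assms
      by (intro exI[of _ "\<lambda>n. f n + g n"]) (auto intro: tendsto_add subspace_add)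
  qed
  show "c *\<^sub>R x \<in> closure D" if x: "x \<in> closure D" for x c
  proof -
    obtain f where "\<And>n. f n \<in> D" "f \<longlonglongrightarrow> x" using x unfolding closure_sequential by metis
    then show ?thesis unfolding closure_sequential using assms
      by (intro exI[of _ "\<lambda>n. c *\<^sub>R f n"]) (auto intro: tendsto_scaleR subspace_scale)
  qed
qed

lemma closure_subspace_eq_UNIV:
  fixes D :: "'a::{real_inner, banach} set"
  assumes "subspace D" and "\<And>y. (\<And>k. k \<in> D \<Longrightarrow> y \<bullet> k = 0) \<Longrightarrow> y = 0"
  shows "closure D = UNIV"
proof -
  have sub: "subspace (closure D)" using assms(1) by (rule closure_subspace)
  have "x \<in> closure D" for x
    by (rule double_orthogonal_complement[OF closed_closure sub])
      (use assms(2) closure_subset in \<open>blast intro: subsetD inner_zero_right\<close>)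
  then show ?thesis by auto
qed

theorem riesz_representation:
  fixes f :: "'a::{real_inner, banach} \<Rightarrow> real"
  assumes "bounded_linear f"
  shows "\<exists>v. \<forall>x. f x = x \<bullet> v"
proof (cases "\<forall>x. f x = 0")
  case True
  then show ?thesis by (intro exI[of _ 0]) auto
next
  case False
  interpret f: bounded_linear f by fact
  obtain a where a: "f a \<noteq> 0" using False by auto
  let ?K = "{x. f x = 0}"
  have "closed ?K"
    by (intro closed_Collect_eq continuous_intros linear_continuous_on assms)
  moreover have "subspace ?K" by (auto simp: subspace_def f.add f.scaleR f.zero)
  ultimately obtain p where p: "f p = 0" "\<And>k. f k = 0 \<Longrightarrow> (a - p) \<bullet> k = 0"
    using orthogonal_projection_exists[of ?K a] by auto
  \<comment> \<open>\<open>w\<close> spans the orthogonal complement of the kernel, since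
    subtracting a suitable multiple of \<open>w\<close> brings any \<open>x\<close> into the
    kernel.\<close>
  define w where "w = a - p"
  have fw: "f w \<noteq> 0" using a p(1) by (simp add: w_def f.diff)
  then have "w \<noteq> 0" using f.zero by auto
  have "f x = x \<bullet> ((f w / (w \<bullet> w)) *\<^sub>R w)" for x
  proof -
    have "f (x - (f x / f w) *\<^sub>R w) = 0" using fw by (simp add: f.diff f.scaleR)
    from p(2)[OF this] have "w \<bullet> x = (f x / f w) * (w \<bullet> w)"
      by (simp add: w_def[symmetric] inner_diff_right)
    then show ?thesis using fw \<open>w \<noteq> 0\<close> by (simp add: inner_commute field_simps)
  qed
  then show ?thesis by blast
qed

lemma inner_eq_imp_eq:
  fixes v w :: "'a::real_inner"
  assumes "\<And>u. u \<bullet> v = u \<bullet> w"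
  shows "v = w"
proof -
  have "(v - w) \<bullet> (v - w) = 0" using assms[of "v - w"] by (simp add: inner_diff_right)
  then show ?thesis by simp
qed

text \<open>\<open>adjoint\<close> is defined by choice, so the identity holds as soon as one
  function satisfies it; Riesz supplies that function.\<close>

lemma adjoint_blinfun:
  fixes f :: "'a::{real_inner, banach} \<Rightarrow>\<^sub>L 'b::real_inner"
  shows "blinfun_apply f x \<bullet> y = x \<bullet> adjoint (blinfun_apply f) y"
proof -
  have "bounded_linear (\<lambda>x. f x \<bullet> y)" for y
    by (rule bounded_linear_compose[OF bounded_linear_inner_left blinfun.bounded_linear_right])
  then have "\<forall>y. \<exists>v. \<forall>x. f x \<bullet> y = x \<bullet> v" using riesz_representation by blast
  then have "\<exists>g. \<forall>x y. f x \<bullet> y = x \<bullet> g y" by metis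
  from someI_ex[OF this] show ?thesis unfolding adjoint_def by blast
qed

lemma norm_le_if_inner_le:
  fixes y :: "'a::real_inner"
  assumes "\<And>x. x \<bullet> y \<le> c * norm x" "0 \<le> c"
  shows "norm y \<le> c"
proof (cases "y = 0")
  case False
  have "norm y * norm y \<le> c * norm y" using assms(1)[of y]
    by (simp add: power2_norm_eq_inner[symmetric] power2_eq_square)
  then show ?thesis using False by simp
qed (use assms in simp)

lemma bounded_linear_adjoint_blinfun:
  fixes f :: "'a::{real_inner, banach} \<Rightarrow>\<^sub>L 'b::real_inner"
  shows "bounded_linear (adjoint (blinfun_apply f))"
    and "norm (adjoint (blinfun_apply f) y) \<le> norm f * norm y"
proof -
  show bound: "norm (adjoint (blinfun_apply f) y) \<le> norm f * norm y" for y
  proof (rule norm_le_if_inner_le)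
    fix x
    have "x \<bullet> adjoint (blinfun_apply f) y \<le> norm (f x) * norm y"
      unfolding adjoint_blinfun[symmetric] by (rule norm_cauchy_schwarz)
    also have "\<dots> \<le> (norm f * norm x) * norm y"
      by (intro mult_right_mono norm_blinfun) auto
    finally show "x \<bullet> adjoint (blinfun_apply f) y \<le> norm f * norm y * norm x" by (simp add: ac_simps)
  qed simp
  show "bounded_linear (adjoint (blinfun_apply f))"
  proof (rule bounded_linear_intro[where K = "norm f"])
    show "adjoint (blinfun_apply f) (x + y) = adjoint (blinfun_apply f) x + adjoint (blinfun_apply f) y" for x y
      by (rule inner_eq_imp_eq) (simp add: inner_add_right flip: adjoint_blinfun)
    show "adjoint (blinfun_apply f) (r *\<^sub>R x) = r *\<^sub>R adjoint (blinfun_apply f) x" for r x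
      by (rule inner_eq_imp_eq) (simp flip: adjoint_blinfun)
  qed (use bound in \<open>simp add: mult.commute\<close>)
qed

text \<open>A gliding hump: were the norms unbounded, steps of length (1/5)^n could be chosen so
  that the n-th one makes the image under \<open>f n\<close> large, while all later steps together
  are too short to undo it. The images of the limit point would then be unbounded.\<close>

theorem banach_steinhaus:
  fixes F :: "('a::banach \<Rightarrow>\<^sub>L 'b::real_normed_vector) set"
  assumes "\<And>x. \<exists>K. \<forall>f\<in>F. norm (f x) \<le> K"
  shows "\<exists>K. \<forall>f\<in>F. norm f \<le> K"
proof (rule ccontr)
  assume "\<nexists>K. \<forall>f\<in>F. norm f \<le> K"
  \<comment> \<open>The growth rate is chosen for the end of the proof: step n gains (1/2) (1/5)^n
    \<open>norm (f n)\<close>, the later steps lose at most half of it, and the remaining (1/4)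
    (1/5)^n times 4 n 5^n is n.\<close>
  then have "\<forall>n::nat. \<exists>f\<in>F. norm f > 4 * real n * 5 ^ n" by (meson not_le)
  then obtain f where fF: "\<And>n. f n \<in> F" and fn: "\<And>n::nat. norm (f n) > 4 * real n * 5 ^ n"
    by metis
  have step: "\<exists>v. norm v \<le> (1/5)^n \<and> norm (f n (x + v)) \<ge> (1/2) * (1/5)^n * norm (f n)" for n x
  proof -
    have "0 < norm (f n)" using fn[of n] by (smt (verit) mult_nonneg_nonneg of_nat_0_le_iff zero_le_power)
    then have "\<not> norm (f n) \<le> norm (f n) / 2" by simp
    then obtain y where y: "norm (f n y) > norm (f n) / 2 * norm y"
      using norm_blinfun_bound[of "norm (f n) / 2" "f n"] \<open>0 < norm (f n)\<close>
      by (meson half_gt_zero less_imp_le not_le)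
    then have "y \<noteq> 0" by auto
    define v where "v = ((1/5)^n / norm y) *\<^sub>R y"
    have nv: "norm v = (1/5)^n" using \<open>y \<noteq> 0\<close> by (simp add: v_def)
    have "norm (f n v) = (1/5)^n / norm y * norm (f n y)"
      by (simp add: v_def blinfun.scaleR_right)
    also have "\<dots> \<ge> (1/5)^n / norm y * (norm (f n) / 2 * norm y)"
      by (rule mult_left_mono) (use y in auto)
    finally have fv: "norm (f n v) \<ge> (1/2) * (1/5)^n * norm (f n)" using \<open>y \<noteq> 0\<close> by (simp add: field_simps)
    \<comment> \<open>Whatever \<open>x\<close> is, the two images differ by twice
      \<open>f n v\<close>, so one of the signs gives an image at least as long as
      \<open>f n v\<close>.\<close>
    have "f n (x + v) - f n (x + (- v)) = 2 *\<^sub>R f n v"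
      by (simp add: blinfun.add_right blinfun.diff_right scaleR_2)
    then have "2 * norm (f n v) = norm (f n (x + v) - f n (x + (- v)))" by simp
    also have "\<dots> \<le> norm (f n (x + v)) + norm (f n (x + (- v)))" by (rule norm_triangle_ineq4)
    finally consider "norm (f n (x + v)) \<ge> norm (f n v)" | "norm (f n (x + (- v))) \<ge> norm (f n v)" by linarith
    then show ?thesis
    proof cases
      case 1
      with fv nv show ?thesis by (intro exI[of _ v]) simp
    next
      case 2
      with fv nv show ?thesis by (intro exI[of _ "- v"]) simp
    qed
  qed
  obtain X where X: "\<And>n. norm (X (Suc n) - X n) \<le> (1/5)^n"
      "\<And>n. norm (f n (X (Suc n))) \<ge> (1/2) * (1/5)^n * norm (f n)"
  proof -
    have "\<exists>X. \<forall>n. True \<and> (norm (X (Suc n) - X n) \<le> (1/5)^n \<and>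
        norm (f n (X (Suc n))) \<ge> (1/2) * (1/5)^n * norm (f n))"
    proof (rule dependent_nat_choice)
      fix x n
      obtain v where "norm v \<le> (1/5)^n" "norm (f n (x + v)) \<ge> (1/2) * (1/5)^n * norm (f n)"
        using step by blast
      then show "\<exists>y. True \<and> norm (y - x) \<le> (1/5)^n \<and> norm (f n y) \<ge> (1/2) * (1/5)^n * norm (f n)"
        by (intro exI[of _ "x + v"]) auto
    qed auto
    then show thesis using that by blast
  qed
  have telescope: "norm (X (n + k) - X n) \<le> (5/4) * (1/5)^n" for n k
  proof -
    have "norm (X (n + k) - X n) \<le> (5/4) * ((1/5)^n - (1/5)^(n + k))"
    proof (induction k)
      case (Suc k)
      have "norm (X (n + Suc k) - X n) \<le> norm (X (Suc (n + k)) - X (n + k)) + norm (X (n + k) - X n)"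
        by (metis add_Suc_right diff_add_cancel add_diff_eq norm_triangle_ineq)
      also have "\<dots> \<le> (1/5)^(n+k) + (5/4) * ((1/5)^n - (1/5)^(n + k))"
        using X(1) Suc.IH by (intro add_mono) auto
      also have "\<dots> = (5/4) * ((1/5)^n - (1/5)^(n + Suc k))" by (simp add: field_simps)
      finally show ?case .
    qed simp
    also have "\<dots> \<le> (5/4) * (1/5)^n" by simp
    finally show ?thesis .
  qed
  have "Cauchy X"
    unfolding Cauchy_altdef2
  proof (intro allI impI)
    fix e :: real assume "e > 0"
    have "(\<lambda>n. (5/4) * (1/5)^n) \<longlonglongrightarrow> (5/4) * (0::real)" by (intro tendsto_intros LIMSEQ_power_zero) auto
    then have "\<forall>\<^sub>F n in sequentially. (5/4) * (1/5)^n < e"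
      using \<open>e > 0\<close> by (intro order_tendstoD(2)[where a = e]) auto
    then obtain N where "(5/4) * (1/5)^N < e" by (auto simp only: eventually_sequentially)
    then have "dist (X n) (X N) < e" if "n \<ge> N" for n
      using telescope[of N "n - N"] that by (simp add: dist_norm)
    then show "\<exists>N. \<forall>n\<ge>N. dist (X n) (X N) < e" by blast
  qed
  then obtain x where x: "X \<longlonglongrightarrow> x" by (auto simp: Cauchy_convergent_iff convergent_def)
  have xX: "norm (x - X n) \<le> (5/4) * (1/5)^n" for n
  proof (rule LIMSEQ_le_const2)
    show "(\<lambda>k. norm (X (k + n) - X n)) \<longlonglongrightarrow> norm (x - X n)"
      by (intro tendsto_intros LIMSEQ_ignore_initial_segment x)
    show "\<exists>N. \<forall>k\<ge>N. norm (X (k + n) - X n) \<le> (5/4) * (1/5)^n"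
      using telescope by (metis add.commute)
  qed
  have fx: "norm (f n x) \<ge> real n" for n
  proof -
    have "norm (f n (X (Suc n))) \<le> norm (f n x) + norm (f n (x - X (Suc n)))"
      by (metis blinfun.diff_right norm_triangle_sub norm_minus_commute)
    also have "norm (f n (x - X (Suc n))) \<le> norm (f n) * ((5/4) * (1/5)^Suc n)"
      by (rule order.trans[OF norm_blinfun]) (intro mult_left_mono xX norm_ge_zero)
    finally have "(1/4) * (1/5)^n * norm (f n) \<le> norm (f n x)"
      using X(2)[of n] by (simp add: mult.commute[of "norm (f n)"])
    moreover have "(1/4) * (1/5)^n * (4 * real n * 5^n) \<le> (1/4) * (1/5)^n * norm (f n)"
      using fn[of n] by (intro mult_left_mono) auto
    moreover have "(1/4) * (1/5)^n * (4 * real n * 5^n) = real n"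
      by (simp add: power_one_over)
    ultimately show ?thesis by linarith
  qed
  obtain K where K: "\<forall>f\<in>F. norm (f x) \<le> K" using assms by blast
  obtain n :: nat where "real n > K" using reals_Archimedean2 by blast
  with fx[of n] K fF[of n] show False by (meson not_le order_trans)
qed

section \<open>Square integrable functions with values in a Hilbert space\<close>

text \<open>A working form of \<open>L2\<close> on arbitrary sets: the scalar gauge integral comes
  with the rules for splitting, shifting and reflecting intervals that are used throughout.\<close>

definition sqint :: "real set \<Rightarrow> (real \<Rightarrow> 'u::real_inner) \<Rightarrow> bool" where
  "sqint S u \<longleftrightarrow> u measurable_on S \<and> (\<lambda>s. (norm (u s))\<^sup>2) integrable_on S"

abbreviation sqnorm :: "real set \<Rightarrow> (real \<Rightarrow> 'u::real_inner) \<Rightarrow> real" where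
  "sqnorm S u \<equiv> integral S (\<lambda>s. (norm (u s))\<^sup>2)"

lemma measurable_on_inner:
  fixes u w :: "'a::euclidean_space \<Rightarrow> 'u::real_inner"
  assumes "u measurable_on S" "w measurable_on S"
  shows "(\<lambda>s. u s \<bullet> w s) measurable_on S"
  by (rule measurable_on_combine[OF assms]) (auto intro!: continuous_intros)

lemma measurable_on_subset:
  fixes u :: "'a::euclidean_space \<Rightarrow> 'u::real_normed_vector"
  assumes "u measurable_on S" "T \<subseteq> S" "T \<in> sets lebesgue"
  shows "u measurable_on T"
proof -
  have "(\<lambda>x. if x \<in> T then (if x \<in> S then u x else 0) else 0) measurable_on UNIV"
    by (rule measurable_on_restrict[OF iffD2[OF measurable_on_UNIV assms(1)] assms(3)])
  moreover have "(\<lambda>x. if x \<in> T then (if x \<in> S then u x else 0) else 0) = (\<lambda>x. if x \<in> T then u x else 0)"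
    using assms(2) by (auto simp: fun_eq_iff)
  ultimately show ?thesis using measurable_on_UNIV[of T u] by simp
qed

lemma integrable_on_subset_nonneg:
  fixes f :: "real \<Rightarrow> real"
  assumes "f integrable_on S" "\<And>x. x \<in> S \<Longrightarrow> 0 \<le> f x" "T \<subseteq> S" "T \<in> sets lebesgue"
  shows "f integrable_on T"
  using set_integrable_subset[OF nonnegative_absolutely_integrable_1[OF assms(1,2)] assms(4,3)]
  by (auto dest: set_lebesgue_integral_eq_integral(1))

lemma sqint_inner_absolutely_integrable:
  assumes "sqint S u" "sqint S w" "S \<in> sets lebesgue"
  shows "(\<lambda>s. u s \<bullet> w s) absolutely_integrable_on S"
proof (rule measurable_bounded_by_integrable_imp_absolutely_integrable)
  show "(\<lambda>s. u s \<bullet> w s) \<in> borel_measurable (lebesgue_on S)"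
    using assms measurable_on_inner measurable_on_iff_borel_measurable unfolding sqint_def by blast
  show "(\<lambda>s. (norm (u s))\<^sup>2 + (norm (w s))\<^sup>2) integrable_on S"
    using assms unfolding sqint_def by (auto intro: integrable_add)
  show "norm (u s \<bullet> w s) \<le> (norm (u s))\<^sup>2 + (norm (w s))\<^sup>2" for s
    using Cauchy_Schwarz_ineq2[of "u s" "w s"] sum_squares_bound[of "norm (u s)" "norm (w s)"]
      norm_ge_zero[of "u s"] norm_ge_zero[of "w s"] mult_nonneg_nonneg[of "norm (u s)" "norm (w s)"]
    unfolding real_norm_def by linarith
qed fact

lemma sqint_inner_integrable:
  assumes "sqint S u" "sqint S w" "S \<in> sets lebesgue"
  shows "(\<lambda>s. u s \<bullet> w s) integrable_on S"
  using set_lebesgue_integral_eq_integral(1)[OF sqint_inner_absolutely_integrable[OF assms]] .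

lemma sqint_norm_integrable: "sqint S u \<Longrightarrow> (\<lambda>s. (norm (u s))\<^sup>2) integrable_on S"
  by (simp add: sqint_def)

lemma sqint_zero [simp]: "sqint S (\<lambda>s. 0)"
  by (simp add: sqint_def integrable_0)

lemma sqint_scaleR: "sqint S u \<Longrightarrow> sqint S (\<lambda>s. c *\<^sub>R u s)"
  unfolding sqint_def by (auto simp: power_mult_distrib intro!: measurable_on_scaleR_const integrable_on_mult_right)

lemma norm_add_power2:
  fixes x y :: "'a::real_inner"
  shows "(norm (x + y))\<^sup>2 = (norm x)\<^sup>2 + 2 * (x \<bullet> y) + (norm y)\<^sup>2"
  by (simp add: power2_norm_eq_inner inner_add_left inner_add_right inner_commute)

lemma sqint_add:
  assumes "sqint S u" "sqint S w" "S \<in> sets lebesgue"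
  shows "sqint S (\<lambda>s. u s + w s)"
  unfolding sqint_def norm_add_power2 using assms sqint_inner_integrable[OF assms]
  by (auto simp: sqint_def intro!: measurable_on_add integrable_add integrable_on_mult_right)

lemma sqint_diff:
  assumes "sqint S u" "sqint S w" "S \<in> sets lebesgue"
  shows "sqint S (\<lambda>s. u s - w s)"
  using sqint_add[OF assms(1) sqint_scaleR[OF assms(2), of "-1"] assms(3)] by simp

lemma sqint_subset:
  assumes "sqint S u" "T \<subseteq> S" "T \<in> sets lebesgue"
  shows "sqint T u"
  using assms unfolding sqint_def by (auto intro: measurable_on_subset integrable_on_subset_nonneg)

lemma sqint_UNIV: "sqint UNIV (\<lambda>x. if x \<in> S then u x else 0) \<longleftrightarrow> sqint S u"
proof -
  have "(\<lambda>x. (norm (if x \<in> S then u x else 0))\<^sup>2) = (\<lambda>x. if x \<in> S then (norm (u x))\<^sup>2 else 0)" by auto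
  then show ?thesis
    unfolding sqint_def by (simp add: measurable_on_UNIV integrable_restrict_UNIV)
qed

lemma sqint_spike:
  assumes "sqint S u" "negligible N" "\<And>x. x \<in> S - N \<Longrightarrow> w x = u x"
  shows "sqint S w"
  using assms unfolding sqint_def
  by (auto intro: measurable_on_spike[of u S N] integrable_spike[where f = "\<lambda>s. (norm (u s))\<^sup>2" and S = N])

lemma continuous_on_imp_measurable_on_interval:
  fixes u :: "real \<Rightarrow> 'u::real_normed_vector"
  assumes "continuous_on {a..b} u"
  shows "u measurable_on {a..b}"
proof (cases "a \<le> b")
  case True
  \<comment> \<open>Clamping the argument extends \<open>u\<close> continuously to the whole line,
    constant beyond the endpoints.\<close>
  have "continuous_on UNIV (\<lambda>x. u (max a (min b x)))"
    by (rule continuous_on_compose2[OF assms]) (use True in \<open>auto intro!: continuous_intros\<close>)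
  then have "(\<lambda>x. if x \<in> {a..b} then u (max a (min b x)) else 0) measurable_on UNIV"
    by (intro measurable_on_restrict continuous_imp_measurable_on) auto
  moreover have "(\<lambda>x. if x \<in> {a..b} then u (max a (min b x)) else 0) = (\<lambda>x. if x \<in> {a..b} then u x else 0)"
    by (auto simp: max_def min_def)
  ultimately show ?thesis using measurable_on_UNIV[of "{a..b}" u] by simp
next
  case False
  then show ?thesis using measurable_on_UNIV[of "{a..b}" u] by simp
qed

lemma sqint_continuous:
  assumes "continuous_on {a..b} u"
  shows "sqint {a..b} u"
  unfolding sqint_def using assms
  by (auto intro!: continuous_on_imp_measurable_on_interval integrable_continuous_interval continuous_intros)

lemma sqint_const [simp]: "sqint {a..b} (\<lambda>s. c)"
  by (intro sqint_continuous continuous_intros)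

text \<open>The endpoints form a null set. Closed intervals are preferred from here on, since they
  can be cut at a point and shifted.\<close>

lemma L2_iff_sqint: "u \<in> L2 T \<longleftrightarrow> sqint {0..T} u"
proof -
  have neg: "negligible ({0<..<T} - {0..T} \<union> ({0..T} - {0<..<T}))"
    by (rule negligible_subset[of "{0, T}"]) auto
  have "u measurable_on {0<..<T} \<longleftrightarrow> u measurable_on {0..T}"
    using neg by (auto elim!: measurable_on_spike_set simp: Un_commute)
  moreover have "set_integrable lebesgue {0<..<T} (\<lambda>t. (norm (u t))\<^sup>2) \<longleftrightarrow> (\<lambda>t. (norm (u t))\<^sup>2) integrable_on {0<..<T}"
    by (rule absolutely_integrable_on_iff_nonneg) auto
  moreover have "(\<lambda>t. (norm (u t))\<^sup>2) integrable_on {0<..<T} \<longleftrightarrow> (\<lambda>t. (norm (u t))\<^sup>2) integrable_on {0..T}"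
    by (simp add: integrable_on_Icc_iff_Ioo)
  ultimately show ?thesis by (auto simp: L2_def sqint_def)
qed

lemma measurable_on_shift:
  fixes u :: "real \<Rightarrow> 'u::real_normed_vector"
  assumes "u measurable_on {a + c..b + c}"
  shows "(\<lambda>s. u (s + c)) measurable_on {a..b}"
proof -
  obtain N g where N: "negligible N" and g: "\<And>n. continuous_on UNIV (g n)"
    and lim: "\<And>x. x \<notin> N \<Longrightarrow> (\<lambda>n. g n x) \<longlonglongrightarrow> (if x \<in> {a + c..b + c} then u x else 0)"
    using assms unfolding measurable_on_def by metis
  have "negligible ((+) (- c) ` N)" using N by (rule negligible_translation)
  moreover have "continuous_on UNIV (\<lambda>x. g n (x + c))" for n
    by (rule continuous_on_compose2[OF g]) (auto intro!: continuous_intros)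
  moreover have "(\<lambda>n. g n (x + c)) \<longlonglongrightarrow> (if x \<in> {a..b} then u (x + c) else 0)" if "x \<notin> (+) (- c) ` N" for x
  proof -
    have "x + c \<notin> N" using that by (metis add.commute image_eqI minus_add_cancel)
    from lim[OF this] show ?thesis by simp
  qed
  ultimately show ?thesis unfolding measurable_on_def by (intro exI[of _ "(+) (- c) ` N"] exI[of _ "\<lambda>n x. g n (x + c)"]) auto
qed

lemma sqint_shift:
  assumes "sqint {a + c..b + c} u"
  shows "sqint {a..b} (\<lambda>s. u (s + c))"
  using assms integrable_on_shift_Icc_real[of "\<lambda>s. (norm (u s))\<^sup>2" c a b] unfolding sqint_def
  by (auto intro: measurable_on_shift simp: o_def add.commute)

lemma integral_cauchy_schwarz:
  assumes u: "sqint S u" and w: "sqint S w" and S: "S \<in> sets lebesgue"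
  shows "(integral S (\<lambda>s. u s \<bullet> w s))\<^sup>2 \<le> sqnorm S u * sqnorm S w"
proof -
  define a where "a = sqnorm S u"
  define b where "b = integral S (\<lambda>s. u s \<bullet> w s)"
  define c where "c = sqnorm S w"
  \<comment> \<open>Discriminant argument: this quadratic in \<open>t\<close> is the square norm of
    u + t w. Its minimum is at t = - b / c unless c = 0, where it is affine.\<close>
  have nonneg: "0 \<le> a + 2 * t * b + t\<^sup>2 * c" for t
  proof -
    have "0 \<le> sqnorm S (\<lambda>s. u s + t *\<^sub>R w s)"
      by (rule integral_nonneg) (use sqint_add[OF u sqint_scaleR[OF w] S] in \<open>auto simp: sqint_def\<close>)
    also have "\<dots> = integral S (\<lambda>s. (norm (u s))\<^sup>2 + 2 * t * (u s \<bullet> w s) + t\<^sup>2 * (norm (w s))\<^sup>2)"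
      by (simp add: norm_add_power2 power_mult_distrib mult.assoc)
    also have "\<dots> = a + 2 * t * b + t\<^sup>2 * c"
      using u w sqint_inner_integrable[OF u w S] unfolding a_def b_def c_def sqint_def
      by (subst integral_add integral_mult_right | auto intro!: integrable_add integrable_on_mult_right)+
    finally show ?thesis .
  qed
  have "c \<ge> 0" unfolding c_def by (rule integral_nonneg) (use w in \<open>auto simp: sqint_def\<close>)
  have "b\<^sup>2 \<le> a * c"
  proof (cases "c = 0")
    case True
    have "b = 0"
    proof (rule ccontr)
      assume "b \<noteq> 0"
      \<comment> \<open>This value of \<open>t\<close> makes the affine function equal to
        -1.\<close>
      then show False using nonneg[of "- (a + 1) / (2 * b)"] True by (simp add: field_simps)
    qed
    then show ?thesis using True by simp
  next
    case False
    then have "(- b / c)\<^sup>2 * c = b\<^sup>2 / c" "2 * (- b / c) * b = - 2 * (b\<^sup>2 / c)"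
      by (auto simp: power2_eq_square)
    then have "b\<^sup>2 / c \<le> a" using nonneg[of "- b / c"] by linarith
    with False \<open>c \<ge> 0\<close> show ?thesis by (simp add: pos_divide_le_eq)
  qed
  then show ?thesis by (simp add: a_def b_def c_def)
qed

lemma integral_inner_le_sqrt:
  assumes "sqint S u" "sqint S w" "S \<in> sets lebesgue"
  shows "\<bar>integral S (\<lambda>s. u s \<bullet> w s)\<bar>
    \<le> sqrt (sqnorm S u) * sqrt (sqnorm S w)"
  using real_sqrt_le_mono[OF integral_cauchy_schwarz[OF assms]] by (simp add: real_sqrt_mult)

text \<open>By monotone convergence the sum has finite integral, so it is finite almost everywhere.
  It supplies exceptional null sets both for limits of measurable functions and for completeness of
  the space of square integrable functions.\<close>

lemma AE_summable_nn_integral: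
  fixes f :: "nat \<Rightarrow> 'a \<Rightarrow> real"
  assumes meas: "\<And>n. f n \<in> borel_measurable M" and nn: "\<And>n x. 0 \<le> f n x"
    and le: "\<And>n. (\<integral>\<^sup>+x. f n x \<partial>M) \<le> ennreal (c n)" and "summable c" "\<And>n. 0 \<le> c n"
  shows "AE x in M. summable (\<lambda>n. f n x)"
proof -
  have "(\<integral>\<^sup>+x. (\<Sum>n. ennreal (f n x)) \<partial>M) = (\<Sum>n. \<integral>\<^sup>+x. f n x \<partial>M)"
    using meas by (intro nn_integral_suminf) auto
  also have "\<dots> \<le> (\<Sum>n. ennreal (c n))" by (intro suminf_le le) auto
  also have "\<dots> = ennreal (\<Sum>n. c n)" using assms(4,5) by (intro suminf_ennreal2) auto
  finally have "(\<integral>\<^sup>+x. (\<Sum>n. ennreal (f n x)) \<partial>M) \<noteq> \<infinity>" by (auto simp: top_unique)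
  then have "AE x in M. (\<Sum>n. ennreal (f n x)) \<noteq> \<infinity>"
    using meas by (intro nn_integral_noteq_infinite) auto
  then show ?thesis by eventually_elim (auto intro: summable_suminf_not_top nn)
qed

lemma AE_lebesgue_negligibleE:
  assumes "AE x in lebesgue. P x"
  obtains N where "negligible N" "\<And>x. x \<notin> N \<Longrightarrow> P x"
  using assms unfolding negligible_iff_null_sets by (auto elim!: AE_E3)

lemma negligible_imp_AE_lebesgue:
  assumes "negligible N" "\<And>x. x \<notin> N \<Longrightarrow> P x"
  shows "AE x in lebesgue. P x"
  using assms by (intro AE_I'[of N]) (auto simp: negligible_iff_null_sets)

text \<open>The library has this only for Euclidean ranges. Here each term is replaced by one of the continuous
  functions approximating it, chosen close in measure on a growing interval.\<close>

lemma measurable_on_UNIV_limit: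
  fixes f :: "nat \<Rightarrow> real \<Rightarrow> 'b::real_normed_vector"
  assumes f: "\<And>n. f n measurable_on UNIV" and N: "negligible N"
    and lim: "\<And>x. x \<notin> N \<Longrightarrow> (\<lambda>n. f n x) \<longlonglongrightarrow> g x"
  shows "g measurable_on UNIV"
proof -
  obtain Z G where Z: "\<And>n. negligible (Z n)" and G: "\<And>n k. continuous_on UNIV (G n k)"
    and Gf: "\<And>n x. x \<notin> Z n \<Longrightarrow> (\<lambda>k. G n k x) \<longlonglongrightarrow> f n x"
    using f unfolding measurable_on_def by simp metis
  \<comment> \<open>The cut-off at 1 and the indicator supply a dominating function of finite
    integral. Both become inactive at a given \<open>x\<close>: the interval eventually contains
    \<open>x\<close>, and once the value is below 1 it equals the norm.\<close>
  define h where "h n k x = min 1 (norm (G n k x - f n x)) * indicator {- real n..real n} x" for n k x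
  have h_meas: "h n k \<in> borel_measurable lebesgue" for n k
  proof -
    have "((\<lambda>y. min 1 (norm y)) \<circ> (\<lambda>x. G n k x - f n x)) measurable_on UNIV"
      by (intro measurable_on_compose_continuous measurable_on_diff f continuous_imp_measurable_on G
          continuous_intros)
    then have "(\<lambda>x. min 1 (norm (G n k x - f n x))) \<in> borel_measurable lebesgue"
      by (simp add: o_def measurable_on_imp_borel_measurable_lebesgue_UNIV)
    then show ?thesis unfolding h_def by (intro borel_measurable_times borel_measurable_indicator) auto
  qed
  have "\<exists>k. (\<integral>\<^sup>+x. h n k x \<partial>lebesgue) \<le> ennreal ((1/2)^n)" for n
  proof -
    have "(\<lambda>k. \<integral>\<^sup>+x. h n k x \<partial>lebesgue) \<longlonglongrightarrow> (\<integral>\<^sup>+x. 0 \<partial>(lebesgue :: real measure))"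
    proof (rule nn_integral_dominated_convergence[where w = "indicator {- real n..real n}"
          and u = "\<lambda>k x. ennreal (h n k x)" and u' = "\<lambda>_. 0"])
      show "AE x in lebesgue. ennreal (h n k x) \<le> indicator {- real n..real n} x" for k
        by (rule AE_I2) (auto simp: h_def indicator_def)
      show "(\<integral>\<^sup>+x. indicator {- real n..real n} x \<partial>lebesgue) < \<infinity>" by simp
      have "(\<lambda>k. ennreal (h n k x)) \<longlonglongrightarrow> 0" if "x \<notin> Z n" for x
      proof -
        have "(\<lambda>k. min 1 (norm (G n k x - f n x)) * indicator {- real n..real n} x)
            \<longlonglongrightarrow> min 1 (norm (f n x - f n x)) * indicator {- real n..real n} x"
          by (intro tendsto_intros Gf that)
        then have "(\<lambda>k. h n k x) \<longlonglongrightarrow> 0" by (simp add: h_def)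
        then show ?thesis using tendsto_ennrealI by fastforce
      qed
      then show "AE x in lebesgue. (\<lambda>k. ennreal (h n k x)) \<longlonglongrightarrow> 0"
        by (rule negligible_imp_AE_lebesgue[OF Z])
    qed (use h_meas in \<open>auto intro!: borel_measurable_indicator\<close>)
    then have "\<forall>\<^sub>F k in sequentially. (\<integral>\<^sup>+x. h n k x \<partial>lebesgue) < ennreal ((1/2)^n)"
      by (intro order_tendstoD(2)) auto
    then show ?thesis by (meson eventually_sequentially less_imp_le order_refl)
  qed
  then obtain k where k: "\<And>n. (\<integral>\<^sup>+x. h n (k n) x \<partial>lebesgue) \<le> ennreal ((1/2)^n)" by metis
  have "AE x in lebesgue. summable (\<lambda>n. h n (k n) x)"
    by (rule AE_summable_nn_integral[OF h_meas _ k]) (auto simp: h_def)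
  then obtain M where M: "negligible M" "\<And>x. x \<notin> M \<Longrightarrow> summable (\<lambda>n. h n (k n) x)"
    by (rule AE_lebesgue_negligibleE) blast
  have "(\<lambda>n. G n (k n) x) \<longlonglongrightarrow> g x" if x: "x \<notin> N \<union> M" for x
  proof -
    have h0: "(\<lambda>n. h n (k n) x) \<longlonglongrightarrow> 0" using M(2) x by (intro summable_LIMSEQ_zero) auto
    obtain n0 :: nat where n0: "\<bar>x\<bar> \<le> real n0" using real_arch_simple by blast
    have "\<forall>\<^sub>F n in sequentially. norm (G n (k n) x - f n x) \<le> h n (k n) x"
      using order_tendstoD(2)[OF h0 zero_less_one] eventually_ge_at_top[of n0]
    proof eventually_elim
      case (elim n)
      then have "x \<in> {- real n..real n}" using n0 by auto
      with elim show ?case by (auto simp: h_def)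
    qed
    then have "(\<lambda>n. G n (k n) x - f n x) \<longlonglongrightarrow> 0"
      by (rule Lim_null_comparison) (fact h0)
    from tendsto_add[OF this lim[of x]] x show ?thesis by simp
  qed
  then show ?thesis
    unfolding measurable_on_def using N M(1) G
    by (intro exI[of _ "N \<union> M"] exI[of _ "\<lambda>n. G n (k n)"]) auto
qed

lemma sqint_fast_cauchy_limit:
  fixes f :: "nat \<Rightarrow> real \<Rightarrow> 'u::{real_inner, banach}"
  assumes f: "\<And>n. sqint UNIV (f n)"
    and fast: "\<And>n. sqnorm UNIV (\<lambda>x. f (Suc n) x - f n x) \<le> (1/4)^n"
  shows "\<exists>N g. negligible N \<and> g measurable_on UNIV \<and> (\<forall>x. x \<notin> N \<longrightarrow> (\<lambda>n. f n x) \<longlonglongrightarrow> g x)"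
proof -
  \<comment> \<open>The weight 2^n balances two needs: the integrals of \<open>d n\<close> stay
    below (1/2)^n, and by the arithmetic-geometric inequality the norm of the n-th increment is at
    most \<open>d n x + (1/2)^n\<close>. So the increments are absolutely summable almost
    everywhere.\<close>
  define d where "d n x = 2^n * (norm (f (Suc n) x - f n x))\<^sup>2" for n x
  have d_int: "(d n has_integral 2^n * sqnorm UNIV (\<lambda>x. f (Suc n) x - f n x)) UNIV" for n
    unfolding d_def using sqint_diff[OF f f, of "Suc n" n]
    by (intro has_integral_mult_right integrable_integral) (auto simp: sqint_def)
  have "AE x in lebesgue. summable (\<lambda>n. d n x)"
  proof (rule AE_summable_nn_integral)
    fix n
    have D: "d n \<in> borel_measurable lebesgue \<and>
        (\<integral>\<^sup>+x. d n x \<partial>lebesgue) = ennreal (2^n * sqnorm UNIV (\<lambda>x. f (Suc n) x - f n x))"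
      using d_int[of n] by (subst (asm) has_integral_iff_nn_integral_lebesgue) (auto simp: d_def)
    then show "d n \<in> borel_measurable lebesgue" by simp
    have "2^n * sqnorm UNIV (\<lambda>x. f (Suc n) x - f n x) \<le> 2^n * (1/4)^n"
      by (intro mult_left_mono fast) auto
    also have "\<dots> = (1/2)^n" by (simp flip: power_mult_distrib)
    finally show "(\<integral>\<^sup>+x. d n x \<partial>lebesgue) \<le> ennreal ((1/2)^n)" using D by (simp add: ennreal_leI)
  qed (auto simp: d_def)
  then obtain N where N: "negligible N" "\<And>x. x \<notin> N \<Longrightarrow> summable (\<lambda>n. d n x)"
    by (rule AE_lebesgue_negligibleE) blast
  have "convergent (\<lambda>n. f n x)" if x: "x \<notin> N" for x
  proof -
    have "summable (\<lambda>n. d n x + (1/2)^n)" by (intro summable_add N x) auto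
    moreover have "norm (norm (f (Suc n) x - f n x)) \<le> d n x + (1/2)^n" for n
    proof -
      have "0 \<le> (2^n * norm (f (Suc n) x - f n x) - 1)\<^sup>2 * (1/2)^n" by simp
      also have "\<dots> = d n x - 2 * norm (f (Suc n) x - f n x) + (1/2)^n"
        by (simp add: d_def power2_eq_square field_simps)
      finally show ?thesis by simp (use norm_ge_zero[of "f (Suc n) x - f n x"] in argo)
    qed
    ultimately have "summable (\<lambda>n. norm (f (Suc n) x - f n x))"
      by (rule summable_comparison_test'[where N = 0])
    then have "summable (\<lambda>n. f (Suc n) x - f n x)" by (rule summable_norm_cancel)
    then have "convergent (\<lambda>n. \<Sum>i<n. f (Suc i) x - f i x)" by (simp add: summable_iff_convergent)
    moreover have "(\<Sum>i<n. f (Suc i) x - f i x) = f n x - f 0 x" for n by (rule sum_lessThan_telescope)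
    ultimately have "convergent (\<lambda>n. f n x - f 0 x)" by simp
    from convergent_add[OF this convergent_const[of "f 0 x"]] show ?thesis by simp
  qed
  then have lim: "(\<lambda>n. f n x) \<longlonglongrightarrow> lim (\<lambda>n. f n x)" if "x \<notin> N" for x
    using that convergent_LIMSEQ_iff by blast
  have "(\<lambda>x. lim (\<lambda>n. f n x)) measurable_on UNIV"
    by (rule measurable_on_UNIV_limit[OF _ N(1) lim]) (use f in \<open>auto simp: sqint_def\<close>)
  with N lim show ?thesis by blast
qed

text \<open>Fatou's lemma on the squared norms; no dominating function is at hand. Applied to
  differences, it measures the distance from a pointwise limit to a member of the sequence.\<close>

lemma sqint_fatou:
  fixes f :: "nat \<Rightarrow> real \<Rightarrow> 'u::real_inner"
  assumes f: "\<And>n. sqint UNIV (f n)" and bound: "\<And>n. sqnorm UNIV (\<lambda>x. f n x) \<le> c"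
    and N: "negligible N" and lim: "\<And>x. x \<notin> N \<Longrightarrow> (\<lambda>n. f n x) \<longlonglongrightarrow> g x"
  shows "sqint UNIV g" "sqnorm UNIV g \<le> c"
proof -
  have g: "g measurable_on UNIV"
    by (rule measurable_on_UNIV_limit[OF _ N lim]) (use f in \<open>auto simp: sqint_def\<close>)
  have c: "0 \<le> c"
    by (rule order.trans[OF integral_nonneg bound[of 0]]) (use f in \<open>auto simp: sqint_def\<close>)
  have "(\<lambda>x. g x \<bullet> g x) \<in> borel_measurable lebesgue"
    by (intro measurable_on_imp_borel_measurable_lebesgue_UNIV measurable_on_inner g)
  then have gm: "(\<lambda>x. (norm (g x))\<^sup>2) \<in> borel_measurable lebesgue" by (simp add: power2_norm_eq_inner)
  have F: "(\<lambda>x. (norm (f n x))\<^sup>2) \<in> borel_measurable lebesgue \<and>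
      (\<integral>\<^sup>+x. ennreal ((norm (f n x))\<^sup>2) \<partial>lebesgue) = ennreal (sqnorm UNIV (\<lambda>x. f n x))" for n
    using integrable_integral[OF sqint_norm_integrable[OF f[of n]]]
    by (subst (asm) has_integral_iff_nn_integral_lebesgue) auto
  have "(\<integral>\<^sup>+x. ennreal ((norm (g x))\<^sup>2) \<partial>lebesgue)
      = (\<integral>\<^sup>+x. liminf (\<lambda>n. ennreal ((norm (f n x))\<^sup>2)) \<partial>lebesgue)"
  proof (intro nn_integral_cong_AE negligible_imp_AE_lebesgue[OF N])
    fix x assume "x \<notin> N"
    then have "(\<lambda>n. ennreal ((norm (f n x))\<^sup>2)) \<longlonglongrightarrow> ennreal ((norm (g x))\<^sup>2)"
      by (intro tendsto_ennrealI tendsto_intros lim)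
    then show "ennreal ((norm (g x))\<^sup>2) = liminf (\<lambda>n. ennreal ((norm (f n x))\<^sup>2))"
      by (rule lim_imp_Liminf[symmetric, OF sequentially_bot])
  qed
  also have "\<dots> \<le> liminf (\<lambda>n. \<integral>\<^sup>+x. ennreal ((norm (f n x))\<^sup>2) \<partial>lebesgue)"
    using F by (intro nn_integral_liminf) auto
  also have "\<dots> \<le> ennreal c"
    using F bound by (intro Liminf_le) (auto intro!: always_eventually ennreal_leI)
  finally have le: "(\<integral>\<^sup>+x. ennreal ((norm (g x))\<^sup>2) \<partial>lebesgue) \<le> ennreal c" .
  then obtain r where r: "0 \<le> r" "(\<integral>\<^sup>+x. ennreal ((norm (g x))\<^sup>2) \<partial>lebesgue) = ennreal r"
    by (metis ennreal_cases neq_top_trans ennreal_neq_top)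
  then have hi: "((\<lambda>x. (norm (g x))\<^sup>2) has_integral r) UNIV"
    using gm by (subst has_integral_iff_nn_integral_lebesgue) auto
  then show "sqint UNIV g" using g by (auto simp: sqint_def)
  show "sqnorm UNIV g \<le> c"
    using le r c integral_unique[OF hi] by simp
qed

lemma sqint_integral_eq_0:
  assumes "sqint UNIV f" "sqnorm UNIV f = 0"
  shows "negligible {x. f x \<noteq> 0}"
proof -
  have "((\<lambda>x. (norm (f x))\<^sup>2) has_integral 0) UNIV"
    using assms integrable_integral[of "\<lambda>x. (norm (f x))\<^sup>2" UNIV] by (auto simp: sqint_def)
  then have F: "(\<lambda>x. (norm (f x))\<^sup>2) \<in> borel_measurable lebesgue \<and>
      (\<integral>\<^sup>+x. ennreal ((norm (f x))\<^sup>2) \<partial>lebesgue) = 0"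
    by (subst (asm) has_integral_iff_nn_integral_lebesgue) auto
  then have "AE x in lebesgue. ennreal ((norm (f x))\<^sup>2) = 0"
    using nn_integral_0_iff_AE[of "\<lambda>x. ennreal ((norm (f x))\<^sup>2)" lebesgue] by auto
  then obtain N where "negligible N" "\<And>x. x \<notin> N \<Longrightarrow> ennreal ((norm (f x))\<^sup>2) = 0"
    by (rule AE_lebesgue_negligibleE) blast
  then have "f x = 0" if "x \<notin> N" for x using that by simp
  with \<open>negligible N\<close> show ?thesis by (blast intro: negligible_subset)
qed

section \<open>The Hilbert space of square integrable functions\<close>

text \<open>A partial equivalence: requiring both sides to be square integrable makes the quotient
  exactly the Hilbert space. It is taken over the whole line so that one type serves all horizons;
  intervals enter through extension by zero.\<close>

definition ae_eq_sqint :: "(real \<Rightarrow> 'u::real_inner) \<Rightarrow> (real \<Rightarrow> 'u) \<Rightarrow> bool" where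
  "ae_eq_sqint f g \<longleftrightarrow> sqint UNIV f \<and> sqint UNIV g \<and> negligible {x. f x \<noteq> g x}"

lemma part_equivp_ae_eq_sqint: "part_equivp (ae_eq_sqint :: (real \<Rightarrow> 'a::real_inner) \<Rightarrow> _)"
proof (rule part_equivpI)
  show "\<exists>x :: real \<Rightarrow> 'a. ae_eq_sqint x x" by (intro exI[of _ "\<lambda>_. 0"]) (simp add: ae_eq_sqint_def)
  show "symp (ae_eq_sqint :: (real \<Rightarrow> 'a) \<Rightarrow> _)" by (auto simp: symp_def ae_eq_sqint_def eq_commute)
  show "transp (ae_eq_sqint :: (real \<Rightarrow> 'a) \<Rightarrow> _)"
    unfolding transp_def ae_eq_sqint_def
  proof (intro allI impI conjI)
    fix f g h :: "real \<Rightarrow> 'a"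
    assume *: "sqint UNIV f \<and> sqint UNIV g \<and> negligible {x. f x \<noteq> g x}"
      "sqint UNIV g \<and> sqint UNIV h \<and> negligible {x. g x \<noteq> h x}"
    then show "sqint UNIV f" "sqint UNIV h" by auto
    have "negligible ({x. f x \<noteq> g x} \<union> {x. g x \<noteq> h x})" using * by auto
    then show "negligible {x. f x \<noteq> h x}" by (rule negligible_subset) auto
  qed
qed

quotient_type (overloaded) 'u l2 = "real \<Rightarrow> 'u::real_inner" / partial: ae_eq_sqint
  by (rule part_equivp_ae_eq_sqint)

lemma integral_inner_self_eq_0_iff:
  assumes "sqint UNIV f"
  shows "integral UNIV (\<lambda>x. f x \<bullet> f x) = 0 \<longleftrightarrow> negligible {x. f x \<noteq> 0}"
proof
  assume "integral UNIV (\<lambda>x. f x \<bullet> f x) = 0"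
  then show "negligible {x. f x \<noteq> 0}"
    using assms by (intro sqint_integral_eq_0) (simp_all add: power2_norm_eq_inner)
next
  assume "negligible {x. f x \<noteq> 0}"
  then have "integral UNIV (\<lambda>x. f x \<bullet> f x) = integral UNIV (\<lambda>x::real. 0)"
    by (rule integral_spike) auto
  then show "integral UNIV (\<lambda>x. f x \<bullet> f x) = 0" by simp
qed

instantiation l2 :: (real_inner) real_inner
begin

lift_definition zero_l2 :: "'a l2" is "\<lambda>_. 0"
  by (simp add: ae_eq_sqint_def)

lift_definition plus_l2 :: "'a l2 \<Rightarrow> 'a l2 \<Rightarrow> 'a l2" is "\<lambda>f g x. f x + g x"
  unfolding ae_eq_sqint_def
  by (auto intro!: sqint_add) (rule negligible_subset[OF negligible_Un], assumption, assumption, auto)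

lift_definition scaleR_l2 :: "real \<Rightarrow> 'a l2 \<Rightarrow> 'a l2" is "\<lambda>c f x. c *\<^sub>R f x"
  unfolding ae_eq_sqint_def by (auto intro!: sqint_scaleR) (erule negligible_subset, auto)

lift_definition uminus_l2 :: "'a l2 \<Rightarrow> 'a l2" is "\<lambda>f x. - f x"
  unfolding ae_eq_sqint_def using sqint_scaleR[of UNIV _ "-1"] by auto

lift_definition minus_l2 :: "'a l2 \<Rightarrow> 'a l2 \<Rightarrow> 'a l2" is "\<lambda>f g x. f x - g x"
  unfolding ae_eq_sqint_def
  by (auto intro!: sqint_diff) (rule negligible_subset[OF negligible_Un], assumption, assumption, auto)

lift_definition inner_l2 :: "'a l2 \<Rightarrow> 'a l2 \<Rightarrow> real" is "\<lambda>f g. integral UNIV (\<lambda>x. f x \<bullet> g x)"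
proof -
  fix f f' g g' :: "real \<Rightarrow> 'a"
  assume "ae_eq_sqint f f'" "ae_eq_sqint g g'"
  then have "negligible ({x. f x \<noteq> f' x} \<union> {x. g x \<noteq> g' x})" by (auto simp: ae_eq_sqint_def)
  then show "integral UNIV (\<lambda>x. f x \<bullet> g x) = integral UNIV (\<lambda>x. f' x \<bullet> g' x)"
    by (rule integral_spike) auto
qed

definition "norm_l2 (x :: 'a l2) = sqrt (x \<bullet> x)"
definition "sgn_l2 (x :: 'a l2) = inverse (norm x) *\<^sub>R x"
definition "dist_l2 (x :: 'a l2) y = norm (x - y)"
definition "uniformity_l2 = (INF e\<in>{0<..}. principal {(x :: 'a l2, y). dist x y < e})"
definition "open_l2 (U :: 'a l2 set) \<longleftrightarrow> (\<forall>x\<in>U. eventually (\<lambda>(x', y). x' = x \<longrightarrow> y \<in> U) uniformity)"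

instance
proof
  fix x y z :: "'a l2" and a b :: real
  show "x + y + z = x + (y + z)"
    by transfer (auto simp: ae_eq_sqint_def add.assoc intro!: sqint_add)
  show "x + y = y + x"
    by transfer (auto simp: ae_eq_sqint_def add.commute intro!: sqint_add)
  show "0 + x = x" by transfer (auto simp: ae_eq_sqint_def)
  show "- x + x = 0" by transfer (auto simp: ae_eq_sqint_def)
  show "x - y = x + - y"
    by transfer (auto simp: ae_eq_sqint_def intro!: sqint_diff)
  show "a *\<^sub>R (x + y) = a *\<^sub>R x + a *\<^sub>R y"
    by transfer (auto simp: ae_eq_sqint_def scaleR_right_distrib intro!: sqint_add sqint_scaleR)
  show "(a + b) *\<^sub>R x = a *\<^sub>R x + b *\<^sub>R x"
    by transfer (auto simp: ae_eq_sqint_def scaleR_left_distrib intro!: sqint_add sqint_scaleR)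
  show "a *\<^sub>R b *\<^sub>R x = (a * b) *\<^sub>R x"
    by transfer (auto simp: ae_eq_sqint_def intro!: sqint_scaleR)
  show "1 *\<^sub>R x = x" by transfer (auto simp: ae_eq_sqint_def)
  show "x \<bullet> y = y \<bullet> x" by transfer (simp add: inner_commute)
  show "(x + y) \<bullet> z = x \<bullet> z + y \<bullet> z"
    by transfer (auto simp: ae_eq_sqint_def inner_add_left intro!: integral_add sqint_inner_integrable)
  show "a *\<^sub>R x \<bullet> y = a * (x \<bullet> y)"
    by transfer simp
  show "0 \<le> x \<bullet> x"
    by transfer (simp add: ae_eq_sqint_def integral_nonneg sqint_inner_integrable)
  show "(x \<bullet> x = 0) = (x = 0)"
    by transfer (simp add: ae_eq_sqint_def integral_inner_self_eq_0_iff)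
  show "norm x = sqrt (x \<bullet> x)" by (rule norm_l2_def)
  show "sgn x = inverse (norm x) *\<^sub>R x" by (rule sgn_l2_def)
  show "dist x y = norm (x - y)" by (rule dist_l2_def)
  show "uniformity = (INF e\<in>{0<..}. principal {(x :: 'a l2, y). dist x y < e})"
    by (rule uniformity_l2_def)
  show "open U \<longleftrightarrow> (\<forall>x\<in>U. eventually (\<lambda>(x', y). x' = x \<longrightarrow> y \<in> U) uniformity)" for U :: "'a l2 set"
    by (rule open_l2_def)
qed

end

lemma abs_rep_l2: "abs_l2 (rep_l2 X) = X"
  by (rule Quotient3_abs_rep[OF Quotient3_l2])

lemma sqint_rep_l2: "sqint UNIV (rep_l2 X)"
  using Quotient3_rep_reflp[OF Quotient3_l2, of X] by (simp add: ae_eq_sqint_def)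

lemma l2_representative: "\<exists>f. sqint UNIV f \<and> X = abs_l2 f"
  by (intro exI[of _ "rep_l2 X"]) (simp add: sqint_rep_l2 abs_rep_l2)

lemma inner_abs_l2:
  assumes "sqint UNIV f" "sqint UNIV g"
  shows "abs_l2 f \<bullet> abs_l2 g = integral UNIV (\<lambda>x. f x \<bullet> g x)"
  using assms by (intro inner_l2.abs_eq) (auto simp: ae_eq_sqint_def)

lemma diff_abs_l2:
  assumes "sqint UNIV f" "sqint UNIV g"
  shows "abs_l2 f - abs_l2 g = abs_l2 (\<lambda>x. f x - g x)"
  using assms by (intro minus_l2.abs_eq) (auto simp: ae_eq_sqint_def)

lemma add_abs_l2:
  assumes "sqint UNIV f" "sqint UNIV g"
  shows "abs_l2 f + abs_l2 g = abs_l2 (\<lambda>x. f x + g x)"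
  using assms by (intro plus_l2.abs_eq) (auto simp: ae_eq_sqint_def)

lemma scaleR_abs_l2:
  assumes "sqint UNIV f"
  shows "c *\<^sub>R abs_l2 f = abs_l2 (\<lambda>x. c *\<^sub>R f x)"
  using assms by (intro scaleR_l2.abs_eq) (auto simp: ae_eq_sqint_def)

lemma norm_abs_l2:
  assumes "sqint UNIV f"
  shows "(norm (abs_l2 f))\<^sup>2 = sqnorm UNIV f"
  using inner_abs_l2[OF assms assms] by (simp add: power2_norm_eq_inner)

lemma abs_l2_eq_iff:
  assumes "sqint UNIV f" "sqint UNIV g"
  shows "abs_l2 f = abs_l2 g \<longleftrightarrow> negligible {x. f x \<noteq> g x}"
  using assms Quotient3_rel[OF Quotient3_l2, of f g] by (auto simp: ae_eq_sqint_def)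

lemma rep_l2_ae:
  assumes "sqint UNIV f"
  shows "negligible {x. rep_l2 (abs_l2 f) x \<noteq> f x}"
  using abs_l2_eq_iff[OF sqint_rep_l2 assms] abs_rep_l2 by blast

text \<open>Riesz-Fischer: a fast subsequence converges almost everywhere, and Fatou along it bounds
  the distance from the limit to every late member of the full sequence.\<close>

instance l2 :: ("{real_inner, banach}") banach
proof
  fix X :: "nat \<Rightarrow> 'a l2"
  assume X: "Cauchy X"
  have "\<exists>N. \<forall>m\<ge>N. \<forall>n\<ge>N. norm (X m - X n) < (1/2)^k" for k :: nat
    by (rule CauchyD[OF X]) simp
  then obtain M where M: "\<And>k m n. m \<ge> M k \<Longrightarrow> n \<ge> M k \<Longrightarrow> norm (X m - X n) < (1/2)^k" by metis
  \<comment> \<open>The sum makes \<open>r k\<close> and \<open>r (Suc k)\<close> both at least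
    \<open>M k\<close>; the added \<open>k\<close> makes \<open>r (i + M k)\<close> at least
    \<open>M k\<close> for every \<open>i\<close>.\<close>
  define r where "r k = (\<Sum>i\<le>k. M i) + k" for k
  have rM: "r k \<ge> M k" for k unfolding r_def by (simp add: member_le_sum trans_le_add1)
  have rk: "r k \<ge> k" for k by (simp add: r_def)
  have rM': "r (Suc k) \<ge> M k" for k
    using rM[of k] by (simp add: r_def)
  obtain f where f: "\<And>n. sqint UNIV (f n)" and Xf: "\<And>n. X n = abs_l2 (f n)"
    using l2_representative[of "X _"] by metis
  have norm_diff: "(norm (X m - X n))\<^sup>2 = sqnorm UNIV (\<lambda>x. f m x - f n x)" for m n
    by (simp add: Xf diff_abs_l2 f norm_abs_l2 sqint_diff)
  have "sqnorm UNIV (\<lambda>x. f (r (Suc n)) x - f (r n) x) \<le> (1/4)^n" for n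
  proof -
    have "(norm (X (r (Suc n)) - X (r n)))\<^sup>2 \<le> ((1/2)^n)\<^sup>2"
      by (rule power_mono) (use M[OF rM' rM, of n] in auto)
    moreover have "((1/2)^n)\<^sup>2 = ((1/4)^n :: real)"
      by (simp add: power2_eq_square flip: power_mult_distrib)
    ultimately show ?thesis by (simp add: norm_diff)
  qed
  from sqint_fast_cauchy_limit[of "\<lambda>n. f (r n)", OF f this]
  obtain N g where N: "negligible N" and lim: "\<And>x. x \<notin> N \<Longrightarrow> (\<lambda>n. f (r n) x) \<longlonglongrightarrow> g x" by blast
  have bound: "sqint UNIV (\<lambda>x. g x - f n x)" "sqnorm UNIV (\<lambda>x. g x - f n x) \<le> ((1/2)^k)\<^sup>2"
    if "n \<ge> M k" for n k
  proof -
    have le: "sqnorm UNIV (\<lambda>x. f (r (i + M k)) x - f n x) \<le> ((1/2)^k)\<^sup>2" for i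
      unfolding norm_diff[symmetric]
      by (rule power_mono) (use M[of k "r (i + M k)" n] rk[of "i + M k"] that in auto)
    have "(\<lambda>i. f (r (i + M k)) x - f n x) \<longlonglongrightarrow> g x - f n x" if "x \<notin> N" for x
      by (intro tendsto_intros LIMSEQ_ignore_initial_segment[where f = "\<lambda>i. f (r i) x"] lim that)
    from sqint_fatou[OF sqint_diff[OF f f] le N this]
    show "sqint UNIV (\<lambda>x. g x - f n x)" "sqnorm UNIV (\<lambda>x. g x - f n x) \<le> ((1/2)^k)\<^sup>2"
      by auto
  qed
  have g: "sqint UNIV g" using sqint_add[OF bound(1)[OF order_refl, of 0] f[of "M 0"]] by simp
  have "X \<longlonglongrightarrow> abs_l2 g"
    unfolding LIMSEQ_iff
  proof (intro allI impI)
    fix e :: real assume "e > 0"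
    then obtain k :: nat where k: "(1/2)^k < e" using real_arch_pow_inv[of e "1/2"] by force
    have "norm (X n - abs_l2 g) < e" if "n \<ge> M k" for n
    proof -
      have "(norm (abs_l2 g - X n))\<^sup>2 \<le> ((1/2)^k)\<^sup>2"
        using bound[OF that] by (simp add: Xf diff_abs_l2 f g norm_abs_l2)
      then have "norm (abs_l2 g - X n) \<le> (1/2)^k" by (rule power2_le_imp_le) simp
      then show ?thesis using k by (simp add: norm_minus_commute)
    qed
    then show "\<exists>n0. \<forall>n\<ge>n0. norm (X n - abs_l2 g) < e" by blast
  qed
  then show "convergent X" by (auto simp: convergent_def)
qed

definition embed_l2 :: "real \<Rightarrow> real \<Rightarrow> (real \<Rightarrow> 'u::real_inner) \<Rightarrow> 'u l2" where
  "embed_l2 a b u = abs_l2 (\<lambda>x. if x \<in> {a..b} then u x else 0)"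

lemma inner_embed_l2:
  assumes "sqint {a..b} u" "sqint {a..b} w"
  shows "embed_l2 a b u \<bullet> embed_l2 a b w = integral {a..b} (\<lambda>x. u x \<bullet> w x)"
proof -
  have "embed_l2 a b u \<bullet> embed_l2 a b w
      = integral UNIV (\<lambda>x. (if x \<in> {a..b} then u x else 0) \<bullet> (if x \<in> {a..b} then w x else 0))"
    unfolding embed_l2_def by (intro inner_abs_l2 iffD2[OF sqint_UNIV] assms)
  also have "\<dots> = integral UNIV (\<lambda>x. if x \<in> {a..b} then u x \<bullet> w x else 0)"
    by (intro integral_cong) auto
  also have "\<dots> = integral {a..b} (\<lambda>x. u x \<bullet> w x)" by (rule integral_restrict_UNIV)
  finally show ?thesis .
qed

lemma norm_embed_l2:
  assumes "sqint {a..b} u"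
  shows "(norm (embed_l2 a b u))\<^sup>2 = sqnorm {a..b} u"
  using inner_embed_l2[OF assms assms] by (simp add: power2_norm_eq_inner)

lemma inner_embed_l2_representative:
  assumes "sqint UNIV f" "sqint {a..b} w"
  shows "abs_l2 f \<bullet> embed_l2 a b w = integral {a..b} (\<lambda>x. f x \<bullet> w x)"
proof -
  have "abs_l2 f \<bullet> embed_l2 a b w = integral UNIV (\<lambda>x. f x \<bullet> (if x \<in> {a..b} then w x else 0))"
    unfolding embed_l2_def by (intro inner_abs_l2 iffD2[OF sqint_UNIV] assms)
  also have "\<dots> = integral UNIV (\<lambda>x. if x \<in> {a..b} then f x \<bullet> w x else 0)"
    by (intro integral_cong) auto
  also have "\<dots> = integral {a..b} (\<lambda>x. f x \<bullet> w x)" by (rule integral_restrict_UNIV)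
  finally show ?thesis .
qed

text \<open>Pairing with \<open>G i\<close> is a bounded functional on the complete space
  \<open>'u l2\<close>, and its norm controls that of \<open>G i\<close>; pointwise boundedness
  therefore becomes a uniform bound.\<close>

lemma weakly_bounded_l2:
  fixes G :: "'i \<Rightarrow> real \<Rightarrow> 'u::{real_inner, banach}"
  assumes G: "\<And>i. i \<in> I \<Longrightarrow> sqint {a..b} (G i)"
    and bound: "\<And>u. sqint {a..b} u \<Longrightarrow> \<exists>K. \<forall>i\<in>I. \<bar>integral {a..b} (\<lambda>s. u s \<bullet> G i s)\<bar> \<le> K"
  shows "\<exists>K. \<forall>i\<in>I. sqnorm {a..b} (\<lambda>s. G i s) \<le> K"
proof -
  have "\<exists>K. \<forall>f \<in> (\<lambda>i. blinfun_inner_left (embed_l2 a b (G i))) ` I. norm f \<le> K"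
  proof (rule banach_steinhaus)
    fix X :: "'u l2"
    obtain f where f: "sqint UNIV f" "X = abs_l2 f" using l2_representative by blast
    have "sqint {a..b} f" using sqint_subset[OF f(1)] by auto
    then obtain K where "\<forall>i\<in>I. \<bar>integral {a..b} (\<lambda>s. f s \<bullet> G i s)\<bar> \<le> K" using bound by blast
    then show "\<exists>K. \<forall>h \<in> (\<lambda>i. blinfun_inner_left (embed_l2 a b (G i))) ` I. norm (h X) \<le> K"
      using f G by (intro exI[of _ K])
        (auto simp: inner_embed_l2_representative inner_commute[of "embed_l2 a b _"])
  qed
  then obtain K where K: "\<And>i. i \<in> I \<Longrightarrow> norm (blinfun_inner_left (embed_l2 a b (G i))) \<le> K" by auto
  have "sqnorm {a..b} (\<lambda>s. G i s) \<le> K\<^sup>2" if i: "i \<in> I" for i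
  proof -
    let ?g = "embed_l2 a b (G i)"
    have K0: "0 \<le> K" using K[OF i] norm_ge_zero order_trans by blast
    have "norm ?g \<le> K"
    proof (rule norm_le_if_inner_le[OF _ K0])
      fix x :: "'u l2"
      have "x \<bullet> ?g \<le> norm (blinfun_inner_left ?g x)" by (simp add: inner_commute)
      also have "\<dots> \<le> K * norm x"
        by (rule order.trans[OF norm_blinfun]) (intro mult_right_mono K i norm_ge_zero)
      finally show "x \<bullet> ?g \<le> K * norm x" .
    qed
    then have "(norm ?g)\<^sup>2 \<le> K\<^sup>2" by (intro power_mono) auto
    then show ?thesis by (simp add: norm_embed_l2 G i)
  qed
  then show ?thesis by blast
qed

section \<open>Strongly continuous semigroups and their adjoints\<close>

text \<open>Stated for a bare family so that it covers both \<open>S\<close> and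
  \<open>adj_semigroup S\<close>. Continuity from the left is the point: factoring out the earlier
  time leaves an increment at 0, at the price of a local bound.\<close>

lemma semigroup_continuous_on:
  fixes R :: "real \<Rightarrow> 'a::real_normed_vector \<Rightarrow> 'a"
  assumes add: "\<And>s t. 0 \<le> s \<Longrightarrow> 0 \<le> t \<Longrightarrow> R (s + t) x = R s (R t x)"
    and diff: "\<And>t u v. R t (u - v) = R t u - R t v"
    and bounded: "\<And>\<tau>. \<exists>M\<ge>1. \<forall>t\<in>{0..\<tau>}. \<forall>u. norm (R t u) \<le> M * norm u"
    and near_0: "\<And>e. e > 0 \<Longrightarrow> \<exists>d>0. \<forall>t. 0 \<le> t \<and> t < d \<longrightarrow> norm (R t x - x) < e"
  shows "continuous_on {0..} (\<lambda>t. R t x)"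
  unfolding continuous_on_iff
proof (intro ballI allI impI)
  fix t e :: real assume t: "t \<in> {0..}" and "e > 0"
  obtain M where M: "M \<ge> 1" "\<And>s u. 0 \<le> s \<Longrightarrow> s \<le> t + 1 \<Longrightarrow> norm (R s u) \<le> M * norm u"
    using bounded[of "t + 1"] by force
  obtain d where d: "d > 0" "\<And>h. 0 \<le> h \<Longrightarrow> h < d \<Longrightarrow> norm (R h x - x) < e / M"
    using near_0[of "e / M"] \<open>e > 0\<close> M(1) by auto
  have diff: "norm (R b x - R a x) < e" if "0 \<le> a" "a \<le> b" "b - a < d" "a \<le> t + 1" for a b
  proof -
    have "R b x - R a x = R a (R (b - a) x - x)"
      using add[of a "b - a"] that by (simp add: diff)
    also have "norm \<dots> \<le> M * norm (R (b - a) x - x)" using M(2) that by simp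
    also have "\<dots> < M * (e / M)" using M(1) d(2)[of "b - a"] that by (intro mult_strict_left_mono) auto
    finally show ?thesis using M(1) by simp
  qed
  show "\<exists>d>0. \<forall>s\<in>{0..}. dist s t < d \<longrightarrow> dist (R s x) (R t x) < e"
  proof (intro exI[of _ "min d 1"] conjI ballI impI)
    fix s assume s: "s \<in> {0..}" "dist s t < min d 1"
    show "dist (R s x) (R t x) < e"
    proof (cases "s \<le> t")
      case True
      then show ?thesis using diff[of s t] s t by (auto simp: dist_norm dist_real_def norm_minus_commute)
    next
      case False
      then show ?thesis using diff[of t s] s t by (auto simp: dist_norm dist_real_def)
    qed
  qed (use d in auto)
qed

locale c0_generator =
  fixes A :: "'h::{real_inner, banach} unbounded_op"
    and S :: "real \<Rightarrow> 'h \<Rightarrow>\<^sub>L 'h"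
  assumes gen: "generates A S"
begin

abbreviation "Ss \<equiv> adj_semigroup S"
abbreviation "DA \<equiv> op_dom (op_adjoint A)"
abbreviation "As \<equiv> op_app (op_adjoint A)"

lemma S_0 [simp]: "S 0 x = x"
  using gen by (simp add: generates_def C0_semigroup_def)

lemma S_add: "0 \<le> s \<Longrightarrow> 0 \<le> t \<Longrightarrow> S (s + t) x = S s (S t x)"
  using gen by (simp add: generates_def C0_semigroup_def)

lemma S_commute: "0 \<le> s \<Longrightarrow> 0 \<le> t \<Longrightarrow> S s (S t x) = S t (S s x)"
  by (metis S_add add.commute)

lemma S_tendsto_0: "((\<lambda>t. S t x) \<longlongrightarrow> x) (at_right 0)"
  using gen by (simp add: generates_def C0_semigroup_def)

lemma S_near_0:
  assumes "e > 0"
  shows "\<exists>d>0. \<forall>t. 0 \<le> t \<and> t < d \<longrightarrow> norm (S t x - x) < e"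
proof -
  obtain d where d: "d > 0" "\<And>t. t > 0 \<Longrightarrow> t < d \<Longrightarrow> dist (S t x) x < e"
    using tendstoD[OF S_tendsto_0 assms] by (auto simp: eventually_at_right_field)
  have "norm (S t x - x) < e" if "0 \<le> t" "t < d" for t
    using d(2)[of t] that assms by (cases "t = 0") (auto simp: dist_norm)
  with d(1) show ?thesis by blast
qed

text \<open>Otherwise some times tending to 0 carry unbounded operator norms, although every orbit
  converges along them and is thus bounded; this contradicts uniform boundedness.\<close>

lemma S_bounded_near_0: "\<exists>d>0. \<exists>K. \<forall>t\<in>{0..d}. norm (S t) \<le> K"
proof (rule ccontr)
  assume neg: "\<not> (\<exists>d>0. \<exists>K. \<forall>t\<in>{0..d}. norm (S t) \<le> K)"
  have "\<exists>t. 0 \<le> t \<and> t \<le> inverse (real (Suc n)) \<and> norm (S t) > real n" for n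
  proof -
    have "inverse (real (Suc n)) > 0" by simp
    with neg show ?thesis by (meson atLeastAtMost_iff not_le)
  qed
  then obtain t where t: "\<And>n. 0 \<le> t n" "\<And>n. t n \<le> inverse (real (Suc n))"
      "\<And>n. norm (S (t n)) > real n"
    by metis
  have "\<exists>K. \<forall>f \<in> range (\<lambda>n. S (t n)). norm f \<le> K"
  proof (rule banach_steinhaus)
    fix x
    have "(\<lambda>n. S (t n) x) \<longlonglongrightarrow> x"
      unfolding LIMSEQ_iff
    proof (intro allI impI)
      fix e :: real assume "e > 0"
      then obtain d where d: "d > 0" "\<And>t. 0 \<le> t \<Longrightarrow> t < d \<Longrightarrow> norm (S t x - x) < e"
        using S_near_0 by blast
      obtain N where N: "inverse (real (Suc N)) < d" using reals_Archimedean d(1) by blast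
      have "norm (S (t n) x - x) < e" if "n \<ge> N" for n
      proof (rule d(2)[OF t(1)])
        have "inverse (real (Suc n)) \<le> inverse (real (Suc N))" using that by simp
        then show "t n < d" using t(2)[of n] N by linarith
      qed
      then show "\<exists>N. \<forall>n\<ge>N. norm (S (t n) x - x) < e" by blast
    qed
    then have "Bseq (\<lambda>n. S (t n) x)" using convergent_def convergent_imp_Bseq by blast
    then obtain K where "\<And>n. norm (S (t n) x) \<le> K" by (auto simp: Bseq_def)
    then show "\<exists>K. \<forall>f \<in> range (\<lambda>n. S (t n)). norm (f x) \<le> K" by auto
  qed
  then obtain K where K: "\<And>n. norm (S (t n)) \<le> K" by auto
  obtain n :: nat where "real n > K" using reals_Archimedean2 by blast
  with K[of n] t(3)[of n] show False by linarith
qed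

lemma S_locally_bounded: "\<exists>M\<ge>1. \<forall>t\<in>{0..\<tau>}. norm (S t) \<le> M"
proof -
  obtain d K0 where d: "d > 0" and K0: "\<And>t. 0 \<le> t \<Longrightarrow> t \<le> d \<Longrightarrow> norm (S t) \<le> K0"
    using S_bounded_near_0 by force
  \<comment> \<open>A bound of at least 1 makes the powers increasing, so a power meant for late
    times also covers early ones.\<close>
  define K where "K = max K0 1"
  have K: "norm (S t) \<le> K" if "0 \<le> t" "t \<le> d" for t using K0[OF that] by (simp add: K_def)
  have K1: "1 \<le> K" by (simp add: K_def)
  have bound: "norm (S t) \<le> K ^ Suc n" if "0 \<le> t" "t \<le> real (Suc n) * d" for n t
    using that
  proof (induction n arbitrary: t)
    case 0
    then show ?case using K by simp
  next
    case (Suc n)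
    show ?case
    proof (cases "t \<le> d")
      case True
      have "K ^ 1 \<le> K ^ Suc (Suc n)" by (intro power_increasing K1) simp
      with K[OF Suc.prems(1) True] show ?thesis by simp
    next
      case False
      have "S t = S d o\<^sub>L S (t - d)"
        using gen d False unfolding generates_def C0_semigroup_def
        by (metis add.commute diff_add_cancel diff_ge_0_iff_ge less_imp_le not_le)
      then have "norm (S t) \<le> norm (S d) * norm (S (t - d))" by (simp add: norm_blinfun_compose)
      also have "\<dots> \<le> K * K ^ Suc n"
        using Suc.prems False d K1 by (intro mult_mono K Suc.IH) (auto simp: algebra_simps)
      finally show ?thesis by simp
    qed
  qed
  obtain n :: nat where n: "\<tau> / d < real n" using reals_Archimedean2 by blast
  have "\<tau> \<le> real (Suc n) * d" using n d by (simp add: field_simps)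
  then have "\<forall>t\<in>{0..\<tau>}. norm (S t) \<le> K ^ Suc n" using bound by fastforce
  moreover have "1 \<le> K ^ Suc n" using K1 by (rule one_le_power)
  ultimately show ?thesis by blast
qed

lemma S_continuous_on: "continuous_on {0..} (\<lambda>t. S t x)"
proof (rule semigroup_continuous_on)
  fix \<tau> :: real
  obtain M where M: "M \<ge> 1" "\<forall>t\<in>{0..\<tau>}. norm (S t) \<le> M" using S_locally_bounded by blast
  then have "\<forall>t\<in>{0..\<tau>}. \<forall>u. norm (S t u) \<le> M * norm u"
    by (meson mult_right_mono norm_blinfun norm_ge_zero order_trans)
  with M(1) show "\<exists>M\<ge>1. \<forall>t\<in>{0..\<tau>}. \<forall>u. norm (S t u) \<le> M * norm u" by blast
qed (use S_near_0 in \<open>simp_all add: S_add blinfun.diff_right\<close>)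

lemma S_continuous_on': "A' \<subseteq> {0..} \<Longrightarrow> continuous_on A' (\<lambda>t. S t x)"
  using S_continuous_on continuous_on_subset by blast

section \<open>The integrated semigroup and the generator\<close>

definition Sint :: "real \<Rightarrow> 'h \<Rightarrow>\<^sub>L 'h" where
  "Sint t = Blinfun (\<lambda>x. integral {0..t} (\<lambda>s. S s x))"

text \<open>It stands for the integral of the adjoint semigroup over [0, t]. The strong continuity
  needed to form that integral is not yet known here and is itself derived from \<open>Is\<close>,
  so the adjoint of \<open>Sint t\<close> is taken instead.\<close>

definition Is :: "real \<Rightarrow> 'h \<Rightarrow> 'h" where
  "Is t = adjoint (blinfun_apply (Sint t))"

lemma S_integrable: "0 \<le> a \<Longrightarrow> (\<lambda>s. S s x) integrable_on {a..b}"
  by (intro integrable_continuous_real S_continuous_on') auto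

lemma Sint_norm_le:
  assumes "\<And>s. 0 \<le> s \<Longrightarrow> s \<le> t \<Longrightarrow> norm (S s) \<le> M" "0 \<le> t"
  shows "norm (integral {0..t} (\<lambda>s. S s x)) \<le> M * t * norm x"
proof -
  have "norm (integral {0..t} (\<lambda>s. S s x)) \<le> (M * norm x) * (t - 0)"
  proof (rule integral_bound)
    show "norm (S s x) \<le> M * norm x" if "s \<in> {0..t}" for s
      by (rule order.trans[OF norm_blinfun]) (use that assms in \<open>auto intro: mult_right_mono\<close>)
  qed (use assms S_continuous_on' in auto)
  then show ?thesis by (simp add: ac_simps)
qed

lemma Sint_apply:
  assumes "0 \<le> t"
  shows "Sint t x = integral {0..t} (\<lambda>s. S s x)"
proof -
  obtain M where M: "\<And>s. 0 \<le> s \<Longrightarrow> s \<le> t \<Longrightarrow> norm (S s) \<le> M"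
    using S_locally_bounded[of t] by force
  have "bounded_linear (\<lambda>x. integral {0..t} (\<lambda>s. S s x))"
  proof (rule bounded_linear_intro[where K = "M * t"])
    show "norm (integral {0..t} (\<lambda>s. S s x)) \<le> norm x * (M * t)" for x
      using Sint_norm_le[OF M assms, of x] by (simp add: ac_simps)
  qed (auto simp: blinfun.add_right blinfun.scaleR_right integral_add S_integrable)
  then show ?thesis by (simp add: Sint_def bounded_linear_Blinfun_apply)
qed

lemma norm_Sint_le:
  assumes "\<And>s. 0 \<le> s \<Longrightarrow> s \<le> t \<Longrightarrow> norm (S s) \<le> M" "0 \<le> t" "0 \<le> M"
  shows "norm (Sint t) \<le> M * t"
  by (rule norm_blinfun_bound) (use assms in \<open>simp_all add: Sint_apply Sint_norm_le\<close>)

lemma Sint_add: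
  assumes "0 \<le> h" "0 \<le> t"
  shows "Sint (h + t) x = Sint h x + S h (Sint t x)"
proof -
  have "S h (Sint t x) = integral {0..t} (\<lambda>s. S h (S s x))"
    using assms integral_linear[OF S_integrable[where a = 0 and b = t and x = x, OF order_refl]
        blinfun.bounded_linear_right[of "S h"]]
    by (simp add: Sint_apply o_def)
  also have "\<dots> = integral {0..t} ((\<lambda>s. S s x) \<circ> (+) h)"
    using assms by (intro integral_cong) (simp add: S_add)
  also have "\<dots> = integral {h..h + t} (\<lambda>s. S s x)"
    by (simp add: integral_shift_Icc_real add.commute)
  also have "Sint h x + \<dots> = Sint (h + t) x"
    using assms by (simp add: Sint_apply Henstock_Kurzweil_Integration.integral_combine S_integrable)
  finally show ?thesis by simp
qed

lemma Sint_near_0: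
  assumes "e > 0"
  shows "\<exists>d>0. \<forall>h. 0 \<le> h \<and> h < d \<longrightarrow> norm (Sint h x - h *\<^sub>R x) \<le> e * h"
proof -
  obtain d where d: "d > 0" "\<And>t. 0 \<le> t \<Longrightarrow> t < d \<Longrightarrow> norm (S t x - x) < e"
    using S_near_0[OF assms] by blast
  have "norm (Sint h x - h *\<^sub>R x) \<le> e * h" if h: "0 \<le> h" "h < d" for h
  proof -
    have "Sint h x - h *\<^sub>R x = integral {0..h} (\<lambda>s. S s x - x)"
      using h integral_diff[OF S_integrable[where a = 0 and b = h and x = x, OF order_refl]
          integrable_const_ivl[of x 0 h]]
      by (simp add: Sint_apply)
    also have "norm \<dots> \<le> e * (h - 0)"
      by (rule integral_bound) (use h less_imp_le[OF d(2)] in \<open>auto intro!: continuous_on_diff continuous_on_const S_continuous_on'\<close>)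
    finally show ?thesis by simp
  qed
  with d(1) show ?thesis by blast
qed

lemma Sint_derivative_0: "((\<lambda>h. Sint h x /\<^sub>R h) \<longlongrightarrow> x) (at_right 0)"
proof (rule tendstoI)
  fix e :: real assume "e > 0"
  then obtain d where d: "d > 0" "\<And>h. 0 \<le> h \<Longrightarrow> h < d \<Longrightarrow> norm (Sint h x - h *\<^sub>R x) \<le> e/2 * h"
    using Sint_near_0[of "e/2" x] by auto
  have "dist (Sint h x /\<^sub>R h) x < e" if "h > 0" "h < d" for h
  proof -
    have "Sint h x /\<^sub>R h - x = inverse h *\<^sub>R (Sint h x - h *\<^sub>R x)"
      using that by (simp add: scaleR_diff_right)
    then have "norm (Sint h x /\<^sub>R h - x) = norm (Sint h x - h *\<^sub>R x) / h"
      using that by (simp add: divide_inverse mult.commute)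
    also have "\<dots> \<le> e/2" using d(2)[of h] that by (simp add: field_simps)
    finally show ?thesis using \<open>e > 0\<close> by (simp add: dist_norm)
  qed
  with d(1) show "\<forall>\<^sub>F h in at_right 0. dist (Sint h x /\<^sub>R h) x < e"
    by (auto simp: eventually_at_right_field)
qed

lemma op_domI:
  assumes "((\<lambda>t. (S t x - x) /\<^sub>R t) \<longlongrightarrow> y) (at_right 0)"
  shows "x \<in> op_dom A" "op_app A x = y"
proof -
  show x: "x \<in> op_dom A" using gen assms unfolding generates_def by blast
  then have "((\<lambda>t. (S t x - x) /\<^sub>R t) \<longlongrightarrow> op_app A x) (at_right 0)"
    using gen unfolding generates_def by blast
  then show "op_app A x = y" using assms tendsto_unique trivial_limit_at_right_real by blast
qed

lemma op_domD: "x \<in> op_dom A \<Longrightarrow> ((\<lambda>t. (S t x - x) /\<^sub>R t) \<longlongrightarrow> op_app A x) (at_right 0)"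
  using gen unfolding generates_def by blast

lemma Sint_in_dom:
  assumes "0 \<le> t"
  shows "Sint t x \<in> op_dom A" "op_app A (Sint t x) = S t x - x"
proof -
  have "((\<lambda>h. S t (Sint h x /\<^sub>R h) - Sint h x /\<^sub>R h) \<longlongrightarrow> S t x - x) (at_right 0)"
    by (intro tendsto_intros Sint_derivative_0 bounded_linear.tendsto[OF blinfun.bounded_linear_right])
  then have "((\<lambda>h. (S h (Sint t x) - Sint t x) /\<^sub>R h) \<longlongrightarrow> S t x - x) (at_right 0)"
  proof (rule Lim_transform_eventually)
    show "\<forall>\<^sub>F h in at_right 0. S t (Sint h x /\<^sub>R h) - Sint h x /\<^sub>R h = (S h (Sint t x) - Sint t x) /\<^sub>R h"
    proof (rule eventually_at_rightI[of 0 1])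
      fix h :: real assume "h \<in> {0<..<1}"
      \<comment> \<open>Both sides are \<open>Sint (h + t) x\<close>, split at \<open>h\<close> and
        at \<open>t\<close>; this moves the difference quotient from \<open>Sint t x\<close> to
        \<open>Sint h x\<close>.\<close>
      then have "Sint h x + S h (Sint t x) = Sint t x + S t (Sint h x)"
        using Sint_add[of h t x] Sint_add[of t h x] assms by (simp add: add.commute)
      then have "S h (Sint t x) - Sint t x = S t (Sint h x) - Sint h x" by (simp add: algebra_simps)
      then show "S t (Sint h x /\<^sub>R h) - Sint h x /\<^sub>R h = (S h (Sint t x) - Sint t x) /\<^sub>R h"
        by (simp add: blinfun.scaleR_right scaleR_diff_right)
    qed simp
  qed
  from op_domI[OF this] show "Sint t x \<in> op_dom A" "op_app A (Sint t x) = S t x - x" .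
qed

text \<open>\<open>Sint t\<close> is bounded and commutes with the semigroup, so it passes through
  the difference quotient, whose limit is then also the generator at
  \<open>Sint t x\<close>.\<close>

lemma Sint_generator:
  assumes "0 \<le> t" "x \<in> op_dom A"
  shows "Sint t (op_app A x) = S t x - x"
proof -
  have commute: "Sint t (S h x) = S h (Sint t x)" if "0 \<le> h" for h
  proof -
    have "S h (Sint t x) = integral {0..t} (\<lambda>s. S h (S s x))"
      using assms(1) integral_linear[OF S_integrable[where a = 0 and b = t and x = x, OF order_refl]
        blinfun.bounded_linear_right[of "S h"]]
      by (simp add: Sint_apply o_def)
    also have "\<dots> = integral {0..t} (\<lambda>s. S s (S h x))"
      using that by (intro integral_cong) (simp add: S_commute)
    finally show ?thesis using assms(1) by (simp add: Sint_apply)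
  qed
  have "((\<lambda>h. Sint t ((S h x - x) /\<^sub>R h)) \<longlongrightarrow> Sint t (op_app A x)) (at_right 0)"
    by (intro bounded_linear.tendsto[OF blinfun.bounded_linear_right] op_domD assms(2))
  then have "((\<lambda>h. (S h (Sint t x) - Sint t x) /\<^sub>R h) \<longlongrightarrow> Sint t (op_app A x)) (at_right 0)"
  proof (rule Lim_transform_eventually)
    show "\<forall>\<^sub>F h in at_right 0. Sint t ((S h x - x) /\<^sub>R h) = (S h (Sint t x) - Sint t x) /\<^sub>R h"
      by (rule eventually_at_rightI[of 0 1])
        (simp_all add: blinfun.scaleR_right blinfun.diff_right commute)
  qed
  from op_domI(2)[OF this] show ?thesis using Sint_in_dom(2)[OF assms(1)] by simp
qed

lemma S_in_dom:
  assumes "0 \<le> t" "x \<in> op_dom A"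
  shows "S t x \<in> op_dom A" "op_app A (S t x) = S t (op_app A x)"
proof -
  have "((\<lambda>h. S t ((S h x - x) /\<^sub>R h)) \<longlongrightarrow> S t (op_app A x)) (at_right 0)"
    by (intro bounded_linear.tendsto[OF blinfun.bounded_linear_right] op_domD assms(2))
  then have "((\<lambda>h. (S h (S t x) - S t x) /\<^sub>R h) \<longlongrightarrow> S t (op_app A x)) (at_right 0)"
  proof (rule Lim_transform_eventually)
    show "\<forall>\<^sub>F h in at_right 0. S t ((S h x - x) /\<^sub>R h) = (S h (S t x) - S t x) /\<^sub>R h"
      by (rule eventually_at_rightI[of 0 1])
        (use assms(1) in \<open>simp_all add: blinfun.scaleR_right blinfun.diff_right S_commute\<close>)
  qed
  from op_domI[OF this] show "S t x \<in> op_dom A" "op_app A (S t x) = S t (op_app A x)" .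
qed

text \<open>Density of the domain in weak form: the averages of an orbit over [0, h] lie in the
  domain and tend to the starting vector. It makes the \<open>THE\<close> in
  \<open>op_adjoint\<close> well defined.\<close>

lemma inner_dom_eq_imp_eq:
  assumes "\<And>x. x \<in> op_dom A \<Longrightarrow> x \<bullet> v = x \<bullet> w"
  shows "v = w"
proof (rule inner_eq_imp_eq)
  fix u
  have "((\<lambda>h. (Sint h u /\<^sub>R h) \<bullet> v) \<longlongrightarrow> u \<bullet> v) (at_right 0)"
    by (intro tendsto_intros Sint_derivative_0)
  moreover have "\<forall>\<^sub>F h in at_right 0. (Sint h u /\<^sub>R h) \<bullet> v = (Sint h u /\<^sub>R h) \<bullet> w"
    by (rule eventually_at_rightI[of 0 1]) (use assms Sint_in_dom(1) in auto)
  ultimately have "((\<lambda>h. (Sint h u /\<^sub>R h) \<bullet> w) \<longlongrightarrow> u \<bullet> v) (at_right 0)"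
    by (rule Lim_transform_eventually)
  moreover have "((\<lambda>h. (Sint h u /\<^sub>R h) \<bullet> w) \<longlongrightarrow> u \<bullet> w) (at_right 0)"
    by (intro tendsto_intros Sint_derivative_0)
  ultimately show "u \<bullet> v = u \<bullet> w"
    using tendsto_unique trivial_limit_at_right_real by blast
qed

section \<open>The adjoint generator and the adjoint semigroup\<close>

lemma DA_I:
  assumes "\<And>x. x \<in> op_dom A \<Longrightarrow> op_app A x \<bullet> \<phi> = x \<bullet> \<psi>"
  shows "\<phi> \<in> DA" "As \<phi> = \<psi>"
proof -
  show "\<phi> \<in> DA" using assms by (auto simp: op_adjoint_def)
  have "(THE \<psi>. \<forall>x\<in>op_dom A. op_app A x \<bullet> \<phi> = x \<bullet> \<psi>) = \<psi>"
    by (rule the_equality) (use assms inner_dom_eq_imp_eq in auto)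
  then show "As \<phi> = \<psi>" by (simp add: op_adjoint_def)
qed

lemma DA_D:
  assumes "\<phi> \<in> DA" "x \<in> op_dom A"
  shows "op_app A x \<bullet> \<phi> = x \<bullet> As \<phi>"
proof -
  obtain \<psi> where \<psi>: "\<And>x. x \<in> op_dom A \<Longrightarrow> op_app A x \<bullet> \<phi> = x \<bullet> \<psi>"
    using assms(1) by (auto simp: op_adjoint_def)
  from DA_I(2)[OF this] \<psi> assms(2) show ?thesis by simp
qed

lemma DA_add: "\<phi> \<in> DA \<Longrightarrow> \<psi> \<in> DA \<Longrightarrow> \<phi> + \<psi> \<in> DA \<and> As (\<phi> + \<psi>) = As \<phi> + As \<psi>"
  using DA_I[of "\<phi> + \<psi>" "As \<phi> + As \<psi>"] by (simp add: inner_add_right DA_D)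

lemma DA_scaleR: "\<phi> \<in> DA \<Longrightarrow> c *\<^sub>R \<phi> \<in> DA \<and> As (c *\<^sub>R \<phi>) = c *\<^sub>R As \<phi>"
  using DA_I[of "c *\<^sub>R \<phi>" "c *\<^sub>R As \<phi>"] by (simp add: DA_D)

lemma DA_diff: "\<phi> \<in> DA \<Longrightarrow> \<psi> \<in> DA \<Longrightarrow> \<phi> - \<psi> \<in> DA \<and> As (\<phi> - \<psi>) = As \<phi> - As \<psi>"
  using DA_I[of "\<phi> - \<psi>" "As \<phi> - As \<psi>"] by (simp add: inner_diff_right DA_D)

lemma DA_zero: "0 \<in> DA" "As 0 = 0"
  using DA_I[of 0 0] by simp_all

lemma subspace_DA: "subspace DA"
  by (simp add: subspace_def DA_add DA_scaleR DA_zero)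

lemma DA_closed:
  assumes "\<And>n. \<phi> n \<in> DA" "\<phi> \<longlonglongrightarrow> \<psi>" "(\<lambda>n. As (\<phi> n)) \<longlonglongrightarrow> \<eta>"
  shows "\<psi> \<in> DA" "As \<psi> = \<eta>"
proof -
  have *: "op_app A x \<bullet> \<psi> = x \<bullet> \<eta>" if "x \<in> op_dom A" for x
  proof (rule LIMSEQ_unique)
    show "(\<lambda>n. op_app A x \<bullet> \<phi> n) \<longlonglongrightarrow> op_app A x \<bullet> \<psi>" by (intro tendsto_intros assms)
    have "(\<lambda>n. x \<bullet> As (\<phi> n)) \<longlonglongrightarrow> x \<bullet> \<eta>" by (intro tendsto_intros assms)
    then show "(\<lambda>n. op_app A x \<bullet> \<phi> n) \<longlonglongrightarrow> x \<bullet> \<eta>" using DA_D[OF assms(1) that] by simp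
  qed
  from DA_I[OF *] show "\<psi> \<in> DA" "As \<psi> = \<eta>" by auto
qed

lemma inner_Ss: "S t x \<bullet> y = x \<bullet> Ss t y"
  unfolding adj_semigroup_def by (rule adjoint_blinfun)

lemma bounded_linear_Ss: "bounded_linear (Ss t)"
  unfolding adj_semigroup_def by (rule bounded_linear_adjoint_blinfun)

lemma norm_Ss_le: "norm (Ss t y) \<le> norm (S t) * norm y"
  unfolding adj_semigroup_def by (rule bounded_linear_adjoint_blinfun)

lemmas Ss_linear = bounded_linear.linear[OF bounded_linear_Ss]

lemma Ss_0 [simp]: "Ss 0 y = y"
  by (rule inner_eq_imp_eq) (simp flip: inner_Ss)

lemma Ss_add: "0 \<le> s \<Longrightarrow> 0 \<le> t \<Longrightarrow> Ss (s + t) y = Ss s (Ss t y)"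
  by (rule inner_eq_imp_eq) (simp add: S_add S_commute[of t s] flip: inner_Ss)

lemma inner_Is: "Sint t x \<bullet> y = x \<bullet> Is t y"
  unfolding Is_def by (rule adjoint_blinfun)

lemma Is_in_DA:
  assumes "0 \<le> t"
  shows "Is t y \<in> DA" "As (Is t y) = Ss t y - y"
proof -
  have *: "op_app A x \<bullet> Is t y = x \<bullet> (Ss t y - y)" if "x \<in> op_dom A" for x
    using that assms by (simp add: Sint_generator inner_diff_left inner_diff_right inner_Ss flip: inner_Is)
  from DA_I[OF *] show "Is t y \<in> DA" "As (Is t y) = Ss t y - y" by auto
qed

lemma Is_As:
  assumes "0 \<le> t" "\<phi> \<in> DA"
  shows "Is t (As \<phi>) = Ss t \<phi> - \<phi>"
proof (rule inner_eq_imp_eq)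
  fix x
  have "x \<bullet> Is t (As \<phi>) = op_app A (Sint t x) \<bullet> \<phi>"
    using assms by (simp add: DA_D Sint_in_dom(1) flip: inner_Is)
  then show "x \<bullet> Is t (As \<phi>) = x \<bullet> (Ss t \<phi> - \<phi>)"
    using assms by (simp add: Sint_in_dom(2) inner_diff_left inner_diff_right inner_Ss)
qed

lemma Ss_in_DA:
  assumes "0 \<le> t" "\<phi> \<in> DA"
  shows "Ss t \<phi> \<in> DA" "As (Ss t \<phi>) = Ss t (As \<phi>)"
proof -
  have *: "op_app A x \<bullet> Ss t \<phi> = x \<bullet> Ss t (As \<phi>)" if "x \<in> op_dom A" for x
    using DA_D[OF assms(2) S_in_dom(1)[OF assms(1) that]] S_in_dom(2)[OF assms(1) that]
    by (simp flip: inner_Ss)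
  from DA_I[OF *] show "Ss t \<phi> \<in> DA" "As (Ss t \<phi>) = Ss t (As \<phi>)" by auto
qed

text \<open>A vector orthogonal to all \<open>Is t u\<close> is annihilated by every
  \<open>Sint t\<close>; being the limit of its own averages, it is 0.\<close>

lemma DA_dense: "closure DA = UNIV"
proof (rule closure_subspace_eq_UNIV[OF subspace_DA])
  fix y assume y: "\<And>k. k \<in> DA \<Longrightarrow> y \<bullet> k = 0"
  have "Sint t y = 0" if "0 \<le> t" for t
  proof (rule inner_eq_imp_eq)
    show "u \<bullet> Sint t y = u \<bullet> 0" for u
      using y[OF Is_in_DA(1)[OF that, of u]] by (simp add: inner_commute[of u] flip: inner_Is)
  qed
  then have "\<forall>\<^sub>F h in at_right 0. Sint h y /\<^sub>R h = 0"
    by (intro eventually_at_rightI[of 0 1]) auto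
  then have "((\<lambda>h. 0) \<longlongrightarrow> y) (at_right (0 :: real))"
    by (rule Lim_transform_eventually[OF Sint_derivative_0])
  then show "y = 0" using tendsto_unique[OF trivial_limit_at_right_real tendsto_const] by metis
qed

lemma DA_approx: "\<exists>\<phi>. (\<forall>n. \<phi> n \<in> DA) \<and> \<phi> \<longlonglongrightarrow> y"
  using DA_dense closure_sequential by blast

lemma inner_DA_eq_imp_eq:
  assumes "\<And>\<phi>. \<phi> \<in> DA \<Longrightarrow> v \<bullet> \<phi> = w \<bullet> \<phi>"
  shows "v = w"
proof (rule inner_eq_imp_eq)
  fix u
  obtain \<phi> where \<phi>: "\<And>n. \<phi> n \<in> DA" "\<phi> \<longlonglongrightarrow> u" using DA_approx by blast
  have "(\<lambda>n. \<phi> n \<bullet> v) \<longlonglongrightarrow> u \<bullet> v" "(\<lambda>n. \<phi> n \<bullet> w) \<longlonglongrightarrow> u \<bullet> w" by (intro tendsto_intros \<phi>)+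
  moreover have "\<phi> n \<bullet> v = \<phi> n \<bullet> w" for n using assms[OF \<phi>(1)] by (simp add: inner_commute)
  ultimately show "u \<bullet> v = u \<bullet> w" using LIMSEQ_unique by simp
qed

lemma norm_Is_le:
  assumes "\<And>s. 0 \<le> s \<Longrightarrow> s \<le> t \<Longrightarrow> norm (S s) \<le> M" "0 \<le> t" "0 \<le> M"
  shows "norm (Is t y) \<le> M * t * norm y"
  unfolding Is_def
  by (rule order.trans[OF bounded_linear_adjoint_blinfun(2)])
    (use norm_Sint_le[OF assms] in \<open>auto intro: mult_right_mono\<close>)

text \<open>Duality alone gives only weak continuity. On \<open>DA\<close> the increment is
  \<open>Is t (As \<phi>)\<close>, of order \<open>t\<close>; density of \<open>DA\<close> and the
  local bound carry this over to all \<open>y\<close>.\<close>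

lemma Ss_near_0:
  assumes "e > 0"
  shows "\<exists>d>0. \<forall>t. 0 \<le> t \<and> t < d \<longrightarrow> norm (Ss t y - y) < e"
proof -
  obtain M where M: "M \<ge> 1" "\<And>s. 0 \<le> s \<Longrightarrow> s \<le> 1 \<Longrightarrow> norm (S s) \<le> M"
    using S_locally_bounded[of 1] by force
  have "e / (4 * M) > 0" using assms M(1) by simp
  moreover have "y \<in> closure DA" by (simp add: DA_dense)
  ultimately obtain \<phi> where \<phi>: "\<phi> \<in> DA" "norm (\<phi> - y) < e / (4 * M)"
    unfolding closure_approachable dist_norm by blast
  \<comment> \<open>Half of \<open>e\<close> is reserved for the increment of \<open>\<phi>\<close>;
    the two approximation terms use a quarter each. The summand 1 keeps the denominator positive
    when \<open>As \<phi> = 0\<close>.\<close>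
  define d where "d = min 1 (e / (2 * M * (norm (As \<phi>) + 1)))"
  have pos: "2 * M * (norm (As \<phi>) + 1) > 0" using M(1) by (simp add: add_nonneg_pos)
  have "d > 0" using assms pos by (simp add: d_def)
  moreover have "norm (Ss t y - y) < e" if t: "0 \<le> t" "t < d" for t
  proof -
    have t1: "t \<le> 1" using t by (simp add: d_def)
    have "Ss t y - y = (Ss t \<phi> - \<phi>) - (Ss t (\<phi> - y) - (\<phi> - y))"
      by (simp add: linear_diff[OF Ss_linear])
    then have "norm (Ss t y - y) \<le> norm (Ss t \<phi> - \<phi>) + (norm (Ss t (\<phi> - y)) + norm (\<phi> - y))"
      by (smt (verit) norm_triangle_ineq4)
    moreover have "norm (Ss t \<phi> - \<phi>) \<le> M * t * norm (As \<phi>)"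
      unfolding Is_As[OF t(1) \<phi>(1), symmetric]
      by (rule norm_Is_le) (use t t1 M in auto)
    moreover have "norm (Ss t (\<phi> - y)) \<le> M * norm (\<phi> - y)"
      by (rule order.trans[OF norm_Ss_le]) (use t t1 M in \<open>auto intro: mult_right_mono\<close>)
    moreover have "norm (\<phi> - y) \<le> M * norm (\<phi> - y)" using M(1) by (simp add: mult_le_cancel_right1)
    moreover have "M * norm (\<phi> - y) < e / 4" using \<phi>(2) M(1) by (simp add: field_simps)
    moreover have "M * t * norm (As \<phi>) \<le> e / 2"
    proof -
      have "t \<le> e / (2 * M * (norm (As \<phi>) + 1))" using t by (simp add: d_def)
      then have "t * (2 * M * (norm (As \<phi>) + 1)) \<le> e" using pos by (simp add: pos_le_divide_eq)
      moreover have "0 \<le> M * t" using M(1) t by simp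
      ultimately show ?thesis by (simp add: algebra_simps)
    qed
    ultimately show ?thesis by linarith
  qed
  ultimately show ?thesis by blast
qed

lemma Ss_continuous_on: "continuous_on {0..} (\<lambda>t. Ss t y)"
proof (rule semigroup_continuous_on)
  fix \<tau> :: real
  obtain M where M: "M \<ge> 1" "\<forall>t\<in>{0..\<tau>}. norm (S t) \<le> M" using S_locally_bounded by blast
  then have "\<forall>t\<in>{0..\<tau>}. \<forall>u. norm (Ss t u) \<le> M * norm u"
    by (meson mult_right_mono norm_Ss_le norm_ge_zero order_trans)
  with M(1) show "\<exists>M\<ge>1. \<forall>t\<in>{0..\<tau>}. \<forall>u. norm (Ss t u) \<le> M * norm u" by blast
qed (use Ss_near_0 in \<open>simp_all add: Ss_add linear_diff[OF Ss_linear]\<close>)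

text \<open>\<open>Is\<close> is an adjoint and not an integral, so the estimate is read off from
  \<open>Sint\<close> by testing with \<open>x\<close>. It acts as the derivative of
  \<open>Is\<close> at 0 in the weak equation for \<open>Phi\<close>.\<close>

lemma Is_near_0:
  assumes "e > 0"
  shows "\<exists>d>0. \<forall>h. 0 \<le> h \<and> h < d \<longrightarrow> norm (Is h y - h *\<^sub>R y) \<le> e * h"
proof -
  obtain d where d: "d > 0" "\<And>t. 0 \<le> t \<Longrightarrow> t < d \<Longrightarrow> norm (Ss t y - y) < e"
    using Ss_near_0[OF assms] by blast
  have "norm (Is h y - h *\<^sub>R y) \<le> e * h" if h: "0 \<le> h" "h < d" for h
  proof (rule norm_le_if_inner_le)
    fix x
    have "x \<bullet> (Is h y - h *\<^sub>R y) = Sint h x \<bullet> y - h * (x \<bullet> y)"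
      by (simp add: inner_diff_right inner_Is)
    also have "Sint h x \<bullet> y = integral {0..h} (\<lambda>s. S s x \<bullet> y)"
      using h integral_linear[OF S_integrable[where a = 0 and b = h and x = x, OF order_refl]
          bounded_linear_inner_left[of y]]
      by (simp add: Sint_apply o_def)
    also have "\<dots> - h * (x \<bullet> y) = integral {0..h} (\<lambda>s. S s x \<bullet> y - x \<bullet> y)"
    proof -
      have "(\<lambda>s. S s x \<bullet> y) integrable_on {0..h}"
        by (intro integrable_continuous_real continuous_on_inner S_continuous_on' continuous_on_const) auto
      from integral_diff[OF this integrable_const_ivl[of "x \<bullet> y" 0 h]] h show ?thesis by simp
    qed
    also have "\<dots> \<le> norm \<dots>" by simp
    also have "\<dots> \<le> (e * norm x) * (h - 0)"
    proof (rule integral_bound)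
      fix s assume s: "s \<in> {0..h}"
      have "S s x \<bullet> y - x \<bullet> y = x \<bullet> (Ss s y - y)" by (simp add: inner_diff_right inner_Ss)
      also have "norm \<dots> \<le> norm x * norm (Ss s y - y)" by (simp add: Cauchy_Schwarz_ineq2)
      also have "\<dots> \<le> norm x * e" using d(2)[of s] s h by (intro mult_left_mono) auto
      finally show "norm (S s x \<bullet> y - x \<bullet> y) \<le> e * norm x" by (simp add: mult.commute)
    qed (use h in \<open>auto intro!: continuous_on_diff continuous_on_inner continuous_on_const S_continuous_on'\<close>)
    finally show "x \<bullet> (Is h y - h *\<^sub>R y) \<le> e * h * norm x" by (simp add: ac_simps)
  qed (use h assms in auto)
  with d(1) show ?thesis by blast
qed

end

section \<open>Admissible control operators\<close>

lemma integral_reflect_Icc: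
  fixes f :: "real \<Rightarrow> real"
  shows "integral {0..t} (\<lambda>s. f (t - s)) = integral {0..t} f"
proof -
  have "integral {0..t} (\<lambda>s. f (t - s)) = integral {-t..-0} (\<lambda>s. f (t - (- s)))"
    using Henstock_Kurzweil_Integration.integral_reflect_real[of t 0 "\<lambda>s. f (t - s)"] by simp
  also have "\<dots> = integral {-t..0} (f \<circ> (+) t)" by (simp add: o_def)
  also have "\<dots> = integral {0..t} f" by (subst integral_shift_Icc_real) simp
  finally show ?thesis .
qed

text \<open>A substitute for differentiation when \<open>G\<close> need not be differentiable: over
  a fine uniform partition the increments of \<open>V\<close> telescope, and the factor
  \<open>e\<close> is arbitrary. Taking an integral for \<open>V\<close> admits controls that are
  merely square integrable.\<close>

lemma small_increments_imp_const:
  fixes G V :: "real \<Rightarrow> real"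
  assumes "0 \<le> \<tau>"
    and small: "\<And>e. e > 0 \<Longrightarrow> \<exists>d>0. \<forall>a b. 0 \<le> a \<and> a \<le> b \<and> b \<le> \<tau> \<and> b - a < d \<longrightarrow> \<bar>G b - G a\<bar> \<le> e * (V b - V a)"
  shows "G \<tau> = G 0"
proof -
  have bound: "\<bar>G \<tau> - G 0\<bar> \<le> e * (V \<tau> - V 0)" if e: "e > 0" for e
  proof -
    obtain d where d: "d > 0"
        "\<And>a b. 0 \<le> a \<Longrightarrow> a \<le> b \<Longrightarrow> b \<le> \<tau> \<Longrightarrow> b - a < d \<Longrightarrow> \<bar>G b - G a\<bar> \<le> e * (V b - V a)"
      using small[OF e] by blast
    obtain N :: nat where N: "\<tau> / d < real N" using reals_Archimedean2 by blast
    define n where "n = Suc N"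
    have n: "0 < real n" "\<tau> / real n < d"
      using N d(1) by (auto simp: n_def field_simps)
    have "\<bar>G (real k * \<tau> / real n) - G 0\<bar> \<le> e * (V (real k * \<tau> / real n) - V 0)" if "k \<le> n" for k
      using that
    proof (induction k)
      case (Suc k)
      let ?a = "real k * \<tau> / real n" and ?b = "real (Suc k) * \<tau> / real n"
      have ab: "?b - ?a = \<tau> / real n" by (simp add: add_divide_distrib distrib_right)
      have "\<bar>G ?b - G ?a\<bar> \<le> e * (V ?b - V ?a)"
      proof (rule d(2))
        show "?b \<le> \<tau>" using Suc.prems n(1) assms(1) by (simp add: pos_divide_le_eq mult.commute mult_left_mono)
      qed (use ab n assms(1) in \<open>auto simp: divide_right_mono mult_right_mono\<close>)
      then show ?case using Suc by (auto simp: algebra_simps abs_le_iff)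
    qed simp
    from this[of n] n(1) show ?thesis by simp
  qed
  have "\<bar>G \<tau> - G 0\<bar> \<le> 0 + x" if "x > 0" for x
  proof -
    have "\<bar>G \<tau> - G 0\<bar> \<le> x / (\<bar>V \<tau> - V 0\<bar> + 1) * (V \<tau> - V 0)" by (rule bound) (use that in simp)
    also have "\<dots> \<le> x / (\<bar>V \<tau> - V 0\<bar> + 1) * (\<bar>V \<tau> - V 0\<bar> + 1)"
      by (intro mult_left_mono) (use that in auto)
    also have "\<dots> = x" by (simp add: add_nonneg_eq_0_iff)
    finally show ?thesis by simp
  qed
  then have "\<bar>G \<tau> - G 0\<bar> \<le> 0" by (rule field_le_epsilon)
  then show ?thesis by simp
qed

locale control_system = c0_generator A S
  for A :: "'h::{real_inner, banach} unbounded_op" and S +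
  fixes B :: "'u::{real_inner, banach} \<Rightarrow> 'h \<Rightarrow> real"
  assumes ctrl: "control_operator A B"
    and adm: "admissible A S B"
begin

abbreviation "Bs \<equiv> ctrl_adjoint B"

lemma norm_le_if_inner_DA_le:
  assumes "\<And>\<phi>. \<phi> \<in> DA \<Longrightarrow> v \<bullet> \<phi> \<le> c * norm \<phi>" "0 \<le> c"
  shows "norm v \<le> c"
proof (rule norm_le_if_inner_le[OF _ assms(2)])
  fix x
  obtain \<phi> where \<phi>: "\<And>n. \<phi> n \<in> DA" "\<phi> \<longlonglongrightarrow> x" using DA_approx by blast
  have "(\<lambda>n. v \<bullet> \<phi> n) \<longlonglongrightarrow> v \<bullet> x" "(\<lambda>n. c * norm (\<phi> n)) \<longlonglongrightarrow> c * norm x"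
    by (intro tendsto_intros \<phi>)+
  then have "v \<bullet> x \<le> c * norm x" by (rule LIMSEQ_le) (use assms(1) \<phi>(1) in auto)
  then show "x \<bullet> v \<le> c * norm x" by (simp add: inner_commute)
qed

lemma B_bounded:
  obtains K where "0 \<le> K" "\<And>u \<phi>. \<phi> \<in> DA \<Longrightarrow> \<bar>B u \<phi>\<bar> \<le> K * norm u * (norm \<phi> + norm (As \<phi>))"
proof -
  obtain K where K: "\<And>u \<phi>. \<phi> \<in> DA \<Longrightarrow> \<bar>B u \<phi>\<bar> \<le> K * norm u * graph_norm (op_adjoint A) \<phi>"
    using ctrl unfolding control_operator_def by blast
  show thesis
  proof (rule that[of "\<bar>K\<bar>"])
    fix u \<phi> assume \<phi>: "\<phi> \<in> DA"
    have g: "0 \<le> graph_norm (op_adjoint A) \<phi>" "graph_norm (op_adjoint A) \<phi> \<le> norm \<phi> + norm (As \<phi>)"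
      unfolding graph_norm_def by (auto intro: sqrt_sum_squares_le_sum)
    have "\<bar>B u \<phi>\<bar> \<le> K * norm u * graph_norm (op_adjoint A) \<phi>" by (rule K[OF \<phi>])
    also have "\<dots> \<le> \<bar>K\<bar> * norm u * (norm \<phi> + norm (As \<phi>))"
      using g by (intro mult_mono) auto
    finally show "\<bar>B u \<phi>\<bar> \<le> \<bar>K\<bar> * norm u * (norm \<phi> + norm (As \<phi>))" .
  qed simp
qed

lemma inner_Bs:
  assumes "\<phi> \<in> DA"
  shows "u \<bullet> Bs \<phi> = B u \<phi>"
proof -
  obtain K where K: "0 \<le> K" "\<And>u \<phi>. \<phi> \<in> DA \<Longrightarrow> \<bar>B u \<phi>\<bar> \<le> K * norm u * (norm \<phi> + norm (As \<phi>))"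
    using B_bounded by blast
  have "linear (\<lambda>u. B u \<phi>)" using ctrl assms unfolding control_operator_def by blast
  then have "bounded_linear (\<lambda>u. B u \<phi>)"
    by (rule bounded_linear.intro)
      (use K(2)[OF assms] in \<open>auto simp: bounded_linear_axioms_def ac_simps intro!: exI[of _ "K * (norm \<phi> + norm (As \<phi>))"]\<close>)
  then obtain v where v: "\<And>u. B u \<phi> = u \<bullet> v" using riesz_representation by blast
  have "(THE v. \<forall>u. u \<bullet> v = B u \<phi>) = v"
    by (rule the_equality) (auto simp: v intro: inner_eq_imp_eq)
  then show ?thesis by (simp add: ctrl_adjoint_def v)
qed

lemma Bs_bounded:
  obtains K where "0 \<le> K" "\<And>\<phi>. \<phi> \<in> DA \<Longrightarrow> norm (Bs \<phi>) \<le> K * (norm \<phi> + norm (As \<phi>))"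
proof -
  obtain K where K: "0 \<le> K" "\<And>u \<phi>. \<phi> \<in> DA \<Longrightarrow> \<bar>B u \<phi>\<bar> \<le> K * norm u * (norm \<phi> + norm (As \<phi>))"
    using B_bounded by blast
  have "norm (Bs \<phi>) \<le> K * (norm \<phi> + norm (As \<phi>))" if "\<phi> \<in> DA" for \<phi>
  proof (rule norm_le_if_inner_le)
    show "x \<bullet> Bs \<phi> \<le> K * (norm \<phi> + norm (As \<phi>)) * norm x" for x
      using K(2)[OF that, of x] by (simp add: inner_Bs that ac_simps abs_le_iff)
  qed (use K(1) in simp)
  with K(1) show thesis using that by blast
qed

lemma B_linear:
  assumes "\<phi> \<in> DA" "\<psi> \<in> DA"
  shows "B u (\<phi> + \<psi>) = B u \<phi> + B u \<psi>" "B u (c *\<^sub>R \<phi>) = c * B u \<phi>"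
proof -
  have "B u \<in> adj_dom_dual A" using ctrl by (simp add: control_operator_def)
  then show "B u (\<phi> + \<psi>) = B u \<phi> + B u \<psi>" "B u (c *\<^sub>R \<phi>) = c * B u \<phi>"
    using assms unfolding adj_dom_dual_def by blast+
qed

lemma Bs_add: "\<phi> \<in> DA \<Longrightarrow> \<psi> \<in> DA \<Longrightarrow> Bs (\<phi> + \<psi>) = Bs \<phi> + Bs \<psi>"
  by (rule inner_eq_imp_eq) (simp add: inner_Bs inner_add_right DA_add B_linear)

lemma Bs_scaleR: "\<phi> \<in> DA \<Longrightarrow> Bs (c *\<^sub>R \<phi>) = c *\<^sub>R Bs \<phi>"
  by (rule inner_eq_imp_eq) (simp add: inner_Bs DA_scaleR B_linear)

lemma Bs_diff: "\<phi> \<in> DA \<Longrightarrow> \<psi> \<in> DA \<Longrightarrow> Bs (\<phi> - \<psi>) = Bs \<phi> - Bs \<psi>"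
  using Bs_add[of \<phi> "(-1) *\<^sub>R \<psi>"] Bs_scaleR[of \<psi> "-1"] DA_scaleR[of \<psi> "-1"] by simp

text \<open>\<open>Bs\<close> is bounded only in the graph norm, so the orbits of both
  \<open>\<phi>\<close> and \<open>As \<phi>\<close> have to be continuous; the second one appears
  because \<open>As\<close> commutes with the adjoint semigroup.\<close>

lemma Bs_Ss_continuous_on:
  assumes "\<phi> \<in> DA"
  shows "continuous_on {0..} (\<lambda>s. Bs (Ss s \<phi>))"
proof -
  obtain K where K: "0 \<le> K" "\<And>\<phi>. \<phi> \<in> DA \<Longrightarrow> norm (Bs \<phi>) \<le> K * (norm \<phi> + norm (As \<phi>))"
    using Bs_bounded by blast
  show ?thesis
    unfolding continuous_on_def
  proof
    fix t :: real assume t: "t \<in> {0..}"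
    have bound: "norm (Bs (Ss s \<phi>) - Bs (Ss t \<phi>))
        \<le> K * (norm (Ss s \<phi> - Ss t \<phi>) + norm (Ss s (As \<phi>) - Ss t (As \<phi>)))" if "s \<in> {0..}" for s
      using K(2)[of "Ss s \<phi> - Ss t \<phi>"] that t assms by (simp add: Ss_in_DA DA_diff Bs_diff)
    have "((\<lambda>s. K * (norm (Ss s \<phi> - Ss t \<phi>) + norm (Ss s (As \<phi>) - Ss t (As \<phi>))))
        \<longlongrightarrow> K * (norm (Ss t \<phi> - Ss t \<phi>) + norm (Ss t (As \<phi>) - Ss t (As \<phi>)))) (at t within {0..})"
      using Ss_continuous_on t unfolding continuous_on_def by (intro tendsto_intros) auto
    then have lim: "((\<lambda>s. K * (norm (Ss s \<phi> - Ss t \<phi>) + norm (Ss s (As \<phi>) - Ss t (As \<phi>)))) \<longlongrightarrow> 0) (at t within {0..})"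
      by simp
    have "\<forall>\<^sub>F s in at t within {0..}. norm (Bs (Ss s \<phi>) - Bs (Ss t \<phi>))
        \<le> K * (norm (Ss s \<phi> - Ss t \<phi>) + norm (Ss s (As \<phi>) - Ss t (As \<phi>)))"
      using bound by (auto simp: eventually_at_filter)
    then have "((\<lambda>s. Bs (Ss s \<phi>) - Bs (Ss t \<phi>)) \<longlongrightarrow> 0) (at t within {0..})"
      using lim by (rule Lim_null_comparison)
    then show "((\<lambda>s. Bs (Ss s \<phi>)) \<longlongrightarrow> Bs (Ss t \<phi>)) (at t within {0..})"
      by (simp add: LIM_zero_iff)
  qed
qed

lemma Bs_Ss_continuous_on':
  assumes "\<phi> \<in> DA" "continuous_on X f" "\<And>x. x \<in> X \<Longrightarrow> 0 \<le> f x"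
  shows "continuous_on X (\<lambda>s. Bs (Ss (f s) \<phi>))"
  by (rule continuous_on_compose2[OF Bs_Ss_continuous_on[OF assms(1)] assms(2)]) (use assms(3) in auto)

lemma sqint_Bs_Ss: "\<phi> \<in> DA \<Longrightarrow> 0 \<le> a \<Longrightarrow> sqint {a..b} (\<lambda>s. Bs (Ss s \<phi>))"
  by (intro sqint_continuous Bs_Ss_continuous_on' continuous_intros) auto

lemma sqint_Bs_Ss_reflect: "\<phi> \<in> DA \<Longrightarrow> b \<le> t \<Longrightarrow> sqint {a..b} (\<lambda>s. Bs (Ss (t - s) \<phi>))"
  by (intro sqint_continuous Bs_Ss_continuous_on' continuous_intros) auto

section \<open>The input map, its duality formula and its bounds\<close>

definition Phi :: "real \<Rightarrow> (real \<Rightarrow> 'u) \<Rightarrow> 'h" where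
  "Phi t u = (THE h. represented_by A (input_functional S B u t) h)"

lemma state_eq: "state A S B x0 u t = S t x0 + Phi t u"
  by (simp add: state_def Phi_def)

lemma input_functional_eq_integral:
  assumes "sqint {0..t} u" "\<phi> \<in> DA"
  shows "input_functional S B u t \<phi> = integral {0..t} (\<lambda>s. u s \<bullet> Bs (Ss (t - s) \<phi>))"
proof -
  have "input_functional S B u t \<phi> = (LINT s:{0..t}|lebesgue. u s \<bullet> Bs (Ss (t - s) \<phi>))"
    unfolding input_functional_def ext_semigroup_def
    by (rule set_lebesgue_integral_cong) (use assms in \<open>auto simp: inner_Bs Ss_in_DA\<close>)
  also have "\<dots> = integral {0..t} (\<lambda>s. u s \<bullet> Bs (Ss (t - s) \<phi>))"
    by (intro set_lebesgue_integral_eq_integral(2) sqint_inner_absolutely_integrable assms(1)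
        sqint_Bs_Ss_reflect assms(2)) auto
  finally show ?thesis .
qed

lemma Phi_eq_if_represented:
  "represented_by A (input_functional S B u t) h \<Longrightarrow> Phi t u = h"
  unfolding Phi_def represented_by_def
  by (rule the_equality) (auto intro: inner_DA_eq_imp_eq)

lemma inner_Phi:
  assumes "0 \<le> t" "sqint {0..t} u" "\<phi> \<in> DA"
  shows "Phi t u \<bullet> \<phi> = integral {0..t} (\<lambda>s. u s \<bullet> Bs (Ss (t - s) \<phi>))"
proof -
  \<comment> \<open>Admissibility speaks of a positive horizon and of controls on all of it.
    Extension by zero to [0, t + 1] covers t = 0 and controls known only up to
    \<open>t\<close>.\<close>
  define u' where "u' = (\<lambda>s. if s \<in> {0..t} then u s else 0)"
  have "sqint {0..t + 1} u'"
    unfolding u'_def by (rule sqint_subset[OF iffD2[OF sqint_UNIV assms(2)]]) auto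
  then have "u' \<in> L2 (t + 1)" by (simp add: L2_iff_sqint)
  then obtain f where "\<forall>r\<in>{0..t + 1}. represented_by A (input_functional S B u' r) (f r)"
    using adm[unfolded admissible_def, rule_format, of "t + 1" u'] assms(1) by auto
  then have "represented_by A (input_functional S B u' t) (f t)" using assms(1) by simp
  moreover have "input_functional S B u' t \<psi> = input_functional S B u t \<psi>" for \<psi>
    unfolding input_functional_def by (rule set_lebesgue_integral_cong) (auto simp: u'_def)
  ultimately have *: "represented_by A (input_functional S B u t) (f t)"
    by (simp add: represented_by_def)
  then have "Phi t u \<bullet> \<phi> = input_functional S B u t \<phi>"
    using Phi_eq_if_represented[OF *] assms(3) by (simp add: represented_by_def)
  then show ?thesis using input_functional_eq_integral[OF assms(2,3)] by simp
qed

lemma Phi_continuous_on: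
  assumes "sqint {0..T} u"
  shows "continuous_on {0..T} (\<lambda>t. Phi t u)"
proof (cases "T > 0")
  case True
  then obtain f where f: "continuous_on {0..T} f"
      "\<forall>t\<in>{0..T}. represented_by A (input_functional S B u t) (f t)"
    using adm[unfolded admissible_def, rule_format, of T u] assms by (auto simp: L2_iff_sqint)
  have "continuous_on {0..T} f \<longleftrightarrow> continuous_on {0..T} (\<lambda>t. Phi t u)"
    by (rule continuous_on_cong) (use f(2) in \<open>auto dest!: bspec Phi_eq_if_represented\<close>)
  then show ?thesis using f(1) by simp
next
  case False
  then have "{0..T} = {} \<or> {0..T} = {0}" by auto
  then show ?thesis by auto
qed

lemma Phi_spike:
  assumes "0 \<le> t" "sqint {0..t} u" "negligible N" "\<And>s. s \<in> {0..t} - N \<Longrightarrow> w s = u s"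
  shows "Phi t w = Phi t u"
proof (rule inner_DA_eq_imp_eq)
  fix \<phi> assume \<phi>: "\<phi> \<in> DA"
  have w: "sqint {0..t} w" using assms(4) by (rule sqint_spike[OF assms(2,3)])
  have "integral {0..t} (\<lambda>s. w s \<bullet> Bs (Ss (t - s) \<phi>)) = integral {0..t} (\<lambda>s. u s \<bullet> Bs (Ss (t - s) \<phi>))"
    by (rule integral_spike[OF assms(3)]) (use assms(4) in simp)
  then show "Phi t w \<bullet> \<phi> = Phi t u \<bullet> \<phi>" using assms(1,2) w \<phi> by (simp add: inner_Phi)
qed

lemma Phi_cong:
  assumes "0 \<le> t" "sqint {0..t} u" "\<And>s. s \<in> {0..t} \<Longrightarrow> w s = u s"
  shows "Phi t w = Phi t u"
  using Phi_spike[of t u "{}" w] assms by simp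

lemma Phi_add:
  assumes "0 \<le> t" "sqint {0..t} u" "sqint {0..t} w"
  shows "Phi t (\<lambda>s. u s + w s) = Phi t u + Phi t w"
proof (rule inner_DA_eq_imp_eq)
  fix \<phi> assume \<phi>: "\<phi> \<in> DA"
  have "sqint {0..t} (\<lambda>s. u s + w s)" using assms by (intro sqint_add) auto
  then show "Phi t (\<lambda>s. u s + w s) \<bullet> \<phi> = (Phi t u + Phi t w) \<bullet> \<phi>"
    using assms \<phi> sqint_Bs_Ss_reflect[OF \<phi>, of t t 0]
    by (simp add: inner_Phi inner_add_left integral_add sqint_inner_integrable)
qed

lemma Phi_scaleR:
  assumes "0 \<le> t" "sqint {0..t} u"
  shows "Phi t (\<lambda>s. c *\<^sub>R u s) = c *\<^sub>R Phi t u"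
proof (rule inner_DA_eq_imp_eq)
  fix \<phi> assume \<phi>: "\<phi> \<in> DA"
  have "sqint {0..t} (\<lambda>s. c *\<^sub>R u s)" using assms by (intro sqint_scaleR) auto
  then show "Phi t (\<lambda>s. c *\<^sub>R u s) \<bullet> \<phi> = (c *\<^sub>R Phi t u) \<bullet> \<phi>"
    using assms \<phi> by (simp add: inner_Phi)
qed

lemma Phi_diff:
  assumes "0 \<le> t" "sqint {0..t} u" "sqint {0..t} w"
  shows "Phi t (\<lambda>s. u s - w s) = Phi t u - Phi t w"
  using Phi_add[OF assms(1,2) sqint_scaleR[OF assms(3), of "-1"]] Phi_scaleR[OF assms(1,3), of "-1"] by simp

lemma Phi_zero:
  assumes "0 \<le> t" shows "Phi t (\<lambda>s. 0) = 0"
  using Phi_scaleR[OF assms, of "\<lambda>s. 0" 0] by simp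

text \<open>The duality integral is split at \<open>t\<close>: the early part sees the test vector
  \<open>Ss h \<phi>\<close>, which becomes \<open>S h\<close> on the other side, and the late part
  is the shifted control.\<close>

lemma Phi_cocycle:
  assumes "0 \<le> t" "0 \<le> h" "sqint {0..t + h} u"
  shows "Phi (t + h) u = S h (Phi t u) + Phi h (\<lambda>s. u (s + t))"
proof (rule inner_DA_eq_imp_eq)
  fix \<phi> assume \<phi>: "\<phi> \<in> DA"
  have u: "sqint {0..t} u" "sqint {0 + t..h + t} u"
    by (rule sqint_subset[OF assms(3)]; use assms in auto)+
  have uh: "sqint {0..h} (\<lambda>s. u (s + t))" using sqint_shift[OF u(2)] .
  let ?f = "\<lambda>s. u s \<bullet> Bs (Ss (t + h - s) \<phi>)"
  have "?f integrable_on {0..t + h}"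
    using sqint_Bs_Ss_reflect[OF \<phi>, of "t + h" "t + h" 0] assms by (intro sqint_inner_integrable) auto
  then have "Phi (t + h) u \<bullet> \<phi> = integral {0..t} ?f + integral {t..t + h} ?f"
    using assms \<phi> by (simp add: inner_Phi Henstock_Kurzweil_Integration.integral_combine)
  also have "integral {0..t} ?f = integral {0..t} (\<lambda>s. u s \<bullet> Bs (Ss (t - s) (Ss h \<phi>)))"
    using assms by (intro integral_cong) (simp flip: Ss_add add: algebra_simps)
  also have "\<dots> = Phi t u \<bullet> Ss h \<phi>"
    using assms u \<phi> by (simp add: inner_Phi Ss_in_DA)
  also have "\<dots> = S h (Phi t u) \<bullet> \<phi>" by (simp add: inner_Ss)
  also have "integral {t..t + h} ?f = integral {0..h} (?f \<circ> (+) t)"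
    by (subst integral_shift_Icc_real) (simp add: add.commute)
  also have "\<dots> = integral {0..h} (\<lambda>s. u (s + t) \<bullet> Bs (Ss (h - s) \<phi>))"
    by (intro integral_cong) (simp add: o_def add.commute)
  also have "\<dots> = Phi h (\<lambda>s. u (s + t)) \<bullet> \<phi>" using assms uh \<phi> by (simp add: inner_Phi)
  finally show "Phi (t + h) u \<bullet> \<phi> = (S h (Phi t u) + Phi h (\<lambda>s. u (s + t))) \<bullet> \<phi>"
    by (simp add: inner_add_left)
qed

text \<open>By Banach-Steinhaus in \<open>L\<^sup>2\<close>: the functional \<open>u \<mapsto> \<langle>Phi \<tau> u, \<phi>\<rangle>\<close> is the inner product with the
  output of \<open>\<phi>\<close>.\<close>

lemma output_bounded:
  assumes "0 \<le> \<tau>"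
  shows "\<exists>M\<ge>0. \<forall>\<phi>\<in>DA. sqnorm {0..\<tau>} (\<lambda>s. Bs (Ss (\<tau> - s) \<phi>)) \<le> (M * norm \<phi>)\<^sup>2"
proof -
  let ?I = "{\<phi> \<in> DA. norm \<phi> \<le> 1}"
  have "\<exists>K. \<forall>\<phi>\<in>?I. sqnorm {0..\<tau>} (\<lambda>s. Bs (Ss (\<tau> - s) \<phi>)) \<le> K"
  proof (rule weakly_bounded_l2)
    show "sqint {0..\<tau>} (\<lambda>s. Bs (Ss (\<tau> - s) \<phi>))" if "\<phi> \<in> ?I" for \<phi>
      using that by (intro sqint_Bs_Ss_reflect) auto
    fix u :: "real \<Rightarrow> 'u" assume u: "sqint {0..\<tau>} u"
    have "\<bar>integral {0..\<tau>} (\<lambda>s. u s \<bullet> Bs (Ss (\<tau> - s) \<phi>))\<bar> \<le> norm (Phi \<tau> u)" if "\<phi> \<in> ?I" for \<phi>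
    proof -
      have "\<bar>Phi \<tau> u \<bullet> \<phi>\<bar> \<le> norm (Phi \<tau> u) * norm \<phi>" by (rule Cauchy_Schwarz_ineq2)
      also have "\<dots> \<le> norm (Phi \<tau> u) * 1" using that by (intro mult_left_mono) auto
      finally show ?thesis using that u assms by (simp add: inner_Phi)
    qed
    then show "\<exists>K. \<forall>\<phi>\<in>?I. \<bar>integral {0..\<tau>} (\<lambda>s. u s \<bullet> Bs (Ss (\<tau> - s) \<phi>))\<bar> \<le> K" by blast
  qed
  then obtain K where K: "\<And>\<phi>. \<phi> \<in> DA \<Longrightarrow> norm \<phi> \<le> 1 \<Longrightarrow>
      sqnorm {0..\<tau>} (\<lambda>s. Bs (Ss (\<tau> - s) \<phi>)) \<le> K" by auto
  have "sqnorm {0..\<tau>} (\<lambda>s. Bs (Ss (\<tau> - s) \<phi>)) \<le> (sqrt \<bar>K\<bar> * norm \<phi>)\<^sup>2" if \<phi>: "\<phi> \<in> DA" for \<phi>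
  proof (cases "\<phi> = 0")
    case True
    have "Bs 0 = 0" using Bs_scaleR[OF DA_zero(1), of 0] by simp
    then show ?thesis using True by (simp add: linear_0[OF Ss_linear])
  next
    case False
    define \<psi> where "\<psi> = (1 / norm \<phi>) *\<^sub>R \<phi>"
    have \<psi>: "\<psi> \<in> DA" "norm \<psi> \<le> 1" using \<phi> False by (auto simp: \<psi>_def DA_scaleR)
    have "sqnorm {0..\<tau>} (\<lambda>s. Bs (Ss (\<tau> - s) \<psi>))
        = integral {0..\<tau>} (\<lambda>s. (1 / norm \<phi>)\<^sup>2 * (norm (Bs (Ss (\<tau> - s) \<phi>)))\<^sup>2)"
      by (intro integral_cong)
        (use \<phi> in \<open>simp add: \<psi>_def linear_scale[OF Ss_linear] Bs_scaleR Ss_in_DA power_divide\<close>)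
    also have "\<dots> = (1 / norm \<phi>)\<^sup>2 * sqnorm {0..\<tau>} (\<lambda>s. Bs (Ss (\<tau> - s) \<phi>))" by simp
    finally have "(1 / norm \<phi>)\<^sup>2 * sqnorm {0..\<tau>} (\<lambda>s. Bs (Ss (\<tau> - s) \<phi>)) \<le> \<bar>K\<bar>"
      using K[OF \<psi>] by linarith
    then show ?thesis using False by (simp add: power_mult_distrib power_divide pos_divide_le_eq)
  qed
  then show ?thesis by (intro exI[of _ "sqrt \<bar>K\<bar>"]) auto
qed

text \<open>By duality it is enough to bound the output of \<open>\<phi>\<close>. Up to a time shift
  the output over [0, t] is the final piece of the one over [0, \<tau>], so the bound at the single
  time \<open>\<tau>\<close> serves all \<open>t\<close>.\<close>

lemma Phi_bounded:
  "\<exists>M\<ge>0. \<forall>t\<in>{0..\<tau>}. \<forall>u. sqint {0..t} u \<longrightarrow> norm (Phi t u) \<le> M * sqrt (sqnorm {0..t} u)"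
proof (cases "0 \<le> \<tau>")
  case True
  then obtain M where M: "M \<ge> 0"
      "\<And>\<phi>. \<phi> \<in> DA \<Longrightarrow> sqnorm {0..\<tau>} (\<lambda>s. Bs (Ss (\<tau> - s) \<phi>)) \<le> (M * norm \<phi>)\<^sup>2"
    using output_bounded by blast
  have "norm (Phi t u) \<le> M * sqrt (sqnorm {0..t} u)"
    if t: "t \<in> {0..\<tau>}" and u: "sqint {0..t} u" for t u
  proof (rule norm_le_if_inner_DA_le)
    fix \<phi> assume \<phi>: "\<phi> \<in> DA"
    let ?f = "\<lambda>s. (norm (Bs (Ss (\<tau> - s) \<phi>)))\<^sup>2"
    have "sqnorm {0..t} (\<lambda>s. Bs (Ss (t - s) \<phi>)) = integral {0..t} (?f \<circ> (+) (\<tau> - t))"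
      by (simp add: o_def algebra_simps)
    also have "\<dots> = integral {\<tau> - t..\<tau>} ?f" by (subst integral_shift_Icc_real) simp
    also have "\<dots> \<le> integral {0..\<tau>} ?f"
      by (rule integral_subset_le)
        (use t sqint_Bs_Ss_reflect[OF \<phi>] in \<open>auto simp: sqint_def\<close>)
    also have "\<dots> \<le> (M * norm \<phi>)\<^sup>2" by (rule M(2)[OF \<phi>])
    finally have out: "sqrt (sqnorm {0..t} (\<lambda>s. Bs (Ss (t - s) \<phi>))) \<le> M * norm \<phi>"
      using M(1) by (intro real_le_lsqrt) auto
    have "Phi t u \<bullet> \<phi> \<le> \<bar>integral {0..t} (\<lambda>s. u s \<bullet> Bs (Ss (t - s) \<phi>))\<bar>"
      using t u \<phi> by (simp add: inner_Phi)
    also have "\<dots> \<le> sqrt (sqnorm {0..t} u) * sqrt (sqnorm {0..t} (\<lambda>s. Bs (Ss (t - s) \<phi>)))"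
      by (rule integral_inner_le_sqrt) (use u sqint_Bs_Ss_reflect[OF \<phi>] in auto)
    also have "\<dots> \<le> sqrt (sqnorm {0..t} u) * (M * norm \<phi>)"
      by (intro mult_left_mono out real_sqrt_ge_zero integral_nonneg sqint_norm_integrable u) auto
    finally show "Phi t u \<bullet> \<phi> \<le> M * sqrt (sqnorm {0..t} u) * norm \<phi>"
      by (simp add: ac_simps)
  qed (use M(1) u in \<open>auto intro!: mult_nonneg_nonneg integral_nonneg sqint_norm_integrable\<close>)
  with M(1) show ?thesis by blast
next
  case False
  then show ?thesis by (intro exI[of _ 0]) auto
qed

section \<open>Trajectories as weak solutions\<close>

lemma integrable_S_inner: "(\<lambda>s. S s x \<bullet> y) integrable_on {0..h}"
  by (intro integrable_continuous_real continuous_on_inner S_continuous_on' continuous_on_const) auto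

lemma S_weak:
  assumes "0 \<le> h" "\<phi> \<in> DA"
  shows "S h x \<bullet> \<phi> = x \<bullet> \<phi> + integral {0..h} (\<lambda>s. S s x \<bullet> As \<phi>)"
proof -
  have "S h x \<bullet> \<phi> - x \<bullet> \<phi> = Sint h x \<bullet> As \<phi>"
    using Is_As[OF assms] by (simp add: inner_Is inner_Ss inner_diff_right)
  also have "\<dots> = integral {0..h} (\<lambda>s. S s x \<bullet> As \<phi>)"
    using assms(1) integral_linear[OF S_integrable[where a = 0 and b = h and x = x, OF order_refl]
          bounded_linear_inner_left[of "As \<phi>"]]
    by (simp add: Sint_apply o_def)
  finally show ?thesis by simp
qed

lemma integrable_Phi_inner: "sqint {0..h} w \<Longrightarrow> (\<lambda>s. Phi s w \<bullet> y) integrable_on {0..h}"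
  by (intro integrable_continuous_real continuous_on_inner Phi_continuous_on continuous_on_const)

text \<open>No regularity of \<open>As \<phi>\<close> is available to differentiate under the integral defining \<open>Phi\<close>; instead
  the increments of both sides over \<open>[a, b]\<close> are compared by means of \<open>Phi_cocycle\<close>.\<close>

lemma Phi_weak:
  assumes tau: "0 \<le> \<tau>" and w: "sqint {0..\<tau>} w" and \<phi>: "\<phi> \<in> DA"
  shows "Phi \<tau> w \<bullet> \<phi> = integral {0..\<tau>} (\<lambda>s. Phi s w \<bullet> As \<phi> + w s \<bullet> Bs \<phi>)"
proof -
  define P where "P s = Phi s w" for s
  define y where "y = As \<phi>"
  define g where "g s = P s \<bullet> y + w s \<bullet> Bs \<phi>" for s
  \<comment> \<open>\<open>N s\<close> dominates both 1 and \<open>norm (w s)\<close>, so errors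
    proportional to the length and errors proportional to the control are both absorbed by
    increments of \<open>V\<close>.\<close>
  define N where "N s = 1 + (norm (w s))\<^sup>2" for s
  define G where "G t = P t \<bullet> \<phi> - integral {0..t} g" for t
  define V where "V t = integral {0..t} N" for t
  have Pcont: "continuous_on {0..\<tau>} P" unfolding P_def using Phi_continuous_on[OF w] .
  have w_sub: "sqint {a..b} w" if "0 \<le> a" "b \<le> \<tau>" for a b
    by (rule sqint_subset[OF w]) (use that in auto)
  have Py: "(\<lambda>s. P s \<bullet> y) integrable_on {a..b}" if "0 \<le> a" "b \<le> \<tau>" for a b
    by (intro integrable_continuous_real continuous_on_inner continuous_on_const
        continuous_on_subset[OF Pcont]) (use that in auto)
  have wB: "(\<lambda>s. w s \<bullet> Bs \<phi>) integrable_on {a..b}" if "0 \<le> a" "b \<le> \<tau>" for a b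
    by (intro sqint_inner_integrable w_sub that) auto
  have gint: "g integrable_on {a..b}" if "0 \<le> a" "b \<le> \<tau>" for a b
    unfolding g_def by (intro integrable_add Py wB that)
  have Nint: "N integrable_on {a..b}" if "0 \<le> a" "b \<le> \<tau>" for a b
    unfolding N_def by (intro integrable_add sqint_norm_integrable w_sub that) auto
  have "bounded (P ` {0..\<tau>})" by (intro compact_imp_bounded compact_continuous_image Pcont) simp
  then obtain C0 where C0: "\<And>s. s \<in> {0..\<tau>} \<Longrightarrow> norm (P s) \<le> C0" unfolding bounded_iff by blast
  define C where "C = max C0 0"
  have C: "0 \<le> C" "\<And>s. s \<in> {0..\<tau>} \<Longrightarrow> norm (P s) \<le> C" using C0 by (force simp: C_def)+
  have "G \<tau> = G 0"
  proof (rule small_increments_imp_const[OF tau, where V = V])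
    fix e :: real assume "e > 0"
    \<comment> \<open>Three errors are weighted in the denominator: \<open>C\<close> for
      \<open>Is\<close> against its linearization, \<open>norm y\<close> for the variation of
      \<open>P\<close>, and 1 for the variation of the output of \<open>\<phi>\<close>.\<close>
    define e' where "e' = e / (C + norm y + 1)"
    have pos: "C + norm y + 1 > 0" using C(1) norm_ge_zero[of y] by linarith
    have e': "e' > 0" "e' * (C + norm y + 1) = e" using pos \<open>e > 0\<close> by (auto simp: e'_def)
    obtain d1 where d1: "d1 > 0"
        "\<And>s t. s \<in> {0..\<tau>} \<Longrightarrow> t \<in> {0..\<tau>} \<Longrightarrow> dist t s < d1 \<Longrightarrow> dist (P t) (P s) < e'"
      using compact_uniformly_continuous[OF Pcont compact_Icc] e'(1)
      unfolding uniformly_continuous_on_def by metis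
    obtain d2 where d2: "d2 > 0" "\<And>h. 0 \<le> h \<Longrightarrow> h < d2 \<Longrightarrow> norm (Is h y - h *\<^sub>R y) \<le> e' * h"
      using Is_near_0[OF e'(1)] by blast
    obtain d3 where d3: "d3 > 0" "\<And>r. 0 \<le> r \<Longrightarrow> r < d3 \<Longrightarrow> norm (Bs (Ss r \<phi>) - Bs \<phi>) < e'"
    proof -
      have "\<exists>d>0. \<forall>r\<in>{0..}. dist r 0 < d \<longrightarrow> dist (Bs (Ss r \<phi>)) (Bs (Ss 0 \<phi>)) < e'"
        using Bs_Ss_continuous_on[OF \<phi>] e'(1) unfolding continuous_on_iff by (meson atLeast_iff order_refl)
      then show thesis using that by (auto simp: dist_norm)
    qed
    have main: "\<bar>G b - G a\<bar> \<le> e * (V b - V a)"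
      if ab: "0 \<le> a" "a \<le> b" "b \<le> \<tau>" "b - a < min d1 (min d2 d3)" for a b
    proof -
      define h where "h = b - a"
      have h: "0 \<le> h" "h < d1" "h < d2" "h < d3" using ab by (auto simp: h_def)
      have VN: "V b - V a = integral {a..b} N"
        unfolding V_def using Henstock_Kurzweil_Integration.integral_combine[OF ab(1,2) Nint[OF order_refl ab(3)]] by simp
      have hN: "h \<le> integral {a..b} N"
      proof -
        have "integral {a..b} (\<lambda>s. 1) \<le> integral {a..b} N"
          by (rule integral_le) (use ab Nint in \<open>auto simp: N_def\<close>)
        then show ?thesis using ab by (simp add: h_def)
      qed
      \<comment> \<open>The pointwise error on [a, b]: the state frozen at \<open>a\<close> against
        the running state, and the output propagated to \<open>b\<close> against its value at time
        0.\<close>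
      define f where "f s = (P a - P s) \<bullet> y + w s \<bullet> (Bs (Ss (b - s) \<phi>) - Bs \<phi>)" for s
      have wb: "(\<lambda>s. w s \<bullet> Bs (Ss (b - s) \<phi>)) integrable_on {a..b}"
        by (intro sqint_inner_integrable w_sub sqint_Bs_Ss_reflect \<phi>) (use ab in auto)
      have f_eq: "f = (\<lambda>s. P a \<bullet> y + (w s \<bullet> Bs (Ss (b - s) \<phi>) - g s))"
        by (auto simp: f_def g_def fun_eq_iff inner_diff_left inner_diff_right)
      have fint: "f integrable_on {a..b}"
        unfolding f_eq by (intro integrable_add integrable_diff wb gint) (use ab in auto)
      have int_f: "integral {a..b} f = h * (P a \<bullet> y) + (integral {a..b} (\<lambda>s. w s \<bullet> Bs (Ss (b - s) \<phi>)) - integral {a..b} g)"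
      proof -
        have "integral {a..b} f = integral {a..b} (\<lambda>s. P a \<bullet> y)
            + integral {a..b} (\<lambda>s. w s \<bullet> Bs (Ss (b - s) \<phi>) - g s)"
          unfolding f_eq by (rule integral_add) (use ab wb gint in \<open>auto intro!: integrable_diff\<close>)
        also have "integral {a..b} (\<lambda>s. w s \<bullet> Bs (Ss (b - s) \<phi>) - g s)
            = integral {a..b} (\<lambda>s. w s \<bullet> Bs (Ss (b - s) \<phi>)) - integral {a..b} g"
          by (rule integral_diff) (use ab wb gint in auto)
        finally show ?thesis using ab by (simp add: h_def)
      qed
      have Pb: "P b = S h (P a) + Phi h (\<lambda>s. w (s + a))"
        using Phi_cocycle[of a h w] ab w_sub[of 0 b] by (simp add: P_def h_def)
      have "sqint {0 + a..h + a} w" using ab by (intro w_sub) (auto simp: h_def)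
      then have "Phi h (\<lambda>s. w (s + a)) \<bullet> \<phi> = integral {0..h} (\<lambda>s. w (s + a) \<bullet> Bs (Ss (h - s) \<phi>))"
        using h \<phi> by (intro inner_Phi sqint_shift)
      also have "\<dots> = integral {0..h} ((\<lambda>s. w s \<bullet> Bs (Ss (b - s) \<phi>)) \<circ> (+) a)"
        by (simp add: o_def h_def algebra_simps)
      also have "\<dots> = integral {a..b} (\<lambda>s. w s \<bullet> Bs (Ss (b - s) \<phi>))"
        by (subst integral_shift_Icc_real) (simp add: h_def)
      finally have Phi_h: "Phi h (\<lambda>s. w (s + a)) \<bullet> \<phi> = integral {a..b} (\<lambda>s. w s \<bullet> Bs (Ss (b - s) \<phi>))" .
      have "S h (P a) \<bullet> \<phi> - P a \<bullet> \<phi> = P a \<bullet> Is h y"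
        using h(1) \<phi> by (simp add: y_def Is_As inner_Ss inner_diff_right)
      then have "P b \<bullet> \<phi> - P a \<bullet> \<phi> - integral {a..b} g = P a \<bullet> (Is h y - h *\<^sub>R y) + integral {a..b} f"
        using Pb Phi_h int_f by (simp add: inner_add_left inner_diff_right)
      moreover have "integral {0..b} g = integral {0..a} g + integral {a..b} g"
        using Henstock_Kurzweil_Integration.integral_combine[OF ab(1,2) gint[OF order_refl ab(3)]] by simp
      ultimately have "G b - G a = P a \<bullet> (Is h y - h *\<^sub>R y) + integral {a..b} f"
        by (simp add: G_def)
      moreover have "\<bar>P a \<bullet> (Is h y - h *\<^sub>R y)\<bar> \<le> C * e' * integral {a..b} N"
      proof -
        have "\<bar>P a \<bullet> (Is h y - h *\<^sub>R y)\<bar> \<le> norm (P a) * norm (Is h y - h *\<^sub>R y)"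
          by (rule Cauchy_Schwarz_ineq2)
        also have "\<dots> \<le> C * (e' * h)" using ab h C d2(2) by (intro mult_mono) auto
        also have "\<dots> \<le> C * (e' * integral {a..b} N)" using C(1) e'(1) hN by (intro mult_left_mono) auto
        finally show ?thesis by simp
      qed
      moreover have "norm (integral {a..b} f) \<le> integral {a..b} (\<lambda>s. (e' * (norm y + 1)) * N s)"
      proof (rule integral_norm_bound_integral)
        show "(\<lambda>s. (e' * (norm y + 1)) * N s) integrable_on {a..b}"
          using ab by (intro integrable_on_mult_right Nint) auto
        fix s assume s: "s \<in> {a..b}"
        have "2 * norm (w s) \<le> N s" using sum_squares_bound[of 1 "norm (w s)"] by (simp add: N_def)
        then have N1: "1 \<le> N s" "norm (w s) \<le> N s"
          using norm_ge_zero[of "w s"] by (simp add: N_def, linarith)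
        have "norm ((P a - P s) \<bullet> y) \<le> norm (P a - P s) * norm y" by (simp add: Cauchy_Schwarz_ineq2)
        also have "\<dots> \<le> e' * norm y"
          using d1(2)[of s a] s ab h by (intro mult_right_mono) (auto simp: dist_norm h_def)
        also have "\<dots> \<le> e' * norm y * N s"
          using mult_left_mono[OF N1(1), of "e' * norm y"] e'(1) by simp
        finally have 1: "norm ((P a - P s) \<bullet> y) \<le> e' * norm y * N s" .
        have "norm (w s \<bullet> (Bs (Ss (b - s) \<phi>) - Bs \<phi>)) \<le> norm (w s) * norm (Bs (Ss (b - s) \<phi>) - Bs \<phi>)"
          by (simp add: Cauchy_Schwarz_ineq2)
        also have "\<dots> \<le> N s * e'"
          using d3(2)[of "b - s"] s h N1 by (intro mult_mono) (auto simp: h_def)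
        finally have 2: "norm (w s \<bullet> (Bs (Ss (b - s) \<phi>) - Bs \<phi>)) \<le> N s * e'" .
        show "norm (f s) \<le> e' * (norm y + 1) * N s"
          using norm_triangle_mono[OF 1 2] unfolding f_def by (simp add: algebra_simps)
      qed (use fint in auto)
      ultimately have "\<bar>G b - G a\<bar> \<le> C * e' * integral {a..b} N + e' * (norm y + 1) * integral {a..b} N"
        by simp
      also have "\<dots> = e' * (C + norm y + 1) * integral {a..b} N" by (simp add: algebra_simps)
      finally show ?thesis unfolding e'(2) VN .
    qed
    show "\<exists>d>0. \<forall>a b. 0 \<le> a \<and> a \<le> b \<and> b \<le> \<tau> \<and> b - a < d \<longrightarrow> \<bar>G b - G a\<bar> \<le> e * (V b - V a)"
      by (intro exI[of _ "min d1 (min d2 d3)"] conjI allI impI main) (use d1(1) d2(1) d3(1) in auto)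
  qed
  moreover have "P 0 \<bullet> \<phi> = 0"
    unfolding P_def using w_sub[of 0 0] tau \<phi> by (subst inner_Phi) auto
  moreover have "g = (\<lambda>s. Phi s w \<bullet> As \<phi> + w s \<bullet> Bs \<phi>)"
    by (simp add: fun_eq_iff g_def P_def y_def)
  ultimately show ?thesis by (simp add: G_def P_def)
qed

lemma weak_solution:
  assumes h: "0 \<le> h" and w: "sqint {0..h} w" and \<phi>: "\<phi> \<in> DA"
  shows "(S h x + Phi h w) \<bullet> \<phi> = x \<bullet> \<phi> + integral {0..h} (\<lambda>s. (S s x + Phi s w) \<bullet> As \<phi> + w s \<bullet> Bs \<phi>)"
proof -
  have "(\<lambda>s. w s \<bullet> Bs \<phi>) integrable_on {0..h}" using w by (intro sqint_inner_integrable) auto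
  then have "integral {0..h} (\<lambda>s. S s x \<bullet> As \<phi> + (Phi s w \<bullet> As \<phi> + w s \<bullet> Bs \<phi>))
      = integral {0..h} (\<lambda>s. S s x \<bullet> As \<phi>) + integral {0..h} (\<lambda>s. Phi s w \<bullet> As \<phi> + w s \<bullet> Bs \<phi>)"
    by (intro integral_add integrable_add integrable_S_inner integrable_Phi_inner w)
  then show ?thesis
    using S_weak[OF h \<phi>, of x] Phi_weak[OF h w \<phi>] by (simp add: inner_add_left add.assoc)
qed

text \<open>The defect \<open>r\<close> satisfies the homogeneous weak equation and
  \<open>r (a + h) = S a (r h) + r a\<close>. Hence the increment of its pairing with
  \<open>\<phi>\<close> over [a, b] is the pairing of \<open>r (b - a)\<close> with
  \<open>Ss a \<phi>\<close>, which is of smaller order than b - a because \<open>r\<close> is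
  continuous with value 0 at 0.\<close>

lemma steady_state_trajectory:
  assumes "steady_state A B x u" "0 \<le> t"
  shows "S t x + Phi t (\<lambda>s. u) = x"
proof -
  define r where "r t = S t x + Phi t (\<lambda>s. u) - x" for t
  have steady: "x \<bullet> As \<phi> + u \<bullet> Bs \<phi> = 0" if "\<phi> \<in> DA" for \<phi>
    using assms(1) that by (simp add: steady_state_def)
  have rcont: "continuous_on {0..t} r" for t
    unfolding r_def by (intro continuous_intros S_continuous_on' Phi_continuous_on) auto
  have r_weak: "r h \<bullet> \<phi> = integral {0..h} (\<lambda>s. r s \<bullet> As \<phi>)" if "0 \<le> h" "\<phi> \<in> DA" for h \<phi>
  proof -
    have "r h \<bullet> \<phi> = integral {0..h} (\<lambda>s. (S s x + Phi s (\<lambda>s. u)) \<bullet> As \<phi> + u \<bullet> Bs \<phi>)"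
      using weak_solution[OF that(1) sqint_const that(2), of x u] by (simp add: r_def inner_diff_left)
    also have "\<dots> = integral {0..h} (\<lambda>s. r s \<bullet> As \<phi>)"
      using steady[OF that(2)] by (intro integral_cong) (simp add: r_def inner_diff_left)
    finally show ?thesis .
  qed
  have r_add: "r (a + h) = S a (r h) + r a" if "0 \<le> a" "0 \<le> h" for a h
  proof -
    have "Phi (a + h) (\<lambda>s. u) = S a (Phi h (\<lambda>s. u)) + Phi a (\<lambda>s. u)"
      using Phi_cocycle[of h a "\<lambda>s. u"] that by (simp add: add.commute)
    then show ?thesis by (simp add: r_def S_add that blinfun.add_right blinfun.diff_right)
  qed
  have r0: "r 0 = 0"
  proof (rule inner_DA_eq_imp_eq)
    show "r 0 \<bullet> \<phi> = 0 \<bullet> \<phi>" if "\<phi> \<in> DA" for \<phi> using r_weak[OF order_refl that] by simp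
  qed
  have "r t = 0"
  proof (rule inner_DA_eq_imp_eq)
    fix \<phi> assume \<phi>: "\<phi> \<in> DA"
    obtain M where M: "M \<ge> 1" "\<And>s. 0 \<le> s \<Longrightarrow> s \<le> t \<Longrightarrow> norm (S s) \<le> M"
      using S_locally_bounded[of t] by force
    have "r t \<bullet> \<phi> = r 0 \<bullet> \<phi>"
    proof (rule small_increments_imp_const[OF assms(2), where V = "\<lambda>t. t"])
      fix e :: real assume "e > 0"
      define e' where "e' = e / (M * norm (As \<phi>) + 1)"
      have pos: "M * norm (As \<phi>) + 1 > 0" using M(1) by (simp add: add_nonneg_pos)
      have e': "e' > 0" "e' * (M * norm (As \<phi>)) \<le> e"
        using pos \<open>e > 0\<close> M(1) by (auto simp: e'_def field_simps)
      have "\<exists>d>0. \<forall>s\<in>{0..1}. dist s 0 < d \<longrightarrow> dist (r s) (r 0) < e'"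
        using rcont[of 1] e'(1) unfolding continuous_on_iff by (meson atLeastAtMost_iff order_refl zero_le_one)
      then obtain d where d: "d > 0" "\<And>s. 0 \<le> s \<Longrightarrow> s \<le> 1 \<Longrightarrow> s < d \<Longrightarrow> norm (r s) < e'"
        by (auto simp: dist_norm r0)
      have main: "\<bar>r b \<bullet> \<phi> - r a \<bullet> \<phi>\<bar> \<le> e * (b - a)"
        if ab: "0 \<le> a" "a \<le> b" "b \<le> t" "b - a < min d 1" for a b
      proof -
        have "r b = S a (r (b - a)) + r a" using r_add[of a "b - a"] ab by simp
        then have "r b \<bullet> \<phi> - r a \<bullet> \<phi> = r (b - a) \<bullet> Ss a \<phi>" by (simp add: inner_add_left inner_Ss)
        also have "\<dots> = integral {0..b - a} (\<lambda>s. r s \<bullet> Ss a (As \<phi>))"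
          using r_weak[of "b - a" "Ss a \<phi>"] ab \<phi> by (simp add: Ss_in_DA)
        also have "norm \<dots> \<le> e * (b - a - 0)"
        proof (rule integral_bound)
          show "continuous_on {0..b - a} (\<lambda>s. r s \<bullet> Ss a (As \<phi>))"
            by (intro continuous_on_inner rcont continuous_on_const)
          fix s assume s: "s \<in> {0..b - a}"
          have "norm (r s \<bullet> Ss a (As \<phi>)) \<le> norm (r s) * norm (Ss a (As \<phi>))"
            by (simp add: Cauchy_Schwarz_ineq2)
          also have "\<dots> \<le> e' * (M * norm (As \<phi>))"
          proof (rule mult_mono)
            show "norm (r s) \<le> e'" using d(2)[of s] s ab by simp
            show "norm (Ss a (As \<phi>)) \<le> M * norm (As \<phi>)"
              by (rule order.trans[OF norm_Ss_le]) (use M(2)[of a] ab in \<open>auto intro: mult_right_mono\<close>)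
          qed (use e'(1) in auto)
          finally show "norm (r s \<bullet> Ss a (As \<phi>)) \<le> e" using e'(2) by linarith
        qed (use ab in simp)
        finally show ?thesis by simp
      qed
      show "\<exists>d>0. \<forall>a b. 0 \<le> a \<and> a \<le> b \<and> b \<le> t \<and> b - a < d \<longrightarrow> \<bar>r b \<bullet> \<phi> - r a \<bullet> \<phi>\<bar> \<le> e * (b - a)"
        by (intro exI[of _ "min d 1"] conjI allI impI main) (use d(1) in auto)
    qed
    then show "r t \<bullet> \<phi> = 0 \<bullet> \<phi>" by (simp add: r0)
  qed
  then show ?thesis by (simp add: r_def)
qed

end

lemma LINT_Ioo_eq_integral:
  fixes f :: "real \<Rightarrow> real"
  assumes "f integrable_on {a..b}" "\<And>x. x \<in> {a..b} \<Longrightarrow> 0 \<le> f x"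
  shows "(LINT t:{a<..<b}|lebesgue. f t) = integral {a..b} f"
proof -
  have "f integrable_on {a<..<b}" using assms(1) by (simp add: integrable_on_Icc_iff_Ioo)
  then have "set_integrable lebesgue {a<..<b} f"
    by (rule nonnegative_absolutely_integrable_1) (use assms(2) in auto)
  then have "(LINT t:{a<..<b}|lebesgue. f t) = integral {a<..<b} f"
    by (rule set_lebesgue_integral_eq_integral(2))
  also have "\<dots> = integral {a..b} f"
    using integral_open_interval[of a b f] by simp
  finally show ?thesis .
qed

lemma L2_norm_on_Ioo:
  assumes "sqint {a..b} u"
  shows "L2_norm_on {a<..<b} u = sqrt (sqnorm {a..b} u)"
  unfolding L2_norm_on_def using assms by (subst LINT_Ioo_eq_integral) (auto simp: sqint_def)

lemma sqint_integral_eq_0_Icc: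
  assumes "sqint {a..b} u" "sqnorm {a..b} u = 0"
  shows "negligible {t \<in> {a..b}. u t \<noteq> 0}"
proof -
  let ?u = "\<lambda>x. if x \<in> {a..b} then u x else 0"
  have "sqnorm UNIV ?u = integral UNIV (\<lambda>x. if x \<in> {a..b} then (norm (u x))\<^sup>2 else 0)"
    by (intro integral_cong) auto
  also have "\<dots> = 0" using assms(2) by (simp only: integral_restrict_UNIV)
  finally have "negligible {x. ?u x \<noteq> 0}" by (intro sqint_integral_eq_0 iffD2[OF sqint_UNIV] assms)
  then show ?thesis by (rule negligible_subset) auto
qed

context control_system
begin

lemma output_bounded_forward:
  assumes "0 \<le> \<tau>"
  shows "\<exists>M\<ge>0. \<forall>\<phi>\<in>DA. sqnorm {0..\<tau>} (\<lambda>s. Bs (Ss s \<phi>)) \<le> (M * norm \<phi>)\<^sup>2"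
  using output_bounded[OF assms] integral_reflect_Icc[of \<tau> "\<lambda>s. (norm (Bs (Ss s _)))\<^sup>2"] by simp

text \<open>\<open>adj_output\<close> is fixed by choice. For \<open>\<phi>\<close> in
  \<open>DA\<close> the true output meets the requirement, because the output map is bounded;
  testing the chosen function with the constant sequence identifies it with the true output almost
  everywhere. This turns the observability hypothesis into an inequality on
  \<open>DA\<close>.\<close>

lemma adj_output_DA:
  assumes "T > 0" "\<phi> \<in> DA"
  shows "(LINT t:{0<..<T}|lebesgue. (norm (adj_output A S B T \<phi> t))\<^sup>2)
    = sqnorm {0..T} (\<lambda>s. Bs (Ss s \<phi>))"
proof -
  let ?P = "\<lambda>g. g \<in> L2 T \<and> (\<forall>\<psi>. (\<forall>n. \<psi> n \<in> DA) \<and> \<psi> \<longlonglongrightarrow> \<phi> \<longrightarrow>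
     (\<lambda>n. L2_norm_on {0<..<T} (\<lambda>t. Bs (Ss t (\<psi> n)) - g t)) \<longlonglongrightarrow> 0)"
  define g0 where "g0 t = Bs (Ss t \<phi>)" for t
  have g0: "sqint {0..T} g0" unfolding g0_def by (rule sqint_Bs_Ss[OF assms(2) order_refl])
  obtain M where M: "0 \<le> M" "\<And>\<psi>. \<psi> \<in> DA \<Longrightarrow> sqnorm {0..T} (\<lambda>s. Bs (Ss s \<psi>)) \<le> (M * norm \<psi>)\<^sup>2"
    using output_bounded_forward[of T] assms(1) by auto
  have "?P g0"
  proof (intro conjI allI impI)
    show "g0 \<in> L2 T" using g0 by (simp add: L2_iff_sqint)
    fix \<psi> :: "nat \<Rightarrow> 'h" assume "(\<forall>n. \<psi> n \<in> DA) \<and> \<psi> \<longlonglongrightarrow> \<phi>"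
    then have \<psi>: "\<And>n. \<psi> n \<in> DA" "\<psi> \<longlonglongrightarrow> \<phi>" by auto
    have le: "norm (L2_norm_on {0<..<T} (\<lambda>t. Bs (Ss t (\<psi> n)) - g0 t)) \<le> M * norm (\<psi> n - \<phi>)" for n
    proof -
      have d: "\<psi> n - \<phi> \<in> DA" using DA_diff[OF \<psi>(1) assms(2)] by simp
      have "Bs (Ss t (\<psi> n)) - g0 t = Bs (Ss t (\<psi> n - \<phi>))" if "t \<in> {0..T}" for t
        using that \<psi>(1) assms(2) by (simp add: g0_def linear_diff[OF Ss_linear] Bs_diff Ss_in_DA)
      then have eq: "sqnorm {0..T} (\<lambda>t. Bs (Ss t (\<psi> n)) - g0 t)
          = sqnorm {0..T} (\<lambda>t. Bs (Ss t (\<psi> n - \<phi>)))"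
        by (intro integral_cong) simp
      have sq: "sqint {0..T} (\<lambda>t. Bs (Ss t (\<psi> n)) - g0 t)"
        by (intro sqint_diff g0 sqint_Bs_Ss \<psi>) auto
      have "L2_norm_on {0<..<T} (\<lambda>t. Bs (Ss t (\<psi> n)) - g0 t)
          = sqrt (sqnorm {0..T} (\<lambda>t. Bs (Ss t (\<psi> n - \<phi>))))"
        using L2_norm_on_Ioo[OF sq] eq by simp
      moreover have "sqrt (sqnorm {0..T} (\<lambda>t. Bs (Ss t (\<psi> n - \<phi>)))) \<le> M * norm (\<psi> n - \<phi>)"
        using M(2)[OF d] M(1) by (intro real_le_lsqrt) auto
      moreover have "0 \<le> sqrt (sqnorm {0..T} (\<lambda>t. Bs (Ss t (\<psi> n - \<phi>))))"
        by (intro real_sqrt_ge_zero integral_nonneg sqint_norm_integrable sqint_Bs_Ss d) auto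
      ultimately show ?thesis by simp
    qed
    have "(\<lambda>n. M * norm (\<psi> n - \<phi>)) \<longlonglongrightarrow> M * norm (\<phi> - \<phi>)" by (intro tendsto_intros \<psi>(2))
    then have "(\<lambda>n. M * norm (\<psi> n - \<phi>)) \<longlonglongrightarrow> 0" by simp
    then show "(\<lambda>n. L2_norm_on {0<..<T} (\<lambda>t. Bs (Ss t (\<psi> n)) - g0 t)) \<longlonglongrightarrow> 0"
      by (rule Lim_null_comparison[OF always_eventually[OF allI[OF le]]])
  qed
  then have P: "?P (adj_output A S B T \<phi>)" unfolding adj_output_def by (rule someI[of ?P])
  define g where "g = adj_output A S B T \<phi>"
  have g: "sqint {0..T} g" using P by (simp add: g_def L2_iff_sqint)
  have "(\<lambda>n::nat. L2_norm_on {0<..<T} (\<lambda>t. g0 t - g t)) \<longlonglongrightarrow> 0"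
    using P[THEN conjunct2, rule_format, of "\<lambda>n. \<phi>"] assms(2) by (simp add: g_def g0_def)
  then have "L2_norm_on {0<..<T} (\<lambda>t. g0 t - g t) = 0" using LIMSEQ_const_iff by blast
  moreover have sq: "sqint {0..T} (\<lambda>t. g0 t - g t)" by (intro sqint_diff g0 g) auto
  ultimately have "sqnorm {0..T} (\<lambda>t. g0 t - g t) = 0" by (simp add: L2_norm_on_Ioo)
  from sqint_integral_eq_0_Icc[OF sq this] have neg: "negligible {t \<in> {0..T}. g0 t - g t \<noteq> 0}" .
  have "(LINT t:{0<..<T}|lebesgue. (norm (g t))\<^sup>2) = sqnorm {0..T} g"
    by (intro LINT_Ioo_eq_integral sqint_norm_integrable g) auto
  also have "\<dots> = sqnorm {0..T} g0"
    by (rule integral_spike[OF neg]) auto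
  finally show ?thesis by (simp add: g_def g0_def)
qed

end

section \<open>Exponential decay from dissipation\<close>

text \<open>\<open>P\<close>, \<open>Q\<close> are the norms of the deviations of state and adjoint state, \<open>E a b\<close> is the running cost on
  \<open>[a, b]\<close>.\<close>

definition dissipative :: "real \<Rightarrow> real \<Rightarrow> real \<Rightarrow> real \<Rightarrow> (real \<Rightarrow> real) \<Rightarrow> (real \<Rightarrow> real) \<Rightarrow> (real \<Rightarrow> real \<Rightarrow> real) \<Rightarrow> bool"
  where
  "dissipative T0 K M T P Q E \<longleftrightarrow>
    (\<forall>t\<in>{0..T}. 0 \<le> P t \<and> 0 \<le> Q t) \<and>
    (\<forall>a b. 0 \<le> a \<and> a \<le> b \<and> b \<le> T \<longrightarrow> 0 \<le> E a b) \<and>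
    (\<forall>a b c. 0 \<le> a \<and> a \<le> b \<and> b \<le> c \<and> c \<le> T \<longrightarrow> E a c = E a b + E b c) \<and>
    (\<forall>a b. 0 \<le> a \<and> a \<le> b \<and> b \<le> T \<longrightarrow> E a b \<le> P a * Q a + P b * Q b) \<and>
    (\<forall>t. T0 \<le> t \<and> t \<le> T \<longrightarrow> (P t)\<^sup>2 \<le> K * E (t - T0) t) \<and>
    (\<forall>t. 0 \<le> t \<and> t + T0 \<le> T \<longrightarrow> (Q t)\<^sup>2 \<le> K * E t (t + T0)) \<and>
    (\<forall>t. 0 \<le> t \<and> t \<le> T0 \<longrightarrow> P t \<le> M * (P 0 + sqrt (E 0 t))) \<and>
    (\<forall>t. T - T0 \<le> t \<and> t \<le> T \<longrightarrow> Q t \<le> M * (Q T + sqrt (E t T)))"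

text \<open>On symmetric intervals \<open>F s = E s (T - s)\<close> satisfies \<open>F (r + 2 T0) \<le> \<kappa> F r\<close> with \<open>\<kappa> = K / (2 + K)\<close>.\<close>

lemma dissipation_imp_turnpike:
  fixes T0 K M :: real
  assumes T0: "T0 > 0" and K: "K > 0" and M: "M \<ge> 0"
  obtains c l where "c > 0" "l > 0"
    "\<And>T P Q E t. T > T0 \<Longrightarrow> dissipative T0 K M T P Q E \<Longrightarrow> t \<in> {0..T} \<Longrightarrow>
      P t + Q t + sqrt (E (min t (T - t)) (max t (T - t)))
        \<le> c * (P 0 + Q T) * (exp (- l * t) + exp (- l * (T - t)))"
proof -
  define \<kappa> where "\<kappa> = K / (2 + K)"
  have \<kappa>: "0 < \<kappa>" "\<kappa> < 1" using K by (auto simp: \<kappa>_def)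
  \<comment> \<open>The energy loses the factor \<open>\<kappa>\<close> per length 2
    \<open>T0\<close>; its square root, which bounds the norms, decays at half that rate.\<close>
  define l where "l = - ln \<kappa> / (4 * T0)"
  have l: "l > 0" using \<kappa> T0 by (simp add: l_def divide_neg_pos)
  \<comment> \<open>\<open>K\<close> comes from the bound on the total energy, 1 /
    \<open>\<kappa>\<close> from rounding the number of contraction steps down to an
    integer.\<close>
  define c1 where "c1 = sqrt (K / \<kappa>)"
  have c1: "c1 > 0" using K \<kappa> by (simp add: c1_def)
  \<comment> \<open>The first summand belongs to the zone of length \<open>T0\<close> next to an
    end, handled by the growth bound \<open>M\<close>; the second to all other times, handled by a
    window. The exponential pays for a displacement by \<open>T0\<close>.\<close>
  define c2 where "c2 = (M * (1 + sqrt K) + sqrt K * c1) * exp (l * T0)"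
  have sK: "sqrt K > 0" using K by simp
  have c2: "c2 > 0" unfolding c2_def using M sK c1 by (intro mult_pos_pos add_nonneg_pos mult_nonneg_nonneg) auto
  show thesis
  proof (rule that[of "2 * c2 + c1" l])
    show "2 * c2 + c1 > 0" using c1 c2 by simp
    show "l > 0" by fact
    fix T :: real and P Q :: "real \<Rightarrow> real" and E :: "real \<Rightarrow> real \<Rightarrow> real" and t
    assume "T > T0" and diss: "dissipative T0 K M T P Q E" and t: "t \<in> {0..T}"
    from diss have PQ: "\<forall>t\<in>{0..T}. 0 \<le> P t \<and> 0 \<le> Q t"
      and E_nonneg: "\<forall>a b. 0 \<le> a \<and> a \<le> b \<and> b \<le> T \<longrightarrow> 0 \<le> E a b"
      and E_add: "\<forall>a b c. 0 \<le> a \<and> a \<le> b \<and> b \<le> c \<and> c \<le> T \<longrightarrow> E a c = E a b + E b c"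
      and energy: "\<forall>a b. 0 \<le> a \<and> a \<le> b \<and> b \<le> T \<longrightarrow> E a b \<le> P a * Q a + P b * Q b"
      and P_win: "\<forall>t. T0 \<le> t \<and> t \<le> T \<longrightarrow> (P t)\<^sup>2 \<le> K * E (t - T0) t"
      and Q_win: "\<forall>t. 0 \<le> t \<and> t + T0 \<le> T \<longrightarrow> (Q t)\<^sup>2 \<le> K * E t (t + T0)"
      and P_start: "\<forall>t. 0 \<le> t \<and> t \<le> T0 \<longrightarrow> P t \<le> M * (P 0 + sqrt (E 0 t))"
      and Q_end: "\<forall>t. T - T0 \<le> t \<and> t \<le> T \<longrightarrow> Q t \<le> M * (Q T + sqrt (E t T))"
      unfolding dissipative_def by - (elim conjE, assumption)+
    define D where "D = P 0 + Q T"
    have T: "T > T0" "T > 0" using \<open>T > T0\<close> T0 by auto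
    have PQ0: "0 \<le> P 0" "0 \<le> Q T" "0 \<le> Q 0" "0 \<le> P T" using PQ T by auto
    have D: "D \<ge> 0" using PQ0 by (simp add: D_def)
    have E_mono: "E b c \<le> E a d" if "0 \<le> a" "a \<le> b" "b \<le> c" "c \<le> d" "d \<le> T" for a b c d
    proof -
      have "E a d = E a b + E b d" "E b d = E b c + E c d"
        by (rule E_add[rule_format]; use that in simp)+
      moreover have "0 \<le> E a b" "0 \<le> E c d"
        by (rule E_nonneg[rule_format]; use that in simp)+
      ultimately show ?thesis by linarith
    qed
    \<comment> \<open>The data \<open>D\<close> contain neither \<open>Q 0\<close> nor
      \<open>P T\<close>. Windows bound both by the root of \<open>K * E 0 T\<close>, and the
      resulting inequality E \<le> sqrt (K E) D is solved for E.\<close>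
    have ET: "E 0 T \<le> K * D\<^sup>2"
    proof -
      let ?E = "E 0 T"
      have E0: "0 \<le> ?E" using E_nonneg T by auto
      have "(Q 0)\<^sup>2 \<le> K * E 0 T0" using Q_win[rule_format, of 0] T by simp
      also have "\<dots> \<le> K * ?E" using E_mono[of 0 0 T0 T] T T0 K by (intro mult_left_mono) auto
      finally have Q0: "Q 0 \<le> sqrt (K * ?E)" by (rule real_le_rsqrt)
      have "(P T)\<^sup>2 \<le> K * E (T - T0) T" using P_win T by simp
      also have "\<dots> \<le> K * ?E" using E_mono[of 0 "T - T0" T T] T T0 K by (intro mult_left_mono) auto
      finally have PT: "P T \<le> sqrt (K * ?E)" by (rule real_le_rsqrt)
      have "?E \<le> P 0 * Q 0 + P T * Q T" using energy T by simp
      also have "\<dots> \<le> P 0 * sqrt (K * ?E) + sqrt (K * ?E) * Q T"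
        using PQ0 Q0 PT by (intro add_mono mult_left_mono mult_right_mono)
      also have "\<dots> = sqrt (K * ?E) * D" by (simp add: D_def algebra_simps)
      finally have "?E\<^sup>2 \<le> (sqrt (K * ?E) * D)\<^sup>2" using E0 by (intro power_mono) auto
      also have "\<dots> = K * ?E * D\<^sup>2" using K E0 by (simp add: power_mult_distrib)
      finally have "?E * ?E \<le> ?E * (K * D\<^sup>2)" by (simp add: power2_eq_square ac_simps)
      then show ?thesis using E0 K by (cases "?E = 0") auto
    qed
    \<comment> \<open>The boundary terms of the middle interval [s, T - s] are paid by four windows:
      [r, s] for \<open>P s\<close>, [s, r + 2 T0] for \<open>Q s\<close>, and their mirror images
      for \<open>Q (T - s)\<close> and \<open>P (T - s)\<close>. These are exactly what [r, T - r]
      has beyond the inner interval; the condition on \<open>r\<close> keeps left and right windows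
      apart.\<close>
    have step: "E (r + 2 * T0) (T - (r + 2 * T0)) \<le> \<kappa> * E r (T - r)"
      if r: "0 \<le> r" "r + 2 * T0 \<le> T / 2" for r
    proof -
      define s where "s = r + T0"
      have PQs: "0 \<le> P s" "0 \<le> Q s" "0 \<le> P (T - s)" "0 \<le> Q (T - s)"
        using PQ r T0 by (auto simp: s_def)
      have "P s * Q s \<le> ((P s)\<^sup>2 + (Q s)\<^sup>2) / 2" "P (T - s) * Q (T - s) \<le> ((P (T - s))\<^sup>2 + (Q (T - s))\<^sup>2) / 2"
        using sum_squares_bound[of "P s" "Q s"] sum_squares_bound[of "P (T - s)" "Q (T - s)"] by simp_all
      moreover have "(P s)\<^sup>2 \<le> K * E r s" "(Q s)\<^sup>2 \<le> K * E s (r + 2 * T0)"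
        "(P (T - s))\<^sup>2 \<le> K * E (T - (r + 2 * T0)) (T - s)" "(Q (T - s))\<^sup>2 \<le> K * E (T - s) (T - r)"
        using P_win[rule_format, of s] Q_win[rule_format, of s] P_win[rule_format, of "T - s"]
          Q_win[rule_format, of "T - s"] r T0 by (simp_all add: s_def algebra_simps)
      moreover have "E s (T - s) \<le> P s * Q s + P (T - s) * Q (T - s)"
        using energy r T0 by (simp add: s_def)
      moreover have "E (r + 2 * T0) (T - (r + 2 * T0)) \<le> E s (T - s)"
        using r T0 by (intro E_mono) (auto simp: s_def)
      moreover have "E r (T - r) = E r s + (E s (r + 2 * T0) + (E (r + 2 * T0) (T - (r + 2 * T0))
          + (E (T - (r + 2 * T0)) (T - s) + E (T - s) (T - r))))"
      proof -
        have "E r (T - r) = E r s + E s (T - r)"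
          "E s (T - r) = E s (r + 2 * T0) + E (r + 2 * T0) (T - r)"
          "E (r + 2 * T0) (T - r) = E (r + 2 * T0) (T - (r + 2 * T0)) + E (T - (r + 2 * T0)) (T - r)"
          "E (T - (r + 2 * T0)) (T - r) = E (T - (r + 2 * T0)) (T - s) + E (T - s) (T - r)"
          by (rule E_add[rule_format]; use r T0 in \<open>simp add: s_def\<close>)+
        then show ?thesis by simp
      qed
      ultimately have "2 * E (r + 2 * T0) (T - (r + 2 * T0))
          \<le> K * (E r (T - r) - E (r + 2 * T0) (T - (r + 2 * T0)))"
        by (simp add: algebra_simps)
      then have "(2 + K) * E (r + 2 * T0) (T - (r + 2 * T0)) \<le> K * E r (T - r)" by (simp add: algebra_simps)
      then show ?thesis using K by (simp add: \<kappa>_def pos_le_divide_eq mult.commute)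
    qed
    have geom: "E s (T - s) \<le> \<kappa> ^ n * (K * D\<^sup>2)" if "real n * (2 * T0) \<le> s" "s \<le> T / 2" for n s
      using that
    proof (induction n arbitrary: s)
      case 0
      then show ?case using E_mono[of 0 s "T - s" T] ET by simp
    next
      case (Suc n)
      have "0 \<le> real n * (2 * T0)" using T0 by simp
      moreover have "real (Suc n) * (2 * T0) = real n * (2 * T0) + 2 * T0" by (simp add: algebra_simps)
      ultimately have s: "0 \<le> s - 2 * T0" "real n * (2 * T0) \<le> s - 2 * T0"
        using Suc.prems by linarith+
      have "E s (T - s) \<le> \<kappa> * E (s - 2 * T0) (T - (s - 2 * T0))"
        using step[of "s - 2 * T0"] s(1) Suc.prems by simp
      also have "\<dots> \<le> \<kappa> * (\<kappa> ^ n * (K * D\<^sup>2))"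
        using s Suc.prems T0 \<kappa> by (intro mult_left_mono Suc.IH) auto
      finally show ?case by (simp add: mult.assoc)
    qed
    have decay: "sqrt (E s (T - s)) \<le> c1 * D * exp (- l * s)" if s: "0 \<le> s" "s \<le> T / 2" for s
    proof -
      define n where "n = nat \<lfloor>s / (2 * T0)\<rfloor>"
      have n: "real n \<le> s / (2 * T0)" "s / (2 * T0) < real n + 1"
        using s T0 unfolding n_def by (auto simp: of_nat_nat)
      have "\<kappa> ^ n = exp (real n * ln \<kappa>)" using \<kappa> by (simp add: exp_of_nat_mult)
      also have "\<dots> \<le> exp ((s / (2 * T0) - 1) * ln \<kappa>)"
        using n \<kappa> by (intro iffD2[OF exp_le_cancel_iff] mult_right_mono_neg) auto
      also have "(s / (2 * T0) - 1) * ln \<kappa> = - ln \<kappa> + (- l * s) * 2"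
        using T0 by (simp add: l_def field_simps)
      also have "exp \<dots> = (exp (- l * s))\<^sup>2 / \<kappa>"
        using \<kappa> by (simp add: exp_add exp_minus exp_double field_simps power2_eq_square flip: exp_add)
      finally have \<kappa>n: "\<kappa> ^ n \<le> (exp (- l * s))\<^sup>2 / \<kappa>" .
      have "E s (T - s) \<le> \<kappa> ^ n * (K * D\<^sup>2)"
        using n s T0 by (intro geom) (simp_all add: pos_le_divide_eq)
      also have "\<dots> \<le> (exp (- l * s))\<^sup>2 / \<kappa> * (K * D\<^sup>2)" using K by (intro mult_right_mono \<kappa>n) simp
      also have "\<dots> = (c1 * D * exp (- l * s))\<^sup>2"
        using K \<kappa> by (simp add: c1_def power_mult_distrib)
      finally show ?thesis using c1 D by (intro real_le_lsqrt) auto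
    qed
    have exp_min: "exp (- l * min a b) \<le> exp (- l * a) + exp (- l * b)" for a b
      by (auto simp: min_def)
    let ?e = "exp (- l * t) + exp (- l * (T - t))"
    have expT0: "1 \<le> exp (l * T0)" using l T0 by simp
    \<comment> \<open>The window [a, a + T0] lies in a symmetric interval [s, T - s], to which
      \<open>decay\<close> applies. For \<open>Q t\<close> it starts at \<open>t\<close>, for
      \<open>P t\<close> it ends there; replacing its ends by \<open>t\<close> costs at most the
      factor exp (l T0).\<close>
    have window: "sqrt K * sqrt (E a (a + T0)) \<le> sqrt K * c1 * exp (l * T0) * D * ?e"
      if a: "0 \<le> a" "a + T0 \<le> T" "a = t \<or> a = t - T0" for a
    proof -
      define s where "s = min a (T - (a + T0))"
      have s: "0 \<le> s" "s \<le> T / 2" "s \<le> a" "a + T0 \<le> T - s" using a T0 by (auto simp: s_def min_def)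
      have "E a (a + T0) \<le> E s (T - s)" using a s T0 by (intro E_mono) auto
      then have "sqrt (E a (a + T0)) \<le> c1 * D * exp (- l * s)"
        using decay[OF s(1,2)] by (meson order_trans real_sqrt_le_mono)
      also have "\<dots> \<le> c1 * D * (exp (l * T0) * ?e)"
      proof (rule mult_left_mono)
        have "exp (- l * s) \<le> exp (- l * a) + exp (- l * (T - (a + T0)))" unfolding s_def by (rule exp_min)
        also have "\<dots> \<le> exp (l * T0) * exp (- l * t) + exp (l * T0) * exp (- l * (T - t))"
        proof (rule add_mono)
          show "exp (- l * a) \<le> exp (l * T0) * exp (- l * t)"
            using a(3) l T0 by (auto simp: exp_add[symmetric] algebra_simps)
          show "exp (- l * (T - (a + T0))) \<le> exp (l * T0) * exp (- l * (T - t))"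
            using a(3) l T0 by (auto simp: exp_add[symmetric] algebra_simps)
        qed
        finally show "exp (- l * s) \<le> exp (l * T0) * ?e" by (simp add: distrib_left)
      qed (use c1 D in auto)
      finally show ?thesis using sK by (simp add: ac_simps)
    qed
    have c2_split: "c2 * D * ?e = M * (1 + sqrt K) * exp (l * T0) * D * ?e + sqrt K * c1 * exp (l * T0) * D * ?e"
      by (simp add: c2_def algebra_simps)
    have nonneg: "0 \<le> M * (1 + sqrt K) * exp (l * T0) * D * ?e" "0 \<le> sqrt K * c1 * exp (l * T0) * D * ?e"
      using M sK c1 D by (auto intro!: mult_nonneg_nonneg)
    \<comment> \<open>Closer than \<open>T0\<close> to the relevant end no window fits. There the
      exponential weight is at least exp (- l T0), so the crude bound by the total energy
      suffices.\<close>
    have boundary: "M * (d + sqrt (E a b)) \<le> M * (1 + sqrt K) * exp (l * T0) * D * ?e"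
      if "d \<le> D" "0 \<le> a" "a \<le> b" "b \<le> T" "1 \<le> exp (l * T0) * ?e" for d a b
    proof -
      have "sqrt (E a b) \<le> sqrt (K * D\<^sup>2)"
        using E_mono[of 0 a b T] that ET by (intro real_sqrt_le_mono) simp
      also have "\<dots> = sqrt K * D" using D by (simp add: real_sqrt_mult)
      finally have "M * (d + sqrt (E a b)) \<le> M * (D + sqrt K * D)" using that M by (intro mult_left_mono) auto
      also have "\<dots> = M * (1 + sqrt K) * D * 1" by (simp add: algebra_simps)
      also have "\<dots> \<le> M * (1 + sqrt K) * D * (exp (l * T0) * ?e)"
        using that M D sK by (intro mult_left_mono) auto
      finally show ?thesis by (simp add: ac_simps)
    qed
    have Pt: "P t \<le> c2 * D * ?e"
    proof (cases "t \<le> T0")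
      case True
      have "1 \<le> exp (l * T0) * exp (- l * t)" using True l by (simp add: exp_add[symmetric] mult_left_mono)
      also have "\<dots> \<le> exp (l * T0) * ?e" by (intro mult_left_mono) auto
      finally have "P t \<le> M * (1 + sqrt K) * exp (l * T0) * D * ?e"
        using boundary[of "P 0" 0 t] P_start True t PQ0 by (fastforce simp: D_def)
      then show ?thesis using nonneg(2) c2_split by linarith
    next
      case False
      have "P t \<le> sqrt (K * E (t - T0) t)" using P_win False t by (intro real_le_rsqrt) auto
      also have "\<dots> \<le> sqrt K * c1 * exp (l * T0) * D * ?e"
        using window[of "t - T0"] False t by (simp add: real_sqrt_mult)
      finally show ?thesis using nonneg(1) c2_split by linarith
    qed
    have Qt: "Q t \<le> c2 * D * ?e"
    proof (cases "T - T0 \<le> t")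
      case True
      have "1 \<le> exp (l * T0) * exp (- l * (T - t))" using True l by (simp add: exp_add[symmetric] mult_left_mono)
      also have "\<dots> \<le> exp (l * T0) * ?e" by (intro mult_left_mono) auto
      finally have "Q t \<le> M * (1 + sqrt K) * exp (l * T0) * D * ?e"
        using boundary[of "Q T" t T] Q_end True t PQ0 by (fastforce simp: D_def)
      then show ?thesis using nonneg(2) c2_split by linarith
    next
      case False
      have "Q t \<le> sqrt (K * E t (t + T0))" using Q_win False t by (intro real_le_rsqrt) auto
      also have "\<dots> \<le> sqrt K * c1 * exp (l * T0) * D * ?e"
        using window[of t] False t by (simp add: real_sqrt_mult)
      finally show ?thesis using nonneg(1) c2_split by linarith
    qed
    have "sqrt (E (min t (T - t)) (max t (T - t))) \<le> c1 * D * ?e"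
    proof -
      have "max t (T - t) = T - min t (T - t)" by (auto simp: min_def max_def)
      then have "sqrt (E (min t (T - t)) (max t (T - t))) \<le> c1 * D * exp (- l * min t (T - t))"
        using decay[of "min t (T - t)"] t by (auto simp: min_def)
      also have "\<dots> \<le> c1 * D * ?e" using c1 D exp_min[of t "T - t"] by (intro mult_left_mono) auto
      finally show ?thesis .
    qed
    with Pt Qt show "P t + Q t + sqrt (E (min t (T - t)) (max t (T - t)))
        \<le> (2 * c2 + c1) * (P 0 + Q T) * ?e"
      unfolding D_def[symmetric] by (simp add: algebra_simps)
  qed
qed

section \<open>Estimates along extremals\<close>

lemma integral_shift_add:
  fixes f :: "real \<Rightarrow> real"
  shows "integral {0..h} (\<lambda>r. f (r + a)) = integral {a..a + h} f"
proof -
  have "(\<lambda>r. f (r + a)) = f \<circ> (+) a" by (simp add: fun_eq_iff add.commute)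
  then have "integral {0..h} (\<lambda>r. f (r + a)) = integral {0 + a..h + a} f"
    using integral_shift_Icc_real[of 0 h f a] by simp
  then show ?thesis by (simp add: add.commute)
qed

context control_system
begin

abbreviation traj :: "'h \<Rightarrow> (real \<Rightarrow> 'u) \<Rightarrow> real \<Rightarrow> 'h" where
  "traj x u t \<equiv> S t x + Phi t u"

lemma Phi_0: "Phi 0 u = 0"
proof (rule inner_DA_eq_imp_eq)
  have "sqint {0..0} u" by (rule sqint_spike[OF sqint_zero, of "{0}"]) auto
  then show "Phi 0 u \<bullet> \<phi> = 0 \<bullet> \<phi>" if "\<phi> \<in> DA" for \<phi> using that by (simp add: inner_Phi)
qed

lemma traj_continuous_on:
  assumes "sqint {0..T} u"
  shows "continuous_on {0..T} (traj x u)"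
  by (intro continuous_on_add S_continuous_on' Phi_continuous_on assms) auto

lemma traj_cocycle:
  assumes "0 \<le> a" "0 \<le> h" "sqint {0..a + h} u"
  shows "traj x u (a + h) = traj (traj x u a) (\<lambda>s. u (s + a)) h"
  using Phi_cocycle[OF assms] S_add[of h a x] assms(1,2)
  by (simp add: blinfun.add_right add.commute[of a h])

lemma traj_bounded:
  "\<exists>M\<ge>1. \<forall>t\<in>{0..\<tau>}. \<forall>x u. sqint {0..t} u \<longrightarrow>
    norm (traj x u t) \<le> M * (norm x + sqrt (sqnorm {0..t} u))"
proof -
  obtain M1 where M1: "M1 \<ge> 1" "\<And>t. t \<in> {0..\<tau>} \<Longrightarrow> norm (S t) \<le> M1"
    using S_locally_bounded[of \<tau>] by blast
  obtain M2 where M2: "M2 \<ge> 0" "\<And>t u. t \<in> {0..\<tau>} \<Longrightarrow> sqint {0..t} u \<Longrightarrow>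
      norm (Phi t u) \<le> M2 * sqrt (sqnorm {0..t} u)"
    using Phi_bounded[of \<tau>] by blast
  have "norm (traj x u t) \<le> max M1 M2 * (norm x + sqrt (sqnorm {0..t} u))"
    if "t \<in> {0..\<tau>}" "sqint {0..t} u" for t x u
  proof -
    let ?i = "sqrt (sqnorm {0..t} u)"
    have i: "0 \<le> ?i" by (intro real_sqrt_ge_zero integral_nonneg sqint_norm_integrable that) auto
    have "norm (traj x u t) \<le> norm (S t x) + norm (Phi t u)" by (rule norm_triangle_ineq)
    also have "\<dots> \<le> M1 * norm x + M2 * ?i"
      by (intro add_mono M2(2) that order.trans[OF norm_blinfun] mult_right_mono M1(2)) auto
    also have "\<dots> \<le> max M1 M2 * norm x + max M1 M2 * ?i"
      by (intro add_mono mult_right_mono i) auto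
    finally show ?thesis by (simp add: distrib_left)
  qed
  moreover have "max M1 M2 \<ge> 1" using M1(1) by simp
  ultimately show ?thesis by blast
qed

definition energy :: "('h \<Rightarrow>\<^sub>L 'h) \<Rightarrow> 'h \<Rightarrow> (real \<Rightarrow> 'u) \<Rightarrow> real \<Rightarrow> real \<Rightarrow> real" where
  "energy C p v a b = integral {a..b} (\<lambda>s. (norm (C (traj p v s)))\<^sup>2 + (norm (v s))\<^sup>2)"

text \<open>The weak form of the optimality system \<open>p' = A p + B v\<close>, \<open>q' = - A\<^sup>* q - C\<^sup>* C p\<close>, \<open>v = - B\<^sup>* q\<close>: the
  adjoint state is tested against arbitrary trajectories \<open>traj \<zeta> w\<close>, so that \<open>B\<^sup>* q\<close> need not make
  sense pointwise.\<close>

definition extremal :: "('h \<Rightarrow>\<^sub>L 'h) \<Rightarrow> real \<Rightarrow> 'h \<Rightarrow> (real \<Rightarrow> 'u) \<Rightarrow> (real \<Rightarrow> 'h) \<Rightarrow> bool" where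
  "extremal C T p v q \<longleftrightarrow> sqint {0..T} v \<and>
    (\<forall>a b \<zeta> w. 0 \<le> a \<and> a \<le> b \<and> b \<le> T \<and> sqint {0..b - a} w \<longrightarrow>
      q a \<bullet> \<zeta> = q b \<bullet> traj \<zeta> w (b - a)
        + integral {0..b - a} (\<lambda>r. C (traj p v (r + a)) \<bullet> C (traj \<zeta> w r) + v (r + a) \<bullet> w r))"

lemma extremalD:
  assumes "extremal C T p v q" "0 \<le> a" "0 \<le> h" "a + h \<le> T" "sqint {0..h} w"
  shows "q a \<bullet> \<zeta> = q (a + h) \<bullet> traj \<zeta> w h
    + integral {0..h} (\<lambda>r. C (traj p v (r + a)) \<bullet> C (traj \<zeta> w r) + v (r + a) \<bullet> w r)"
  using assms(1)[unfolded extremal_def, THEN conjunct2, rule_format, of a "a + h" w \<zeta>] assms(2-) by simp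

lemma C_continuous_on:
  fixes C :: "'h \<Rightarrow>\<^sub>L 'h"
  shows "continuous_on X f \<Longrightarrow> continuous_on X (\<lambda>s. C (f s))"
  by (intro bounded_linear.continuous_on[OF blinfun.bounded_linear_right])

context
  fixes C :: "'h \<Rightarrow>\<^sub>L 'h" and T :: real and p :: 'h and v :: "real \<Rightarrow> 'u"
  assumes v: "sqint {0..T} v"
begin

lemma v_sub: "0 \<le> a \<Longrightarrow> b \<le> T \<Longrightarrow> sqint {a..b} v"
  by (rule sqint_subset[OF v]) auto

lemma Cp_sqint: "0 \<le> a \<Longrightarrow> b \<le> T \<Longrightarrow> sqint {a..b} (\<lambda>s. C (traj p v s))"
  by (intro sqint_continuous C_continuous_on continuous_on_subset[OF traj_continuous_on[OF v]]) auto

lemma energy_split: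
  assumes "0 \<le> a" "b \<le> T"
  shows "energy C p v a b = sqnorm {a..b} (\<lambda>s. C (traj p v s)) + sqnorm {a..b} v"
  unfolding energy_def by (intro integral_add sqint_norm_integrable Cp_sqint v_sub assms)

lemma energy_ge:
  assumes "0 \<le> a" "b \<le> T"
  shows "sqnorm {a..b} (\<lambda>s. C (traj p v s)) \<le> energy C p v a b"
    and "sqnorm {a..b} v \<le> energy C p v a b"
    and "0 \<le> energy C p v a b"
proof -
  have "0 \<le> sqnorm {a..b} (\<lambda>s. C (traj p v s))"
    by (intro integral_nonneg sqint_norm_integrable Cp_sqint assms) auto
  moreover have "0 \<le> sqnorm {a..b} v"
    by (intro integral_nonneg sqint_norm_integrable v_sub assms) auto
  ultimately show "sqnorm {a..b} (\<lambda>s. C (traj p v s)) \<le> energy C p v a b"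
    "sqnorm {a..b} v \<le> energy C p v a b" "0 \<le> energy C p v a b"
    unfolding energy_split[OF assms] by auto
qed

lemma energy_add:
  assumes "0 \<le> a" "a \<le> b" "b \<le> c" "c \<le> T"
  shows "energy C p v a c = energy C p v a b + energy C p v b c"
  unfolding energy_def
  by (rule Henstock_Kurzweil_Integration.integral_combine[symmetric])
    (use assms in \<open>auto intro!: integrable_add sqint_norm_integrable Cp_sqint v_sub\<close>)

lemma energy_mono:
  assumes "0 \<le> a" "a \<le> b" "b \<le> c" "c \<le> d" "d \<le> T"
  shows "energy C p v b c \<le> energy C p v a d"
  using energy_add[of a b d] energy_add[of b c d] energy_ge(3)[of a b] energy_ge(3)[of c d] assms by simp

lemma shifted_sqint:
  assumes "0 \<le> a" "a + h \<le> T"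
  shows "sqint {0..h} (\<lambda>r. v (r + a))" "sqint {0..h} (\<lambda>r. C (traj p v (r + a)))"
  using assms by (auto intro!: sqint_shift v_sub Cp_sqint[of a "a + h"] sqint_shift[where u = "\<lambda>s. C (traj p v s)"]
      simp: add.commute)

lemma pairing_le:
  assumes "0 \<le> a" "a + h \<le> T" and f: "sqint {0..h} f" and w: "sqint {0..h} w"
  shows "\<bar>integral {0..h} (\<lambda>r. C (traj p v (r + a)) \<bullet> f r + v (r + a) \<bullet> w r)\<bar>
    \<le> sqrt (energy C p v a (a + h)) *
      (sqrt (sqnorm {0..h} f) + sqrt (sqnorm {0..h} w))"
proof -
  let ?p = "\<lambda>r. C (traj p v (r + a))" and ?v = "\<lambda>r. v (r + a)"
  let ?E = "energy C p v a (a + h)"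
  note sq = shifted_sqint[OF assms(1,2)]
  have "integral {0..h} (\<lambda>r. ?p r \<bullet> f r + ?v r \<bullet> w r)
      = integral {0..h} (\<lambda>r. ?p r \<bullet> f r) + integral {0..h} (\<lambda>r. ?v r \<bullet> w r)"
    by (intro integral_add sqint_inner_integrable sq f w) auto
  moreover have "\<bar>integral {0..h} (\<lambda>r. ?p r \<bullet> f r)\<bar> \<le> sqrt ?E * sqrt (sqnorm {0..h} f)"
  proof -
    have "\<bar>integral {0..h} (\<lambda>r. ?p r \<bullet> f r)\<bar>
        \<le> sqrt (sqnorm {0..h} ?p) * sqrt (sqnorm {0..h} f)"
      by (intro integral_inner_le_sqrt sq f) auto
    also have "\<dots> \<le> sqrt ?E * sqrt (sqnorm {0..h} f)"
    proof (intro mult_right_mono real_sqrt_le_mono)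
      show "sqnorm {0..h} ?p \<le> ?E"
        unfolding integral_shift_add[of h "\<lambda>s. (norm (C (traj p v s)))\<^sup>2"] by (rule energy_ge(1)[OF assms(1,2)])
    qed (intro real_sqrt_ge_zero integral_nonneg sqint_norm_integrable f, simp)
    finally show ?thesis .
  qed
  moreover have "\<bar>integral {0..h} (\<lambda>r. ?v r \<bullet> w r)\<bar> \<le> sqrt ?E * sqrt (sqnorm {0..h} w)"
  proof -
    have "\<bar>integral {0..h} (\<lambda>r. ?v r \<bullet> w r)\<bar>
        \<le> sqrt (sqnorm {0..h} ?v) * sqrt (sqnorm {0..h} w)"
      by (intro integral_inner_le_sqrt sq w) auto
    also have "\<dots> \<le> sqrt ?E * sqrt (sqnorm {0..h} w)"
    proof (intro mult_right_mono real_sqrt_le_mono)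
      show "sqnorm {0..h} ?v \<le> ?E"
        unfolding integral_shift_add[of h "\<lambda>s. (norm (v s))\<^sup>2"] by (rule energy_ge(2)[OF assms(1,2)])
    qed (intro real_sqrt_ge_zero integral_nonneg sqint_norm_integrable w, simp)
    finally show ?thesis .
  qed
  ultimately show ?thesis by (simp add: distrib_left)
qed

end

text \<open>The extremal is tested with its own continuation, started at \<open>traj p v a\<close>
  with the shifted control, so the pairing integrand becomes a sum of squares.\<close>

lemma extremal_energy:
  assumes ext: "extremal C T p v q" and ab: "0 \<le> a" "a \<le> b" "b \<le> T"
  shows "q a \<bullet> traj p v a = q b \<bullet> traj p v b + energy C p v a b"
proof -
  have v: "sqint {0..T} v" using ext by (simp add: extremal_def)
  have vh: "sqint {0..b - a} (\<lambda>s. v (s + a))" using shifted_sqint(1)[OF v ab(1), of "b - a"] ab by simp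
  have va: "sqint {0..a + r} v" if "a + r \<le> T" for r by (rule v_sub[OF v]) (use that in auto)
  have cyc: "traj (traj p v a) (\<lambda>s. v (s + a)) r = traj p v (r + a)" if "0 \<le> r" "r \<le> b - a" for r
    using traj_cocycle[of a r v p, OF ab(1) that(1) va] that ab by (simp add: add.commute)
  have "q a \<bullet> traj p v a = q b \<bullet> traj (traj p v a) (\<lambda>s. v (s + a)) (b - a)
      + integral {0..b - a} (\<lambda>r. C (traj p v (r + a)) \<bullet> C (traj (traj p v a) (\<lambda>s. v (s + a)) r)
          + v (r + a) \<bullet> v (r + a))"
    using extremalD[OF ext ab(1) _ _ vh, of "traj p v a"] ab by simp
  also have "traj (traj p v a) (\<lambda>s. v (s + a)) (b - a) = traj p v b" using cyc[of "b - a"] ab by simp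
  also have "integral {0..b - a} (\<lambda>r. C (traj p v (r + a)) \<bullet> C (traj (traj p v a) (\<lambda>s. v (s + a)) r)
          + v (r + a) \<bullet> v (r + a))
      = integral {0..b - a} (\<lambda>r. (norm (C (traj p v (r + a))))\<^sup>2 + (norm (v (r + a)))\<^sup>2)"
    by (intro integral_cong) (simp add: cyc power2_norm_eq_inner)
  also have "\<dots> = energy C p v a b"
    unfolding energy_def
    using integral_shift_add[of "b - a" "\<lambda>s. (norm (C (traj p v s)))\<^sup>2 + (norm (v s))\<^sup>2" a] by simp
  finally show ?thesis .
qed

text \<open>Cauchy-Schwarz with the local bound for trajectories: the observation of the test
  trajectory contributes \<open>norm C * M * sqrt \<bar>T0\<bar>\<close>, the test control
  contributes the 1 in \<open>k\<close>. The constant depends on the system and the window length,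
  not on \<open>T\<close> or \<open>a\<close>.\<close>

lemma traj_pairing_le:
  fixes C :: "'h \<Rightarrow>\<^sub>L 'h"
  shows "\<exists>k\<ge>0. \<forall>T p v a h \<zeta> w. sqint {0..T} v \<longrightarrow> 0 \<le> a \<longrightarrow> 0 \<le> h \<longrightarrow> h \<le> T0 \<longrightarrow> a + h \<le> T \<longrightarrow> sqint {0..h} w \<longrightarrow>
    \<bar>integral {0..h} (\<lambda>r. C (traj p v (r + a)) \<bullet> C (traj \<zeta> w r) + v (r + a) \<bullet> w r)\<bar>
      \<le> sqrt (energy C p v a (a + h)) * (k * (norm \<zeta> + sqrt (sqnorm {0..h} w)))"
proof -
  obtain M where M: "M \<ge> 1" "\<And>t x u. t \<in> {0..T0} \<Longrightarrow> sqint {0..t} u \<Longrightarrow>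
      norm (traj x u t) \<le> M * (norm x + sqrt (sqnorm {0..t} u))"
    using traj_bounded[of T0] by blast
  define k where "k = norm C * M * sqrt \<bar>T0\<bar> + 1"
  have k: "k \<ge> 0" using M(1) by (simp add: k_def)
  have "\<bar>integral {0..h} (\<lambda>r. C (traj p v (r + a)) \<bullet> C (traj \<zeta> w r) + v (r + a) \<bullet> w r)\<bar>
      \<le> sqrt (energy C p v a (a + h)) * (k * (norm \<zeta> + sqrt (sqnorm {0..h} w)))"
    if v: "sqint {0..T} v" and a: "0 \<le> a" and h: "0 \<le> h" "h \<le> T0" and ah: "a + h \<le> T" and w: "sqint {0..h} w"
    for T p v a h \<zeta> w
  proof -
    let ?w = "sqrt (sqnorm {0..h} w)"
    define m where "m = norm C * (M * (norm \<zeta> + ?w))"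
    have w0: "0 \<le> ?w" by (intro real_sqrt_ge_zero integral_nonneg sqint_norm_integrable w) auto
    have m0: "0 \<le> m" using w0 M(1) by (simp add: m_def)
    have f: "sqint {0..h} (\<lambda>r. C (traj \<zeta> w r))"
      by (intro sqint_continuous C_continuous_on traj_continuous_on w)
    have "sqnorm {0..h} (\<lambda>r. C (traj \<zeta> w r)) \<le> integral {0..h} (\<lambda>r. m\<^sup>2)"
    proof (rule integral_le)
      fix r assume r: "r \<in> {0..h}"
      have "norm (C (traj \<zeta> w r)) \<le> norm C * norm (traj \<zeta> w r)" by (rule norm_blinfun)
      also have "\<dots> \<le> m"
        unfolding m_def
      proof (rule mult_left_mono)
        have wr: "sqint {0..r} w" by (rule sqint_subset[OF w]) (use r in auto)
        have "norm (traj \<zeta> w r) \<le> M * (norm \<zeta> + sqrt (sqnorm {0..r} w))"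
          using r h by (intro M(2) wr) auto
        also have "\<dots> \<le> M * (norm \<zeta> + ?w)"
        proof (intro mult_left_mono add_left_mono real_sqrt_le_mono)
          show "sqnorm {0..r} w \<le> sqnorm {0..h} w"
            by (intro integral_subset_le sqint_norm_integrable wr w) (use r in auto)
        qed (use M(1) in auto)
        finally show "norm (traj \<zeta> w r) \<le> M * (norm \<zeta> + ?w)" .
      qed simp
      finally show "(norm (C (traj \<zeta> w r)))\<^sup>2 \<le> m\<^sup>2" by (intro power_mono) auto
    qed (use f in \<open>auto simp: sqint_def\<close>)
    also have "\<dots> = h * m\<^sup>2" using h by simp
    also have "\<dots> \<le> \<bar>T0\<bar> * m\<^sup>2" using h by (intro mult_right_mono) auto
    finally have "sqrt (sqnorm {0..h} (\<lambda>r. C (traj \<zeta> w r))) \<le> sqrt (\<bar>T0\<bar> * m\<^sup>2)"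
      by (rule real_sqrt_le_mono)
    also have "\<dots> = norm C * M * sqrt \<bar>T0\<bar> * (norm \<zeta> + ?w)"
      using m0 by (simp add: real_sqrt_mult) (simp add: m_def)
    finally have "sqrt (sqnorm {0..h} (\<lambda>r. C (traj \<zeta> w r))) + ?w
        \<le> norm C * M * sqrt \<bar>T0\<bar> * (norm \<zeta> + ?w) + (norm \<zeta> + ?w)"
      using norm_ge_zero[of \<zeta>] by linarith
    also have "\<dots> = k * (norm \<zeta> + ?w)" by (simp add: k_def algebra_simps)
    finally have "sqrt (sqnorm {0..h} (\<lambda>r. C (traj \<zeta> w r))) + ?w \<le> k * (norm \<zeta> + ?w)" .
    moreover have "0 \<le> sqrt (energy C p v a (a + h))" using energy_ge(3)[OF v a ah] by simp
    ultimately have "sqrt (energy C p v a (a + h)) *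
        (sqrt (sqnorm {0..h} (\<lambda>r. C (traj \<zeta> w r))) + ?w)
      \<le> sqrt (energy C p v a (a + h)) * (k * (norm \<zeta> + ?w))"
      by (rule mult_left_mono)
    with pairing_le[OF v a ah f w, where C = C and p = p] show ?thesis by (rule order_trans)
  qed
  with k show ?thesis by blast
qed

text \<open>Testing with zero control compares \<open>q a\<close> with the freely propagated
  \<open>q (a + h)\<close>; both the window estimate for \<open>q\<close> and its growth bound near
  \<open>T\<close> start from this.\<close>

lemma extremal_free_step:
  "\<exists>k\<ge>0. \<forall>T p v q a h. extremal C T p v q \<longrightarrow> 0 \<le> a \<longrightarrow> 0 \<le> h \<longrightarrow> h \<le> T0 \<longrightarrow> a + h \<le> T \<longrightarrow>
    norm (q a) \<le> norm (Ss h (q (a + h))) + k * sqrt (energy C p v a (a + h))"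
proof -
  obtain k where k: "k \<ge> 0" "\<And>T p v a h \<zeta> w. sqint {0..T} v \<Longrightarrow> 0 \<le> a \<Longrightarrow> 0 \<le> h \<Longrightarrow> h \<le> T0 \<Longrightarrow> a + h \<le> T \<Longrightarrow>
      sqint {0..h} w \<Longrightarrow>
      \<bar>integral {0..h} (\<lambda>r. C (traj p v (r + a)) \<bullet> C (traj \<zeta> w r) + v (r + a) \<bullet> w r)\<bar>
        \<le> sqrt (energy C p v a (a + h)) * (k * (norm \<zeta> + sqrt (sqnorm {0..h} w)))"
    using traj_pairing_le[of T0 C] by blast
  have "norm (q a) \<le> norm (Ss h (q (a + h))) + k * sqrt (energy C p v a (a + h))"
    if ext: "extremal C T p v q" and a: "0 \<le> a" and h: "0 \<le> h" "h \<le> T0" and ah: "a + h \<le> T" for T p v q a h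
  proof -
    let ?E = "sqrt (energy C p v a (a + h))"
    have v: "sqint {0..T} v" using ext by (simp add: extremal_def)
    have E: "0 \<le> ?E" using energy_ge(3)[OF v a ah] by simp
    have "norm (q a - Ss h (q (a + h))) \<le> k * ?E"
    proof (rule norm_le_if_inner_le)
      fix \<zeta>
      let ?i = "integral {0..h} (\<lambda>r. C (traj p v (r + a)) \<bullet> C (traj \<zeta> (\<lambda>s. 0) r) + v (r + a) \<bullet> 0)"
      have "q a \<bullet> \<zeta> = q (a + h) \<bullet> S h \<zeta> + ?i"
        using extremalD[OF ext a h(1) ah sqint_zero, of \<zeta>] h by (simp add: Phi_zero)
      moreover have "q (a + h) \<bullet> S h \<zeta> = \<zeta> \<bullet> Ss h (q (a + h))"
        by (simp add: inner_commute[of "q (a + h)"] inner_Ss)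
      ultimately have "\<zeta> \<bullet> (q a - Ss h (q (a + h))) = ?i"
        by (simp add: inner_diff_right inner_commute[of \<zeta> "q a"])
      also have "\<dots> \<le> \<bar>?i\<bar>" by simp
      also have "\<dots> \<le> ?E * (k * (norm \<zeta> + sqrt (sqnorm {0..h} (\<lambda>r. 0 :: 'u))))"
        by (rule k(2)[OF v a h ah sqint_zero])
      finally show "\<zeta> \<bullet> (q a - Ss h (q (a + h))) \<le> k * ?E * norm \<zeta>" by (simp add: ac_simps)
    qed (use k(1) E in simp)
    then show ?thesis using norm_triangle_sub[of "q a" "Ss h (q (a + h))"] by linarith
  qed
  with k(1) show ?thesis by blast
qed

text \<open>Testing with \<open>w s = B\<^sup>* e\<^sup>(\<^sup>T\<^sup>0\<^sup>-\<^sup>s\<^sup>)\<^sup>A\<^sup>* \<phi>\<close> for \<open>\<phi> \<in> D(A\<^sup>*)\<close> close to \<open>q (a + T0)\<close> bounds the output of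
  \<open>q (a + T0)\<close>, hence \<open>e\<^sup>T\<^sup>0\<^sup>A\<^sup>* q (a + T0)\<close> by observability.\<close>

lemma extremal_adjoint_observability:
  assumes obs: "adj_observable A S B T0" and T0: "T0 > 0"
  shows "\<exists>K\<ge>0. \<forall>T p v q a. extremal C T p v q \<longrightarrow> 0 \<le> a \<longrightarrow> a + T0 \<le> T \<longrightarrow>
    (norm (q a))\<^sup>2 \<le> K * energy C p v a (a + T0)"
proof -
  obtain c where c: "c > 0" and obs_c: "\<And>\<xi>. c * (norm (Ss T0 \<xi>))\<^sup>2
      \<le> (LINT t:{0<..<T0}|lebesgue. (norm (adj_output A S B T0 \<xi> t))\<^sup>2)"
    using obs unfolding adj_observable_def by blast
  have c_DA: "c * (norm (Ss T0 \<phi>))\<^sup>2 \<le> sqnorm {0..T0} (\<lambda>s. Bs (Ss s \<phi>))"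
    if "\<phi> \<in> DA" for \<phi>
    using obs_c[of \<phi>] by (simp add: adj_output_DA[OF T0 that])
  obtain k where k: "k \<ge> 0" "\<And>T p v a h \<zeta> w. sqint {0..T} v \<Longrightarrow> 0 \<le> a \<Longrightarrow> 0 \<le> h \<Longrightarrow> h \<le> T0 \<Longrightarrow> a + h \<le> T \<Longrightarrow>
      sqint {0..h} w \<Longrightarrow>
      \<bar>integral {0..h} (\<lambda>r. C (traj p v (r + a)) \<bullet> C (traj \<zeta> w r) + v (r + a) \<bullet> w r)\<bar>
        \<le> sqrt (energy C p v a (a + h)) * (k * (norm \<zeta> + sqrt (sqnorm {0..h} w)))"
    using traj_pairing_le[of T0 C] by blast
  obtain k' where k': "k' \<ge> 0" "\<And>T p v q a h. extremal C T p v q \<Longrightarrow> 0 \<le> a \<Longrightarrow> 0 \<le> h \<Longrightarrow> h \<le> T0 \<Longrightarrow> a + h \<le> T \<Longrightarrow>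
      norm (q a) \<le> norm (Ss h (q (a + h))) + k' * sqrt (energy C p v a (a + h))"
    using extremal_free_step[of C T0] by blast
  obtain M where M: "M \<ge> 0" "\<And>u. sqint {0..T0} u \<Longrightarrow>
      norm (Phi T0 u) \<le> M * sqrt (sqnorm {0..T0} u)"
    using Phi_bounded[of T0] T0 by fastforce
  have "(norm (q a))\<^sup>2 \<le> (k / sqrt c + k')\<^sup>2 * energy C p v a (a + T0)"
    if ext: "extremal C T p v q" and a: "0 \<le> a" "a + T0 \<le> T" for T p v q a
  proof -
    let ?E = "sqrt (energy C p v a (a + T0))"
    define \<xi> where "\<xi> = q (a + T0)"
    have v: "sqint {0..T} v" using ext by (simp add: extremal_def)
    have E: "0 \<le> energy C p v a (a + T0)" using energy_ge(3)[OF v a] .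
    \<comment> \<open>With \<zeta> = 0 the value \<open>q a\<close> drops out, and what remains
      bounds the pairing of \<open>\<xi>\<close> with everything reachable from 0 in time
      \<open>T0\<close>.\<close>
    have ctrl_test: "\<bar>\<xi> \<bullet> Phi T0 w\<bar> \<le> k * ?E * sqrt (sqnorm {0..T0} w)"
      if w: "sqint {0..T0} w" for w
    proof -
      let ?i = "integral {0..T0} (\<lambda>r. C (traj p v (r + a)) \<bullet> C (traj 0 w r) + v (r + a) \<bullet> w r)"
      have "\<xi> \<bullet> Phi T0 w = - ?i"
        using extremalD[OF ext a(1) _ a(2) w, of 0] T0 by (simp add: \<xi>_def)
      then have "\<bar>\<xi> \<bullet> Phi T0 w\<bar> = \<bar>?i\<bar>" by simp
      also have "\<dots> \<le> ?E * (k * (norm (0 :: 'h) + sqrt (sqnorm {0..T0} w)))"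
        using T0 by (intro k(2)[OF v a(1) _ _ a(2) w]) auto
      finally show ?thesis by (simp add: ac_simps)
    qed
    \<comment> \<open>\<open>\<xi>\<close> itself has no pointwise output. With \<open>w\<close> the
      reversed output of a nearby \<open>\<phi>\<close>, the pairing of \<open>Phi T0 w\<close> with
      \<open>\<phi>\<close> is the full square of \<open>g\<close>; replacing \<open>\<phi>\<close>
      by \<open>\<xi>\<close> costs a term that vanishes in the limit.\<close>
    have DA_bound: "sqrt c * norm (Ss T0 \<phi>) \<le> k * ?E + M * norm (\<phi> - \<xi>)" if \<phi>: "\<phi> \<in> DA" for \<phi>
    proof -
      define w where "w s = Bs (Ss (T0 - s) \<phi>)" for s
      have w: "sqint {0..T0} w" unfolding w_def by (rule sqint_Bs_Ss_reflect[OF \<phi> order_refl])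
      define g where "g = sqrt (sqnorm {0..T0} w)"
      have g0: "0 \<le> g" unfolding g_def by (intro real_sqrt_ge_zero integral_nonneg sqint_norm_integrable w) auto
      have g2: "g\<^sup>2 = sqnorm {0..T0} w"
        unfolding g_def by (intro real_sqrt_pow2 integral_nonneg sqint_norm_integrable w) auto
      have "g\<^sup>2 = integral {0..T0} (\<lambda>s. w s \<bullet> Bs (Ss (T0 - s) \<phi>))"
        unfolding g2 by (intro integral_cong) (simp add: w_def power2_norm_eq_inner)
      also have "\<dots> = Phi T0 w \<bullet> \<phi>" using T0 w \<phi> by (simp add: inner_Phi)
      also have "\<dots> = \<xi> \<bullet> Phi T0 w + (\<phi> - \<xi>) \<bullet> Phi T0 w"
        by (simp add: inner_diff_left inner_commute)
      also have "\<dots> \<le> k * ?E * g + norm (\<phi> - \<xi>) * (M * g)"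
      proof (rule add_mono)
        show "\<xi> \<bullet> Phi T0 w \<le> k * ?E * g" using ctrl_test[OF w] by (simp add: g_def)
        have "(\<phi> - \<xi>) \<bullet> Phi T0 w \<le> norm (\<phi> - \<xi>) * norm (Phi T0 w)" by (rule norm_cauchy_schwarz)
        also have "\<dots> \<le> norm (\<phi> - \<xi>) * (M * g)" using M(2)[OF w] by (intro mult_left_mono) (auto simp: g_def)
        finally show "(\<phi> - \<xi>) \<bullet> Phi T0 w \<le> norm (\<phi> - \<xi>) * (M * g)" .
      qed
      finally have "g * g \<le> (k * ?E + M * norm (\<phi> - \<xi>)) * g" by (simp add: power2_eq_square algebra_simps)
      then have g_le: "g \<le> k * ?E + M * norm (\<phi> - \<xi>)"
        using g0 k(1) M(1) E by (cases "g = 0") auto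
      have "c * (norm (Ss T0 \<phi>))\<^sup>2 \<le> g\<^sup>2"
        unfolding g2 w_def using c_DA[OF \<phi>] integral_reflect_Icc[of T0 "\<lambda>s. (norm (Bs (Ss s \<phi>)))\<^sup>2"] by simp
      then have "sqrt (c * (norm (Ss T0 \<phi>))\<^sup>2) \<le> g" using g0 by (intro real_le_lsqrt) auto
      then have "sqrt c * norm (Ss T0 \<phi>) \<le> g" by (simp add: real_sqrt_mult)
      then show ?thesis using g_le by linarith
    qed
    obtain \<phi> where \<phi>: "\<And>n. \<phi> n \<in> DA" "\<phi> \<longlonglongrightarrow> \<xi>" using DA_approx by blast
    have "sqrt c * norm (Ss T0 \<xi>) \<le> k * ?E + M * norm (\<xi> - \<xi>)"
    proof (rule LIMSEQ_le)
      show "(\<lambda>n. sqrt c * norm (Ss T0 (\<phi> n))) \<longlonglongrightarrow> sqrt c * norm (Ss T0 \<xi>)"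
        by (intro tendsto_intros bounded_linear.tendsto[OF bounded_linear_Ss] \<phi>(2))
      show "(\<lambda>n. k * ?E + M * norm (\<phi> n - \<xi>)) \<longlonglongrightarrow> k * ?E + M * norm (\<xi> - \<xi>)"
        by (intro tendsto_intros \<phi>(2))
      show "\<exists>N. \<forall>n\<ge>N. sqrt c * norm (Ss T0 (\<phi> n)) \<le> k * ?E + M * norm (\<phi> n - \<xi>)"
        using DA_bound[OF \<phi>(1)] by blast
    qed
    then have "norm (Ss T0 \<xi>) \<le> k / sqrt c * ?E" using c by (simp add: field_simps)
    moreover have "norm (q a) \<le> norm (Ss T0 \<xi>) + k' * ?E"
      unfolding \<xi>_def by (rule k'(2)[OF ext a(1) _ _ a(2)]) (use T0 in auto)
    ultimately have "norm (q a) \<le> (k / sqrt c + k') * ?E" by (simp add: algebra_simps)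
    then have "(norm (q a))\<^sup>2 \<le> ((k / sqrt c + k') * ?E)\<^sup>2" by (intro power_mono) auto
    then show ?thesis using E by (simp add: power_mult_distrib)
  qed
  then show ?thesis by (intro exI[of _ "(k / sqrt c + k')\<^sup>2"]) auto
qed

text \<open>From every point of the window the state at \<open>t\<close> is reached within time
  \<open>T0\<close>, so the local bound applies, and coercivity of \<open>C\<close> controls the
  starting value by its observation. Averaging over the window replaces pointwise observations by
  the energy, whence the division by \<open>T0\<close>.\<close>

lemma traj_window_le:
  fixes C :: "'h \<Rightarrow>\<^sub>L 'h"
  assumes T0: "T0 > 0" and \<delta>: "\<delta> > 0" "\<And>\<eta>. \<delta> * (norm \<eta>)\<^sup>2 \<le> (norm (C \<eta>))\<^sup>2"
  shows "\<exists>K\<ge>0. \<forall>T p v t. sqint {0..T} v \<longrightarrow> T0 \<le> t \<longrightarrow> t \<le> T \<longrightarrow>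
    (norm (traj p v t))\<^sup>2 \<le> K * energy C p v (t - T0) t"
proof -
  obtain M where M: "M \<ge> 1" "\<And>t x u. t \<in> {0..T0} \<Longrightarrow> sqint {0..t} u \<Longrightarrow>
      norm (traj x u t) \<le> M * (norm x + sqrt (sqnorm {0..t} u))"
    using traj_bounded[of T0] by blast
  have "(norm (traj p v t))\<^sup>2 \<le> 2 * M\<^sup>2 * (1 / \<delta> + T0) / T0 * energy C p v (t - T0) t"
    if v: "sqint {0..T} v" and t: "T0 \<le> t" "t \<le> T" for T p v t
  proof -
    define a where "a = t - T0"
    have a: "0 \<le> a" "a + T0 \<le> T" "a + T0 = t" using t by (auto simp: a_def)
    let ?E = "energy C p v a t"
    have pointwise: "(norm (traj p v t))\<^sup>2 \<le> 2 * M\<^sup>2 * (1 / \<delta> * (norm (C (traj p v (r + a))))\<^sup>2 + ?E)"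
      if r: "r \<in> {0..T0}" for r
    proof -
      have vs: "sqint {0..T0 - r} (\<lambda>s. v (s + (r + a)))"
        using r a by (intro shifted_sqint(1)[OF v]) auto
      have vt: "sqint {0..r + a + (T0 - r)} v" using a by (intro v_sub[OF v]) auto
      have "traj p v t = traj (traj p v (r + a)) (\<lambda>s. v (s + (r + a))) (T0 - r)"
        using traj_cocycle[OF _ _ vt, of p] r a by (simp add: add.commute)
      then have "norm (traj p v t) \<le> M * (norm (traj p v (r + a)) + sqrt (sqnorm {0..T0 - r} (\<lambda>s. v (s + (r + a)))))"
        using M(2)[OF _ vs, of "traj p v (r + a)"] r by simp
      also have "\<dots> \<le> M * (norm (traj p v (r + a)) + sqrt ?E)"
      proof (intro mult_left_mono add_left_mono real_sqrt_le_mono)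
        have "sqnorm {0..T0 - r} (\<lambda>s. v (s + (r + a))) = sqnorm {r + a..t} v"
          using integral_shift_add[of "T0 - r" "\<lambda>s. (norm (v s))\<^sup>2" "r + a"] a by (simp add: add.commute)
        also have "\<dots> \<le> energy C p v (r + a) t" using r a t by (intro energy_ge(2)[OF v]) auto
        also have "\<dots> \<le> ?E" using r a t by (intro energy_mono[OF v]) auto
        finally show "sqnorm {0..T0 - r} (\<lambda>s. v (s + (r + a))) \<le> ?E" .
      qed (use M(1) in auto)
      finally have "(norm (traj p v t))\<^sup>2 \<le> (M * (norm (traj p v (r + a)) + sqrt ?E))\<^sup>2"
        by (intro power_mono) auto
      also have "\<dots> = M\<^sup>2 * (norm (traj p v (r + a)) + sqrt ?E)\<^sup>2" by (simp add: power_mult_distrib)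
      also have "\<dots> \<le> M\<^sup>2 * (2 * ((norm (traj p v (r + a)))\<^sup>2 + ?E))"
      proof (rule mult_left_mono)
        have "(sqrt ?E)\<^sup>2 = ?E" using energy_ge(3)[OF v, of a t] a t by simp
        then show "(norm (traj p v (r + a)) + sqrt ?E)\<^sup>2 \<le> 2 * ((norm (traj p v (r + a)))\<^sup>2 + ?E)"
          using sum_squares_bound[of "norm (traj p v (r + a))" "sqrt ?E"] by (simp add: power2_sum)
      qed simp
      also have "\<dots> \<le> M\<^sup>2 * (2 * (1 / \<delta> * (norm (C (traj p v (r + a))))\<^sup>2 + ?E))"
      proof (intro mult_left_mono add_right_mono)
        show "(norm (traj p v (r + a)))\<^sup>2 \<le> 1 / \<delta> * (norm (C (traj p v (r + a))))\<^sup>2"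
          using \<delta>(2)[of "traj p v (r + a)"] \<delta>(1) by (simp add: field_simps)
      qed auto
      finally show ?thesis by (simp only: mult.assoc mult.left_commute[of "M\<^sup>2" 2])
    qed
    have int: "(\<lambda>r. (norm (C (traj p v (r + a))))\<^sup>2) integrable_on {0..T0}"
      by (intro sqint_norm_integrable shifted_sqint(2)[OF v] a)
    have "sqnorm {0..T0} (\<lambda>r. traj p v t)
        \<le> integral {0..T0} (\<lambda>r. 2 * M\<^sup>2 * (1 / \<delta> * (norm (C (traj p v (r + a))))\<^sup>2 + ?E))"
    proof (rule integral_le)
      show "(\<lambda>r. 2 * M\<^sup>2 * (1 / \<delta> * (norm (C (traj p v (r + a))))\<^sup>2 + ?E)) integrable_on {0..T0}"
        by (intro integrable_on_mult_right integrable_add int integrable_const_ivl)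
    qed (use pointwise in auto)
    also have "\<dots> = 2 * M\<^sup>2 * (1 / \<delta> * sqnorm {0..T0} (\<lambda>r. C (traj p v (r + a))) + T0 * ?E)"
    proof -
      have "integral {0..T0} (\<lambda>r. 1 / \<delta> * (norm (C (traj p v (r + a))))\<^sup>2 + ?E)
          = integral {0..T0} (\<lambda>r. 1 / \<delta> * (norm (C (traj p v (r + a))))\<^sup>2) + integral {0..T0} (\<lambda>r. ?E)"
        using int by (intro integral_add integrable_on_mult_right) auto
      then show ?thesis using T0 by simp
    qed
    also have "\<dots> \<le> 2 * M\<^sup>2 * (1 / \<delta> * ?E + T0 * ?E)"
    proof (intro mult_left_mono add_right_mono)
      show "sqnorm {0..T0} (\<lambda>r. C (traj p v (r + a))) \<le> ?E"
        unfolding integral_shift_add[of T0 "\<lambda>s. (norm (C (traj p v s)))\<^sup>2"]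
        using energy_ge(1)[OF v a(1), where b = t] a(3) t by simp
    qed (use \<delta> in auto)
    finally have "T0 * (norm (traj p v t))\<^sup>2 \<le> 2 * M\<^sup>2 * (1 / \<delta> * ?E + T0 * ?E)" using T0 by simp
    then show ?thesis unfolding a_def[symmetric] using T0 by (simp add: field_simps)
  qed
  moreover have "0 \<le> 2 * M\<^sup>2 * (1 / \<delta> + T0) / T0" using T0 \<delta>(1) by simp
  ultimately show ?thesis by blast
qed

theorem extremal_turnpike:
  fixes C :: "'h \<Rightarrow>\<^sub>L 'h"
  assumes obs: "adj_observable A S B T0" and T0: "T0 > 0"
    and \<delta>: "\<delta> > 0" "\<And>\<eta>. \<delta> * (norm \<eta>)\<^sup>2 \<le> (norm (C \<eta>))\<^sup>2"
  obtains c l where "c > 0" "l > 0"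
    "\<And>T p v q t. T > T0 \<Longrightarrow> extremal C T p v q \<Longrightarrow> t \<in> {0..T} \<Longrightarrow>
      norm (traj p v t) + norm (q t) + sqrt (energy C p v (min t (T - t)) (max t (T - t)))
        \<le> c * (norm p + norm (q T)) * (exp (- l * t) + exp (- l * (T - t)))"
proof -
  obtain K1 where K1: "K1 \<ge> 0" "\<And>T p v q a. extremal C T p v q \<Longrightarrow> 0 \<le> a \<Longrightarrow> a + T0 \<le> T \<Longrightarrow>
      (norm (q a))\<^sup>2 \<le> K1 * energy C p v a (a + T0)"
    using extremal_adjoint_observability[OF obs T0, of C] by blast
  obtain K2 where K2: "K2 \<ge> 0" "\<And>T p v t. sqint {0..T} v \<Longrightarrow> T0 \<le> t \<Longrightarrow> t \<le> T \<Longrightarrow>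
      (norm (traj p v t))\<^sup>2 \<le> K2 * energy C p v (t - T0) t"
    using traj_window_le[where C = C, OF T0 \<delta>] by blast
  obtain M1 where M1: "M1 \<ge> 1" "\<And>t x u. t \<in> {0..T0} \<Longrightarrow> sqint {0..t} u \<Longrightarrow>
      norm (traj x u t) \<le> M1 * (norm x + sqrt (sqnorm {0..t} u))"
    using traj_bounded[of T0] by blast
  obtain k where k: "k \<ge> 0" "\<And>T p v q a h. extremal C T p v q \<Longrightarrow> 0 \<le> a \<Longrightarrow> 0 \<le> h \<Longrightarrow> h \<le> T0 \<Longrightarrow> a + h \<le> T \<Longrightarrow>
      norm (q a) \<le> norm (Ss h (q (a + h))) + k * sqrt (energy C p v a (a + h))"
    using extremal_free_step[of C T0] by blast
  obtain M2 where M2: "\<And>t. t \<in> {0..T0} \<Longrightarrow> norm (S t) \<le> M2"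
    using S_locally_bounded[of T0] by blast
  \<comment> \<open>The window estimates share \<open>K\<close> and the growth estimates share
    \<open>M\<close>; the 1 ensures that \<open>K\<close> is positive.\<close>
  define K where "K = max 1 (max K1 K2)"
  define M where "M = max M1 (max k M2)"
  have K: "K > 0" "K1 \<le> K" "K2 \<le> K" by (auto simp: K_def)
  have M: "M \<ge> 0" "M1 \<le> M" "k \<le> M" "M2 \<le> M" using M1(1) by (auto simp: M_def)
  show thesis
  proof (rule dissipation_imp_turnpike[OF T0 K(1) M(1)])
    fix c l :: real
    assume c: "c > 0" and l: "l > 0"
      and turnpike: "\<And>T P Q E t. T > T0 \<Longrightarrow> dissipative T0 K M T P Q E \<Longrightarrow> t \<in> {0..T} \<Longrightarrow>
        P t + Q t + sqrt (E (min t (T - t)) (max t (T - t)))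
          \<le> c * (P 0 + Q T) * (exp (- l * t) + exp (- l * (T - t)))"
    have main: "norm (traj p v t) + norm (q t) + sqrt (energy C p v (min t (T - t)) (max t (T - t)))
        \<le> c * (norm p + norm (q T)) * (exp (- l * t) + exp (- l * (T - t)))"
      if T: "T > T0" and ext: "extremal C T p v q" and t: "t \<in> {0..T}" for T p v q t
    proof -
      let ?P = "\<lambda>t. norm (traj p v t)" and ?Q = "\<lambda>t. norm (q t)" and ?E = "energy C p v"
      have v: "sqint {0..T} v" using ext by (simp add: extremal_def)
      have "dissipative T0 K M T ?P ?Q ?E"
        unfolding dissipative_def
      proof (intro conjI)
        show "\<forall>a b. 0 \<le> a \<and> a \<le> b \<and> b \<le> T \<longrightarrow> 0 \<le> ?E a b" using energy_ge(3)[OF v] by blast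
        show "\<forall>a b c. 0 \<le> a \<and> a \<le> b \<and> b \<le> c \<and> c \<le> T \<longrightarrow> ?E a c = ?E a b + ?E b c"
          using energy_add[OF v] by blast
        show "\<forall>a b. 0 \<le> a \<and> a \<le> b \<and> b \<le> T \<longrightarrow> ?E a b \<le> ?P a * ?Q a + ?P b * ?Q b"
        proof (intro allI impI)
          fix a b assume ab: "0 \<le> a \<and> a \<le> b \<and> b \<le> T"
          then have "?E a b = q a \<bullet> traj p v a - q b \<bullet> traj p v b" using extremal_energy[OF ext, of a b] by simp
          also have "\<dots> \<le> ?P a * ?Q a + ?P b * ?Q b"
            using Cauchy_Schwarz_ineq2[of "q a" "traj p v a"] Cauchy_Schwarz_ineq2[of "q b" "traj p v b"]
            by (simp add: mult.commute abs_le_iff)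
          finally show "?E a b \<le> ?P a * ?Q a + ?P b * ?Q b" .
        qed
        show "\<forall>t. T0 \<le> t \<and> t \<le> T \<longrightarrow> (?P t)\<^sup>2 \<le> K * ?E (t - T0) t"
        proof (intro allI impI)
          fix t assume t: "T0 \<le> t \<and> t \<le> T"
          have "(?P t)\<^sup>2 \<le> K2 * ?E (t - T0) t" using K2(2)[OF v] t by blast
          also have "\<dots> \<le> K * ?E (t - T0) t" using energy_ge(3)[OF v, of "t - T0" t] t K by (intro mult_right_mono) auto
          finally show "(?P t)\<^sup>2 \<le> K * ?E (t - T0) t" .
        qed
        show "\<forall>t. 0 \<le> t \<and> t + T0 \<le> T \<longrightarrow> (?Q t)\<^sup>2 \<le> K * ?E t (t + T0)"
        proof (intro allI impI)
          fix t assume t: "0 \<le> t \<and> t + T0 \<le> T"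
          have "(?Q t)\<^sup>2 \<le> K1 * ?E t (t + T0)" using K1(2)[OF ext] t by blast
          also have "\<dots> \<le> K * ?E t (t + T0)" using energy_ge(3)[OF v, of t "t + T0"] t K by (intro mult_right_mono) auto
          finally show "(?Q t)\<^sup>2 \<le> K * ?E t (t + T0)" .
        qed
        show "\<forall>t. 0 \<le> t \<and> t \<le> T0 \<longrightarrow> ?P t \<le> M * (?P 0 + sqrt (?E 0 t))"
        proof (intro allI impI)
          fix t assume t: "0 \<le> t \<and> t \<le> T0"
          have vt: "sqint {0..t} v" using t T by (intro v_sub[OF v]) auto
          have "?P t \<le> M1 * (norm p + sqrt (sqnorm {0..t} v))" using t by (intro M1(2) vt) auto
          also have "\<dots> \<le> M * (?P 0 + sqrt (?E 0 t))"
            using M t T energy_ge(2)[OF v, of 0 t]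
            by (intro mult_mono add_mono real_sqrt_le_mono)
              (auto simp: Phi_0 intro!: add_nonneg_nonneg real_sqrt_ge_zero integral_nonneg sqint_norm_integrable vt)
          finally show "?P t \<le> M * (?P 0 + sqrt (?E 0 t))" .
        qed
        show "\<forall>t. T - T0 \<le> t \<and> t \<le> T \<longrightarrow> ?Q t \<le> M * (?Q T + sqrt (?E t T))"
        proof (intro allI impI)
          fix t assume t: "T - T0 \<le> t \<and> t \<le> T"
          have E: "0 \<le> ?E t T" using energy_ge(3)[OF v, of t T] t T by simp
          have "?Q t \<le> norm (Ss (T - t) (q T)) + k * sqrt (?E t T)"
            using k(2)[OF ext, of t "T - t"] t T by simp
          also have "\<dots> \<le> M2 * ?Q T + k * sqrt (?E t T)"
            using t by (intro add_right_mono order.trans[OF norm_Ss_le] mult_right_mono M2) auto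
          also have "\<dots> \<le> M * ?Q T + M * sqrt (?E t T)"
            using M E by (intro add_mono mult_right_mono) auto
          finally show "?Q t \<le> M * (?Q T + sqrt (?E t T))" by (simp add: distrib_left)
        qed
      qed auto
      from turnpike[OF T this t] show ?thesis by (simp add: Phi_0)
    qed
    show thesis by (rule that[OF c l main])
  qed
qed

end

section \<open>The static problem\<close>

lemma quadratic_nonneg_imp_linear_zero:
  fixes L Q :: real
  assumes "\<And>t. 0 \<le> 2 * t * L + t\<^sup>2 * Q"
  shows "L = 0"
proof (rule ccontr)
  assume L: "L \<noteq> 0"
  \<comment> \<open>The denominator is positive and dominates \<open>Q\<close>, so the quadratic
    term consumes at most half of the linear one and leaves \<open>t * L\<close>, which is
    negative.\<close>
  define t where "t = - L / (\<bar>Q\<bar> + 1)"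
  have pos: "\<bar>Q\<bar> + 1 > 0" by (simp add: add_nonneg_pos)
  have "t\<^sup>2 * Q \<le> t\<^sup>2 * (\<bar>Q\<bar> + 1)" by (intro mult_left_mono) auto
  also have "\<dots> = - (t * L)" using pos by (simp add: t_def power2_eq_square)
  finally have "0 \<le> t * L" using assms[of t] by linarith
  moreover have "t * L = - (L\<^sup>2 / (\<bar>Q\<bar> + 1))" by (simp add: t_def power2_eq_square)
  moreover have "L\<^sup>2 / (\<bar>Q\<bar> + 1) > 0" using L pos by simp
  ultimately show False by linarith
qed

lemma norm_midpoint_power2:
  fixes a b c :: "'a::real_inner"
  shows "(norm ((1/2) *\<^sub>R (a + b) - c))\<^sup>2
    = ((norm (a - c))\<^sup>2 + (norm (b - c))\<^sup>2) / 2 - 1/4 * (norm (a - b))\<^sup>2"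
  by (simp add: power2_norm_eq_inner inner_diff_left inner_diff_right inner_add_left
      inner_add_right inner_commute field_simps)

context control_system
begin

text \<open>If \<open>As \<phi>\<close> and \<open>Bs \<phi>\<close> are small, the orbit of
  \<open>\<phi>\<close> barely moves on [0, T0] and its output stays small; observability then makes
  \<open>Ss T0 \<phi>\<close> small, and so \<open>\<phi>\<close>. The lower bound gives both the
  closed range and the uniqueness of the multiplier.\<close>

lemma observability_imp_coercive:
  assumes obs: "adj_observable A S B T0" and T0: "T0 > 0"
  shows "\<exists>K\<ge>0. \<forall>\<phi>\<in>DA. norm \<phi> \<le> K * (norm (As \<phi>) + norm (Bs \<phi>))"
proof -
  obtain c where c: "c > 0" and obs_c: "\<And>\<xi>. c * (norm (Ss T0 \<xi>))\<^sup>2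
      \<le> (LINT t:{0<..<T0}|lebesgue. (norm (adj_output A S B T0 \<xi> t))\<^sup>2)"
    using obs unfolding adj_observable_def by blast
  obtain KB where KB: "0 \<le> KB" "\<And>\<phi>. \<phi> \<in> DA \<Longrightarrow> norm (Bs \<phi>) \<le> KB * (norm \<phi> + norm (As \<phi>))"
    using Bs_bounded by blast
  obtain M where M: "M \<ge> 1" "\<And>s. 0 \<le> s \<Longrightarrow> s \<le> T0 \<Longrightarrow> norm (S s) \<le> M"
    using S_locally_bounded[of T0] by force
  \<comment> \<open>Bounds the output drift through the graph norm of
    \<open>Is s (As \<phi>)\<close>: \<open>M * T0\<close> for the vector, \<open>M + 1\<close> for
    its image under \<open>As\<close>, which is \<open>Ss s (As \<phi>) - As \<phi>\<close>.\<close>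
  define k where "k = KB * (M * T0 + (M + 1))"
  have k: "0 \<le> k" using KB M T0 by (simp add: k_def)
  have Is_le: "norm (Is s \<eta>) \<le> M * T0 * norm \<eta>" if s: "0 \<le> s" "s \<le> T0" for s \<eta>
  proof -
    have "norm (Is s \<eta>) \<le> M * s * norm \<eta>" by (rule norm_Is_le) (use M s in auto)
    also have "\<dots> \<le> M * T0 * norm \<eta>" using M s by (intro mult_right_mono mult_left_mono) auto
    finally show ?thesis .
  qed
  have "norm \<phi> \<le> (sqrt (T0 / c) * (k + 1) + M * T0) * (norm (As \<phi>) + norm (Bs \<phi>))" if \<phi>: "\<phi> \<in> DA" for \<phi>
  proof -
    define m where "m = norm (Bs \<phi>) + k * norm (As \<phi>)"
    have m: "0 \<le> m" using k by (simp add: m_def)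
    have pointwise: "norm (Bs (Ss s \<phi>)) \<le> m" if s: "0 \<le> s" "s \<le> T0" for s
    proof -
      have "Ss s \<phi> = \<phi> + Is s (As \<phi>)" using Is_As[OF s(1) \<phi>] by simp
      then have "Bs (Ss s \<phi>) = Bs \<phi> + Bs (Is s (As \<phi>))"
        using \<phi> Is_in_DA(1)[OF s(1)] by (simp add: Bs_add)
      moreover have "norm (Bs (Is s (As \<phi>))) \<le> k * norm (As \<phi>)"
      proof -
        have "norm (Ss s (As \<phi>) - As \<phi>) \<le> norm (Ss s (As \<phi>)) + norm (As \<phi>)" by (rule norm_triangle_ineq4)
        also have "norm (Ss s (As \<phi>)) \<le> M * norm (As \<phi>)"
          by (rule order.trans[OF norm_Ss_le]) (use M s in \<open>auto intro: mult_right_mono\<close>)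
        finally have "norm (Ss s (As \<phi>) - As \<phi>) \<le> (M + 1) * norm (As \<phi>)" by (simp add: distrib_right)
        then have "norm (Is s (As \<phi>)) + norm (As (Is s (As \<phi>))) \<le> (M * T0 + (M + 1)) * norm (As \<phi>)"
          using Is_le[OF s, of "As \<phi>"] by (simp add: Is_in_DA(2)[OF s(1)] distrib_right)
        then have "KB * (norm (Is s (As \<phi>)) + norm (As (Is s (As \<phi>)))) \<le> k * norm (As \<phi>)"
          unfolding k_def mult.assoc using KB(1) by (intro mult_left_mono) auto
        then show ?thesis using KB(2)[OF Is_in_DA(1)[OF s(1)], of "As \<phi>"] by linarith
      qed
      ultimately show ?thesis using norm_triangle_ineq[of "Bs \<phi>" "Bs (Is s (As \<phi>))"] by (simp add: m_def)
    qed
    have "c * (norm (Ss T0 \<phi>))\<^sup>2 \<le> sqnorm {0..T0} (\<lambda>s. Bs (Ss s \<phi>))"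
      using obs_c[of \<phi>] by (simp add: adj_output_DA[OF T0 \<phi>])
    also have "\<dots> \<le> integral {0..T0} (\<lambda>s. m\<^sup>2)"
      by (intro integral_le sqint_norm_integrable sqint_Bs_Ss \<phi> integrable_const_ivl power_mono pointwise) auto
    finally have "c * (norm (Ss T0 \<phi>))\<^sup>2 \<le> T0 * m\<^sup>2" using T0 by simp
    then have "(norm (Ss T0 \<phi>))\<^sup>2 \<le> T0 / c * m\<^sup>2" using c by (simp add: field_simps)
    then have "norm (Ss T0 \<phi>) \<le> sqrt (T0 / c * m\<^sup>2)" by (rule real_le_rsqrt)
    also have "\<dots> = sqrt (T0 / c) * m" using m by (simp only: real_sqrt_mult real_sqrt_abs abs_of_nonneg)
    finally have 1: "norm (Ss T0 \<phi>) \<le> sqrt (T0 / c) * m" .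
    have "\<phi> = Ss T0 \<phi> - Is T0 (As \<phi>)" using Is_As[of T0 \<phi>] \<phi> T0 by simp
    then have "norm \<phi> \<le> norm (Ss T0 \<phi>) + norm (Is T0 (As \<phi>))" using norm_triangle_ineq4 by metis
    also have "\<dots> \<le> sqrt (T0 / c) * m + M * T0 * norm (As \<phi>)"
      using 1 Is_le[of T0 "As \<phi>"] T0 by simp
    also have "\<dots> \<le> sqrt (T0 / c) * ((k + 1) * (norm (As \<phi>) + norm (Bs \<phi>))) + M * T0 * (norm (As \<phi>) + norm (Bs \<phi>))"
    proof (intro add_mono mult_left_mono)
      show "m \<le> (k + 1) * (norm (As \<phi>) + norm (Bs \<phi>))"
        using k mult_nonneg_nonneg[OF k norm_ge_zero[of "Bs \<phi>"]] by (simp add: m_def algebra_simps)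
    qed (use T0 c M in auto)
    finally show ?thesis by (simp add: algebra_simps)
  qed
  moreover have "0 \<le> sqrt (T0 / c) * (k + 1) + M * T0" using T0 c k M by simp
  ultimately show ?thesis by blast
qed

text \<open>The range of the adjoint of the map taking (x, u) to A x + B u. Steady pairs are its
  orthogonal complement, so a multiplier exists once the cost gradient lies in this range.\<close>

definition adj_range :: "('h \<times> 'u) set" where
  "adj_range = (\<lambda>\<phi>. (As \<phi>, Bs \<phi>)) ` DA"

lemma steady_state_iff_orthogonal:
  "steady_state A B x u \<longleftrightarrow> (\<forall>k\<in>adj_range. (x, u) \<bullet> k = 0)"
  by (auto simp: steady_state_def adj_range_def inner_prod_def)

lemma subspace_adj_range: "subspace adj_range"
  unfolding subspace_def
proof (intro conjI ballI allI)
  have "Bs 0 = 0" using Bs_scaleR[OF DA_zero(1), of 0] by simp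
  then show "0 \<in> adj_range"
    unfolding adj_range_def by (intro image_eqI[of _ _ 0]) (auto simp: DA_zero zero_prod_def)
  show "x + y \<in> adj_range" if xy: "x \<in> adj_range" "y \<in> adj_range" for x y
  proof -
    obtain \<phi> \<psi> where "\<phi> \<in> DA" "x = (As \<phi>, Bs \<phi>)" "\<psi> \<in> DA" "y = (As \<psi>, Bs \<psi>)"
      using xy unfolding adj_range_def by blast
    then show ?thesis unfolding adj_range_def by (intro image_eqI[of _ _ "\<phi> + \<psi>"]) (auto simp: DA_add Bs_add)
  qed
  show "c *\<^sub>R x \<in> adj_range" if x: "x \<in> adj_range" for x c
  proof -
    obtain \<phi> where "\<phi> \<in> DA" "x = (As \<phi>, Bs \<phi>)" using x unfolding adj_range_def by blast
    then show ?thesis unfolding adj_range_def by (intro image_eqI[of _ _ "c *\<^sub>R \<phi>"]) (auto simp: DA_scaleR Bs_scaleR)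
  qed
qed

text \<open>Coercivity makes preimages of a convergent sequence Cauchy; closedness of
  \<open>As\<close> and the graph bound of \<open>Bs\<close> then identify the image of their
  limit.\<close>

lemma closed_adj_range:
  assumes "adj_observable A S B T0" "T0 > 0"
  shows "closed adj_range"
  unfolding closed_sequential_limits
proof (intro allI impI, elim conjE)
  fix f l assume f: "\<forall>n. f n \<in> adj_range" and lim: "f \<longlonglongrightarrow> l"
  obtain K where K: "K \<ge> 0" "\<And>\<phi>. \<phi> \<in> DA \<Longrightarrow> norm \<phi> \<le> K * (norm (As \<phi>) + norm (Bs \<phi>))"
    using observability_imp_coercive[OF assms] by blast
  obtain KB where KB: "0 \<le> KB" "\<And>\<phi>. \<phi> \<in> DA \<Longrightarrow> norm (Bs \<phi>) \<le> KB * (norm \<phi> + norm (As \<phi>))"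
    using Bs_bounded by blast
  have "\<forall>n. \<exists>\<phi>. \<phi> \<in> DA \<and> f n = (As \<phi>, Bs \<phi>)" using f unfolding adj_range_def by blast
  then obtain \<phi> where \<phi>: "\<And>n. \<phi> n \<in> DA" "\<And>n. f n = (As (\<phi> n), Bs (\<phi> n))" by metis
  have limA: "(\<lambda>n. As (\<phi> n)) \<longlonglongrightarrow> fst l" and limB: "(\<lambda>n. Bs (\<phi> n)) \<longlonglongrightarrow> snd l"
    using tendsto_fst[OF lim] tendsto_snd[OF lim] by (simp_all add: \<phi>(2))
  have le: "norm (\<phi> m - \<phi> n) \<le> 2 * K * norm (f m - f n)" for m n
  proof -
    have "norm (\<phi> m - \<phi> n) \<le> K * (norm (As (\<phi> m) - As (\<phi> n)) + norm (Bs (\<phi> m) - Bs (\<phi> n)))"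
      using K(2)[of "\<phi> m - \<phi> n"] DA_diff[OF \<phi>(1) \<phi>(1), of m n] Bs_diff[OF \<phi>(1) \<phi>(1), of m n] by simp
    also have "\<dots> \<le> K * (norm (f m - f n) + norm (f m - f n))"
      using norm_fst_le[of "fst (f m - f n)" "snd (f m - f n)"] norm_snd_le[of "snd (f m - f n)" "fst (f m - f n)"] K(1)
      by (intro mult_left_mono add_mono) (simp_all add: \<phi>(2))
    finally show ?thesis by simp
  qed
  have "Cauchy \<phi>"
    unfolding Cauchy_iff
  proof (intro allI impI)
    fix e :: real assume "e > 0"
    have "2 * K + 1 > 0" using K(1) by simp
    then have "e / (2 * K + 1) > 0" using \<open>e > 0\<close> by simp
    from CauchyD[OF LIMSEQ_imp_Cauchy[OF lim] this]
    obtain N where N: "\<And>m n. m \<ge> N \<Longrightarrow> n \<ge> N \<Longrightarrow> norm (f m - f n) < e / (2 * K + 1)" by blast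
    have "norm (\<phi> m - \<phi> n) < e" if "m \<ge> N" "n \<ge> N" for m n
    proof -
      have "norm (\<phi> m - \<phi> n) \<le> (2 * K + 1) * norm (f m - f n)"
        using le[of m n] norm_ge_zero[of "f m - f n"] by (simp only: distrib_right)
      also have "\<dots> < (2 * K + 1) * (e / (2 * K + 1))"
        using N[OF that] \<open>2 * K + 1 > 0\<close> by (intro mult_strict_left_mono)
      also have "\<dots> = e" using \<open>2 * K + 1 > 0\<close> by simp
      finally show ?thesis .
    qed
    then show "\<exists>N. \<forall>m\<ge>N. \<forall>n\<ge>N. norm (\<phi> m - \<phi> n) < e" by blast
  qed
  then obtain \<psi> where \<psi>: "\<phi> \<longlonglongrightarrow> \<psi>" by (auto simp: Cauchy_convergent_iff convergent_def)
  from DA_closed[OF \<phi>(1) \<psi> limA] have D: "\<psi> \<in> DA" "As \<psi> = fst l" by auto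
  have "(\<lambda>n. KB * (norm (\<phi> n - \<psi>) + norm (As (\<phi> n) - As \<psi>))) \<longlonglongrightarrow> KB * (norm (\<psi> - \<psi>) + norm (fst l - As \<psi>))"
    by (intro tendsto_intros \<psi> limA)
  then have lim0: "(\<lambda>n. KB * (norm (\<phi> n - \<psi>) + norm (As (\<phi> n) - As \<psi>))) \<longlonglongrightarrow> 0" by (simp add: D(2))
  have le': "norm (Bs (\<phi> n) - Bs \<psi>) \<le> KB * (norm (\<phi> n - \<psi>) + norm (As (\<phi> n) - As \<psi>))" for n
    using KB(2)[of "\<phi> n - \<psi>"] DA_diff[OF \<phi>(1) D(1), of n] Bs_diff[OF \<phi>(1) D(1), of n] by simp
  have "(\<lambda>n. Bs (\<phi> n) - Bs \<psi>) \<longlonglongrightarrow> 0"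
    by (rule Lim_null_comparison[OF always_eventually[OF allI[OF le']] lim0])
  then have "(\<lambda>n. Bs (\<phi> n)) \<longlonglongrightarrow> Bs \<psi>" by (simp add: LIM_zero_iff)
  then have "Bs \<psi> = snd l" using limB LIMSEQ_unique by blast
  then show "l \<in> adj_range" unfolding adj_range_def using D by (intro image_eqI[of _ _ \<psi>]) (auto simp: prod_eq_iff)
qed

text \<open>The parallelogram law holds separately for observation and control;
  \<open>\<delta>\<close> converts the observation gap into a state gap, hence the minimum of
  \<open>\<delta>\<close> and 1.\<close>

lemma steady_cost_midpoint:
  fixes C :: "'h \<Rightarrow>\<^sub>L 'h" and z :: 'h
  assumes \<delta>: "\<delta> > 0" "\<And>\<eta>. \<delta> * (norm \<eta>)\<^sup>2 \<le> (norm (C \<eta>))\<^sup>2"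
  defines "J \<equiv> \<lambda>p. (norm (C (fst p) - z))\<^sup>2 + (norm (snd p :: 'u))\<^sup>2"
  shows "J ((1/2) *\<^sub>R (p + p')) \<le> (J p + J p') / 2 - min \<delta> 1 / 4 * (norm (p - p'))\<^sup>2"
proof -
  have "C (fst ((1/2) *\<^sub>R (p + p'))) = (1/2) *\<^sub>R (C (fst p) + C (fst p'))"
    by (simp add: blinfun.scaleR_right blinfun.add_right)
  moreover have "snd ((1/2) *\<^sub>R (p + p')) = (1/2) *\<^sub>R (snd p + snd p') - 0" by simp
  ultimately have "J ((1/2) *\<^sub>R (p + p')) = (J p + J p') / 2
      - 1/4 * ((norm (C (fst p) - C (fst p')))\<^sup>2 + (norm (snd p - snd p'))\<^sup>2)"
    unfolding J_def by (simp only: norm_midpoint_power2) (simp add: field_simps)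
  moreover have "min \<delta> 1 * (norm (p - p'))\<^sup>2 \<le> (norm (C (fst p) - C (fst p')))\<^sup>2 + (norm (snd p - snd p'))\<^sup>2"
  proof -
    have "(norm (p - p'))\<^sup>2 = (norm (fst p - fst p'))\<^sup>2 + (norm (snd p - snd p'))\<^sup>2"
      by (simp add: norm_prod_def)
    moreover have "min \<delta> 1 * (norm (fst p - fst p'))\<^sup>2 \<le> \<delta> * (norm (fst p - fst p'))\<^sup>2"
      "min \<delta> 1 * (norm (snd p - snd p'))\<^sup>2 \<le> 1 * (norm (snd p - snd p'))\<^sup>2"
      by (intro mult_right_mono; simp)+
    ultimately show ?thesis
      using \<delta>(2)[of "fst p - fst p'"] by (simp add: blinfun.diff_right distrib_left)
  qed
  ultimately show ?thesis by simp
qed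

lemma optimal_steady_triple_ex1:
  fixes C :: "'h \<Rightarrow>\<^sub>L 'h"
  assumes obs: "adj_observable A S B T0" and T0: "T0 > 0"
    and \<delta>: "\<delta> > 0" "\<And>\<eta>. \<delta> * (norm \<eta>)\<^sup>2 \<le> (norm (C \<eta>))\<^sup>2"
  shows "\<exists>!p. optimal_steady_triple A B C z p"
proof -
  define J where "J = (\<lambda>p. (norm (C (fst p) - z))\<^sup>2 + (norm (snd p :: 'u))\<^sup>2)"
  define N where "N = {p. \<forall>k\<in>adj_range. p \<bullet> k = 0}"
  have steady_N: "steady_state A B x u \<longleftrightarrow> (x, u) \<in> N" for x u
    by (simp add: N_def steady_state_iff_orthogonal)
  have N_sub: "subspace N" unfolding N_def subspace_def by (auto simp: inner_add_left)
  have N_closed: "closed N"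
  proof -
    have "N = (\<Inter>k\<in>adj_range. {p. p \<bullet> k = 0})" by (auto simp: N_def)
    then show ?thesis by (auto intro!: closed_INT closed_Collect_eq continuous_intros)
  qed
  have mid: "J ((1/2) *\<^sub>R (p + p')) \<le> (J p + J p') / 2 - min \<delta> 1 / 4 * (norm (p - p'))\<^sup>2" for p p'
    unfolding J_def by (rule steady_cost_midpoint[OF \<delta>])
  have mid_N: "(1/2) *\<^sub>R (p + p') \<in> N" if "p \<in> N" "p' \<in> N" for p p'
    using that N_sub by (simp add: subspace_add subspace_scale)
  have "\<exists>p\<in>N. \<forall>p'\<in>N. J p \<le> J p'"
  proof (rule uniformly_midpoint_convex_attains_min[OF N_closed, where c = "min \<delta> 1 / 4"])
    show "N \<noteq> {}" using N_sub subspace_0 by auto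
    show "continuous_on N J"
      unfolding J_def by (intro continuous_intros C_continuous_on)
  qed (use mid mid_N \<delta>(1) in \<open>auto simp: J_def\<close>)
  then obtain p where p: "p \<in> N" "\<And>p'. p' \<in> N \<Longrightarrow> J p \<le> J p'" by blast
  define xb where "xb = fst p"
  define ub where "ub = snd p"
  have orth: "(C xb - z) \<bullet> C x + ub \<bullet> u = 0" if xu: "(x, u) \<in> N" for x u
  proof (rule quadratic_nonneg_imp_linear_zero)
    fix t
    have "p + t *\<^sub>R (x, u) \<in> N" by (intro subspace_add[OF N_sub p(1)] subspace_scale[OF N_sub xu])
    from p(2)[OF this]
    have "(norm (C xb - z))\<^sup>2 + (norm ub)\<^sup>2 \<le> (norm ((C xb - z) + t *\<^sub>R C x))\<^sup>2 + (norm (ub + t *\<^sub>R u))\<^sup>2"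
      by (simp add: J_def xb_def ub_def blinfun.add_right blinfun.scaleR_right algebra_simps)
    then show "0 \<le> 2 * t * ((C xb - z) \<bullet> C x + ub \<bullet> u) + t\<^sup>2 * ((norm (C x))\<^sup>2 + (norm u)\<^sup>2)"
      unfolding norm_add_power2 by (simp add: power_mult_distrib algebra_simps)
  qed
  let ?C = "adjoint (blinfun_apply C)"
  \<comment> \<open>The gradient annihilates \<open>N\<close>, the orthogonal complement of
    \<open>adj_range\<close>; closedness of the range turns this into membership, and a preimage is
    the multiplier.\<close>
  have "(- ?C (C xb - z), - ub) \<in> adj_range"
  proof (rule double_orthogonal_complement[OF closed_adj_range[OF obs T0] subspace_adj_range])
    fix y assume y: "\<And>k. k \<in> adj_range \<Longrightarrow> y \<bullet> k = 0"
    then have "y \<in> N" by (simp add: N_def)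
    then have "(C xb - z) \<bullet> C (fst y) + ub \<bullet> snd y = 0" using orth[of "fst y" "snd y"] by simp
    then show "(- ?C (C xb - z), - ub) \<bullet> y = 0"
      by (simp add: inner_prod_def inner_commute[of "?C _"] inner_commute[of "C xb - z"] adjoint_blinfun)
  qed
  then obtain yb where yb: "yb \<in> DA" "As yb = - ?C (C xb - z)" "Bs yb = - ub"
    unfolding adj_range_def by auto
  have "optimal_steady_triple A B C z (xb, ub, yb)"
    unfolding optimal_steady_triple_def
    using p yb by (auto simp: steady_N J_def xb_def ub_def)
  moreover have "t = t'" if t: "optimal_steady_triple A B C z t" and t': "optimal_steady_triple A B C z t'" for t t'
  proof -
    obtain x u y where t_eq: "t = (x, u, y)" by (cases t)
    obtain x' u' y' where t'_eq: "t' = (x', u', y')" by (cases t')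
    note T = t[unfolded t_eq optimal_steady_triple_def, simplified]
    note T' = t'[unfolded t'_eq optimal_steady_triple_def, simplified]
    have N: "(x, u) \<in> N" "(x', u') \<in> N" using T T' steady_N by auto
    have le: "J (x, u) \<le> J p'" "J (x', u') \<le> J p'" if "p' \<in> N" for p'
      using T T' that steady_N[of "fst p'" "snd p'"] by (auto simp: J_def)
    \<comment> \<open>Both pairs are minimal, so their midpoint is not cheaper, and the convexity
      gap has to vanish.\<close>
    have le0: "d \<le> 0" if "a \<le> (b + b') / 2 - d" "b \<le> a" "b' \<le> a" for a b b' d :: real
      using that by argo
    have "min \<delta> 1 / 4 * (norm ((x, u) - (x', u')))\<^sup>2 \<le> min \<delta> 1 / 4 * 0"
      unfolding mult_zero_right by (rule le0[OF mid le[OF mid_N[OF N]]])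
    moreover have "0 < min \<delta> 1 / 4" using \<delta>(1) by simp
    ultimately have "(norm ((x, u) - (x', u')))\<^sup>2 \<le> 0" by (simp only: mult_le_cancel_left_pos)
    then have eq: "x = x'" "u = u'" by (auto simp: zero_prod_def)
    obtain K where K: "\<And>\<phi>. \<phi> \<in> DA \<Longrightarrow> norm \<phi> \<le> K * (norm (As \<phi>) + norm (Bs \<phi>))"
      using observability_imp_coercive[OF obs T0] by blast
    have Y: "y \<in> DA" "y' \<in> DA" "As y = As y'" "Bs y = Bs y'"
    proof -
      show "y \<in> DA" "y' \<in> DA" using T T' by auto
      have "As y = - ?C (C x - z)" "As y' = - ?C (C x' - z)"
        using T T' by (auto simp: minus_equation_iff[of "As _"] eq_neg_iff_add_eq_0 add.commute algebra_simps)
      then show "As y = As y'" using eq by simp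
      have "u = - Bs y" "u' = - Bs y'" using T T' by auto
      then show "Bs y = Bs y'" using eq by simp
    qed
    have "norm (y - y') \<le> 0" using K[of "y - y'"] Y DA_diff[OF Y(1,2)] Bs_diff[OF Y(1,2)] by simp
    then show ?thesis using eq t_eq t'_eq by simp
  qed
  ultimately show ?thesis by blast
qed

end

section \<open>The dynamic problem\<close>

context control_system
begin

lemma traj_add_scaleR:
  assumes "0 \<le> t" "sqint {0..t} u" "sqint {0..t} w"
  shows "traj x0 (\<lambda>s. u s + c *\<^sub>R w s) t = traj x0 u t + c *\<^sub>R Phi t w"
  using assms by (simp add: Phi_add Phi_scaleR sqint_scaleR)

context
  fixes C :: "'h \<Rightarrow>\<^sub>L 'h" and z x0 :: 'h and T :: real
  assumes T: "T > 0"
begin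

definition residual :: "(real \<Rightarrow> 'u) \<Rightarrow> real \<Rightarrow> 'h" where
  "residual u s = C (traj x0 u s) - z"

lemma residual_continuous_on:
  "sqint {0..T} u \<Longrightarrow> continuous_on {0..T} (residual u)"
  unfolding residual_def by (intro continuous_on_diff continuous_on_const C_continuous_on traj_continuous_on)

lemma sqint_residual: "sqint {0..T} u \<Longrightarrow> sqint {0..T} (residual u)"
  by (rule sqint_continuous[OF residual_continuous_on])

lemma sqint_C_Phi: "sqint {0..T} u \<Longrightarrow> sqint {0..T} (\<lambda>s. C (Phi s u))"
  by (rule sqint_continuous[OF C_continuous_on[OF Phi_continuous_on]])

lemma cost_eq:
  assumes "sqint {0..T} u"
  shows "cost A S B C z T x0 u
    = sqnorm {0..T} (\<lambda>s. residual u s) + sqnorm {0..T} u"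
proof -
  have int: "(\<lambda>s. (norm (residual u s))\<^sup>2) integrable_on {0..T}" "(\<lambda>s. (norm (u s))\<^sup>2) integrable_on {0..T}"
    by (intro sqint_norm_integrable sqint_residual assms)+
  have "cost A S B C z T x0 u
      = (LINT t:{0<..<T}|lebesgue. (norm (residual u t))\<^sup>2 + (norm (u t))\<^sup>2)"
    by (simp add: cost_def state_eq residual_def)
  also have "\<dots> = integral {0..T} (\<lambda>s. (norm (residual u s))\<^sup>2 + (norm (u s))\<^sup>2)"
    by (intro LINT_Ioo_eq_integral integrable_add int) auto
  finally show ?thesis using integral_add[OF int] by simp
qed

lemma residual_add_scaleR:
  assumes "sqint {0..T} u" "sqint {0..T} w" "s \<in> {0..T}"
  shows "residual (\<lambda>s. u s + c *\<^sub>R w s) s = residual u s + c *\<^sub>R C (Phi s w)"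
proof -
  have "sqint {0..s} u" "sqint {0..s} w"
    using assms(3) by (auto intro: sqint_subset[OF assms(1)] sqint_subset[OF assms(2)])
  then show ?thesis
    using assms(3) traj_add_scaleR[of s u w x0 c]
    by (simp add: residual_def blinfun.add_right blinfun.scaleR_right)
qed

lemma integral_norm_add_scaleR:
  fixes f g :: "real \<Rightarrow> 'x::real_inner"
  assumes "sqint {0..T} f" "sqint {0..T} g"
  shows "sqnorm {0..T} (\<lambda>s. f s + c *\<^sub>R g s) = sqnorm {0..T} f
    + 2 * c * integral {0..T} (\<lambda>s. f s \<bullet> g s) + c\<^sup>2 * sqnorm {0..T} g"
proof -
  have int: "(\<lambda>s. (norm (f s))\<^sup>2) integrable_on {0..T}" "(\<lambda>s. 2 * c * (f s \<bullet> g s)) integrable_on {0..T}"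
    "(\<lambda>s. c\<^sup>2 * (norm (g s))\<^sup>2) integrable_on {0..T}"
    by (intro sqint_norm_integrable integrable_on_mult_right sqint_inner_integrable assms; simp)+
  have "sqnorm {0..T} (\<lambda>s. f s + c *\<^sub>R g s)
      = integral {0..T} (\<lambda>s. (norm (f s))\<^sup>2 + 2 * c * (f s \<bullet> g s) + c\<^sup>2 * (norm (g s))\<^sup>2)"
    by (simp add: norm_add_power2 power_mult_distrib mult.assoc)
  also have "\<dots> = sqnorm {0..T} f + integral {0..T} (\<lambda>s. 2 * c * (f s \<bullet> g s))
      + integral {0..T} (\<lambda>s. c\<^sup>2 * (norm (g s))\<^sup>2)"
    by (subst integral_add integral_add[OF int(1,2)] | intro integrable_add int refl)+
  finally show ?thesis by simp
qed

text \<open>Along u + c w the cost is an exact quadratic in \<open>c\<close> with minimum at 0, so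
  its linear coefficient vanishes.\<close>

lemma optimal_imp_stationary:
  assumes "optimal_control A S B C z T x0 u" and w: "sqint {0..T} w"
  shows "integral {0..T} (\<lambda>s. residual u s \<bullet> C (Phi s w)) + integral {0..T} (\<lambda>s. u s \<bullet> w s) = 0"
proof (rule quadratic_nonneg_imp_linear_zero)
  fix c
  have u: "sqint {0..T} u" using assms(1) by (simp add: optimal_control_def L2_iff_sqint)
  have uw: "sqint {0..T} (\<lambda>s. u s + c *\<^sub>R w s)" by (intro sqint_add u sqint_scaleR w) auto
  have "cost A S B C z T x0 u \<le> cost A S B C z T x0 (\<lambda>s. u s + c *\<^sub>R w s)"
    using assms(1) uw by (simp add: optimal_control_def L2_iff_sqint)
  also have "\<dots> = sqnorm {0..T} (\<lambda>s. residual u s + c *\<^sub>R C (Phi s w))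
      + sqnorm {0..T} (\<lambda>s. u s + c *\<^sub>R w s)"
    unfolding cost_eq[OF uw]
    by (intro arg_cong2[where f = "(+)"] integral_cong refl) (simp add: residual_add_scaleR u w)
  also have "\<dots> = cost A S B C z T x0 u
      + 2 * c * (integral {0..T} (\<lambda>s. residual u s \<bullet> C (Phi s w)) + integral {0..T} (\<lambda>s. u s \<bullet> w s))
      + c\<^sup>2 * (sqnorm {0..T} (\<lambda>s. C (Phi s w)) + sqnorm {0..T} w)"
    unfolding integral_norm_add_scaleR[OF sqint_residual[OF u] sqint_C_Phi[OF w]]
      integral_norm_add_scaleR[OF u w] cost_eq[OF u] by (simp add: algebra_simps)
  finally show "0 \<le> 2 * c * (integral {0..T} (\<lambda>s. residual u s \<bullet> C (Phi s w)) + integral {0..T} (\<lambda>s. u s \<bullet> w s))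
      + c\<^sup>2 * (sqnorm {0..T} (\<lambda>s. C (Phi s w)) + sqnorm {0..T} w)"
    by simp
qed

text \<open>Both controls are stationary. Testing both conditions with the difference
  \<open>w\<close> and subtracting leaves the square norm of \<open>w\<close> plus that of its
  observed response, both nonnegative.\<close>

lemma optimal_control_ae_unique:
  assumes opt: "optimal_control A S B C z T x0 u" "optimal_control A S B C z T x0 v"
  shows "AE t in lebesgue_on {0<..<T}. u t = v t"
proof -
  have u: "sqint {0..T} u" and v: "sqint {0..T} v"
    using opt by (simp_all add: optimal_control_def L2_iff_sqint)
  define w where "w s = u s - v s" for s
  have w: "sqint {0..T} w" unfolding w_def by (intro sqint_diff u v) auto
  have res: "residual u s = residual v s + C (Phi s w)" if "s \<in> {0..T}" for s
    using residual_add_scaleR[OF v w that, of 1] by (simp add: w_def)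
  have "integral {0..T} (\<lambda>s. residual u s \<bullet> C (Phi s w))
      = integral {0..T} (\<lambda>s. residual v s \<bullet> C (Phi s w) + (norm (C (Phi s w)))\<^sup>2)"
    by (intro integral_cong) (simp add: res inner_add_left power2_norm_eq_inner)
  also have "\<dots> = integral {0..T} (\<lambda>s. residual v s \<bullet> C (Phi s w)) + sqnorm {0..T} (\<lambda>s. C (Phi s w))"
    by (intro integral_add sqint_inner_integrable sqint_norm_integrable sqint_residual sqint_C_Phi v w) auto
  finally have 1: "integral {0..T} (\<lambda>s. residual u s \<bullet> C (Phi s w))
      = integral {0..T} (\<lambda>s. residual v s \<bullet> C (Phi s w)) + sqnorm {0..T} (\<lambda>s. C (Phi s w))" .
  have "integral {0..T} (\<lambda>s. u s \<bullet> w s) = integral {0..T} (\<lambda>s. v s \<bullet> w s + (norm (w s))\<^sup>2)"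
    by (intro integral_cong) (simp add: w_def inner_diff_left power2_norm_eq_inner)
  also have "\<dots> = integral {0..T} (\<lambda>s. v s \<bullet> w s) + sqnorm {0..T} w"
    by (intro integral_add sqint_inner_integrable sqint_norm_integrable v w) auto
  finally have "sqnorm {0..T} (\<lambda>s. C (Phi s w)) + sqnorm {0..T} w = 0"
    using 1 optimal_imp_stationary[OF opt(1) w] optimal_imp_stationary[OF opt(2) w] by linarith
  moreover have "0 \<le> sqnorm {0..T} (\<lambda>s. C (Phi s w))"
    by (intro integral_nonneg sqint_norm_integrable sqint_C_Phi w) auto
  moreover have "0 \<le> sqnorm {0..T} w"
    by (intro integral_nonneg sqint_norm_integrable w) auto
  ultimately have "sqnorm {0..T} w = 0" by linarith
  from sqint_integral_eq_0_Icc[OF w this] have neg: "negligible {t \<in> {0..T}. w t \<noteq> 0}" .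
  have "AE t in lebesgue. t \<in> {0<..<T} \<longrightarrow> u t = v t"
    by (rule negligible_imp_AE_lebesgue[OF neg]) (auto simp: w_def)
  then show ?thesis by (simp add: AE_restrict_space_iff)
qed

text \<open>On the Hilbert space of controls the cost is a squared distance \<open>R X\<close> to
  \<open>b\<close> plus the square norm of \<open>X\<close>; the latter alone supplies uniform
  convexity with modulus 1/4.\<close>

lemma optimal_control_exists: "\<exists>u. optimal_control A S B C z T x0 u"
proof -
  \<comment> \<open>The input-to-observation operator on equivalence classes. \<open>Phi\<close>
    ignores null sets, so the representative picked by \<open>rep_l2\<close> is immaterial.\<close>
  define R where "R X = embed_l2 0 T (\<lambda>s. C (Phi s (rep_l2 X)))" for X :: "'u l2"
  define b where "b = embed_l2 0 T (\<lambda>s. z - C (S s x0))"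
  have rep: "sqint {0..t} (rep_l2 X)" for t and X :: "'u l2"
    by (rule sqint_subset[OF sqint_rep_l2]) auto
  have sqR: "sqint {0..T} (\<lambda>s. C (Phi s (rep_l2 X)))" for X :: "'u l2" by (rule sqint_C_Phi[OF rep])
  have Phi_rep: "Phi s (rep_l2 (abs_l2 f)) = Phi s f" if "0 \<le> s" "sqint UNIV f" for s f
    by (rule Phi_spike[OF that(1) _ rep_l2_ae[OF that(2)]]) (use sqint_subset[OF that(2)] in auto)
  have "bounded_linear R"
  proof -
    obtain M where M: "M \<ge> 0" "\<And>t u. t \<in> {0..T} \<Longrightarrow> sqint {0..t} u \<Longrightarrow>
        norm (Phi t u) \<le> M * sqrt (sqnorm {0..t} u)"
      using Phi_bounded[of T] by blast
    show ?thesis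
    proof (rule bounded_linear_intro[where K = "sqrt T * (norm C * M)"])
      fix X Y :: "'u l2" and c :: real
      have sum: "X + Y = abs_l2 (\<lambda>s. rep_l2 X s + rep_l2 Y s)"
        using add_abs_l2[OF sqint_rep_l2 sqint_rep_l2, of X Y] by (simp add: abs_rep_l2)
      have "C (Phi s (rep_l2 (X + Y))) = C (Phi s (rep_l2 X)) + C (Phi s (rep_l2 Y))" if "0 \<le> s" for s
        unfolding sum using that Phi_rep[OF that sqint_add[OF sqint_rep_l2 sqint_rep_l2], of X Y]
        by (simp add: Phi_add rep blinfun.add_right)
      then have "R (X + Y) = abs_l2 (\<lambda>s. (if s \<in> {0..T} then C (Phi s (rep_l2 X)) else 0)
          + (if s \<in> {0..T} then C (Phi s (rep_l2 Y)) else 0))"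
        unfolding R_def embed_l2_def by (intro arg_cong[where f = abs_l2]) (auto simp: fun_eq_iff)
      also have "\<dots> = R X + R Y"
        unfolding R_def embed_l2_def by (rule add_abs_l2[symmetric]; rule iffD2[OF sqint_UNIV sqR])
      finally show "R (X + Y) = R X + R Y" .
      have scale: "c *\<^sub>R X = abs_l2 (\<lambda>s. c *\<^sub>R rep_l2 X s)"
        using scaleR_abs_l2[OF sqint_rep_l2, of c X] by (simp add: abs_rep_l2)
      have "C (Phi s (rep_l2 (c *\<^sub>R X))) = c *\<^sub>R C (Phi s (rep_l2 X))" if "0 \<le> s" for s
        unfolding scale using that Phi_rep[OF that sqint_scaleR[OF sqint_rep_l2], of c X]
        by (simp add: Phi_scaleR rep blinfun.scaleR_right)
      then have "R (c *\<^sub>R X) = abs_l2 (\<lambda>s. c *\<^sub>R (if s \<in> {0..T} then C (Phi s (rep_l2 X)) else 0))"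
        unfolding R_def embed_l2_def by (intro arg_cong[where f = abs_l2]) (auto simp: fun_eq_iff)
      also have "\<dots> = c *\<^sub>R R X"
        unfolding R_def embed_l2_def by (rule scaleR_abs_l2[symmetric]; rule iffD2[OF sqint_UNIV sqR])
      finally show "R (c *\<^sub>R X) = c *\<^sub>R R X" .
      have X2: "(norm X)\<^sup>2 = sqnorm UNIV (\<lambda>s. rep_l2 X s)"
        using norm_abs_l2[OF sqint_rep_l2, of X] by (simp add: abs_rep_l2)
      have "(norm (R X))\<^sup>2 = sqnorm {0..T} (\<lambda>s. C (Phi s (rep_l2 X)))"
        unfolding R_def by (rule norm_embed_l2[OF sqR])
      also have "\<dots> \<le> integral {0..T} (\<lambda>s. (norm C * (M * norm X))\<^sup>2)"
      proof (rule integral_le)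
        fix s assume s: "s \<in> {0..T}"
        have "sqnorm {0..s} (\<lambda>s. rep_l2 X s) \<le> (norm X)\<^sup>2"
          unfolding X2 by (intro integral_subset_le sqint_norm_integrable sqint_rep_l2 rep) auto
        then have "sqrt (sqnorm {0..s} (\<lambda>s. rep_l2 X s)) \<le> norm X"
          by (intro real_le_lsqrt) auto
        then have "norm (Phi s (rep_l2 X)) \<le> M * norm X"
          using M(2)[OF s rep, of X] mult_left_mono[OF _ M(1)] by (meson order_trans)
        then have "norm (C (Phi s (rep_l2 X))) \<le> norm C * (M * norm X)"
          by (intro order.trans[OF norm_blinfun] mult_left_mono) auto
        then show "(norm (C (Phi s (rep_l2 X))))\<^sup>2 \<le> (norm C * (M * norm X))\<^sup>2" by (intro power_mono) auto
      qed (use sqint_norm_integrable[OF sqR] in auto)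
      also have "\<dots> = T * (norm C * (M * norm X))\<^sup>2" using T by simp
      also have "\<dots> = (norm X * (sqrt T * (norm C * M)))\<^sup>2" using T by (simp add: power_mult_distrib)
      finally show "norm (R X) \<le> norm X * (sqrt T * (norm C * M))"
        by (rule power2_le_imp_le) (use T M in auto)
    qed
  qed
  then interpret R: bounded_linear R .
  have res: "sqnorm {0..T} (\<lambda>s. residual (rep_l2 X) s) = (norm (R X - b))\<^sup>2" for X
  proof -
    have z: "sqint {0..T} (\<lambda>s. z - C (S s x0))"
      by (intro sqint_continuous continuous_on_diff continuous_on_const C_continuous_on S_continuous_on') auto
    have "R X - b = embed_l2 0 T (residual (rep_l2 X))"
      unfolding R_def b_def embed_l2_def
      by (subst diff_abs_l2[OF iffD2[OF sqint_UNIV sqR] iffD2[OF sqint_UNIV z]])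
        (auto intro!: arg_cong[where f = abs_l2] simp: fun_eq_iff residual_def blinfun.add_right)
    then show ?thesis using norm_embed_l2[OF sqint_residual[OF rep], of X] by simp
  qed
  have "\<exists>X\<in>UNIV. \<forall>Y\<in>UNIV. (norm (R X - b))\<^sup>2 + (norm (X - 0))\<^sup>2 \<le> (norm (R Y - b))\<^sup>2 + (norm (Y - 0))\<^sup>2"
  proof (rule uniformly_midpoint_convex_attains_min[where c = "1/4"])
    show "continuous_on UNIV (\<lambda>X. (norm (R X - b))\<^sup>2 + (norm (X - 0))\<^sup>2)"
      by (intro continuous_intros R.continuous_on)
    fix X Y :: "'u l2"
    show "(norm (R ((1/2) *\<^sub>R (X + Y)) - b))\<^sup>2 + (norm ((1/2) *\<^sub>R (X + Y) - 0))\<^sup>2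
      \<le> ((norm (R X - b))\<^sup>2 + (norm (X - 0))\<^sup>2 + ((norm (R Y - b))\<^sup>2 + (norm (Y - 0))\<^sup>2)) / 2 - 1/4 * (norm (X - Y))\<^sup>2"
      unfolding R.scaleR R.add norm_midpoint_power2 using zero_le_power2[of "norm (R X - R Y)"]
      by (simp only: diff_0_right) argo
  qed auto
  then obtain X where X: "\<And>Y. (norm (R X - b))\<^sup>2 + (norm X)\<^sup>2 \<le> (norm (R Y - b))\<^sup>2 + (norm Y)\<^sup>2" by auto
  have "optimal_control A S B C z T x0 (rep_l2 X)"
    unfolding optimal_control_def L2_iff_sqint
  proof (intro conjI ballI)
    show "sqint {0..T} (rep_l2 X)" by (rule rep)
    fix w :: "real \<Rightarrow> 'u" assume "w \<in> L2 T"
    then have w: "sqint {0..T} w" by (simp add: L2_iff_sqint)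
    let ?w = "\<lambda>s. if s \<in> {0..T} then w s else 0"
    have w': "sqint UNIV ?w" by (rule iffD2[OF sqint_UNIV w])
    have "cost A S B C z T x0 (rep_l2 X) = (norm (R X - b))\<^sup>2 + sqnorm {0..T} (\<lambda>s. rep_l2 X s)"
      using cost_eq[OF rep] res by simp
    \<comment> \<open>Elements of the type live on the whole line, so the norm of \<open>X\<close>
      also counts values outside [0, T]; the inequality goes in the useful direction, while
      competitors are extended by zero and give equality.\<close>
    also have "sqnorm {0..T} (\<lambda>s. rep_l2 X s) \<le> (norm X)\<^sup>2"
      using norm_abs_l2[OF sqint_rep_l2, of X]
        integral_subset_le[OF _ sqint_norm_integrable[OF rep] sqint_norm_integrable[OF sqint_rep_l2], of T X]
      by (simp add: abs_rep_l2)
    finally have "cost A S B C z T x0 (rep_l2 X) \<le> (norm (R (embed_l2 0 T w) - b))\<^sup>2 + (norm (embed_l2 0 T w))\<^sup>2"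
      using X[of "embed_l2 0 T w"] by linarith
    also have "(norm (embed_l2 0 T w))\<^sup>2 = sqnorm {0..T} w" by (rule norm_embed_l2[OF w])
    also have "(norm (R (embed_l2 0 T w) - b))\<^sup>2 = sqnorm {0..T} (\<lambda>s. residual w s)"
      unfolding res[symmetric]
    proof (rule integral_cong)
      fix s assume s: "s \<in> {0..T}"
      have "Phi s (rep_l2 (embed_l2 0 T w)) = Phi s ?w"
        unfolding embed_l2_def using s w' by (intro Phi_rep) auto
      also have "\<dots> = Phi s w"
        using s by (intro Phi_cong sqint_subset[OF w]) auto
      finally show "(norm (residual (rep_l2 (embed_l2 0 T w)) s))\<^sup>2 = (norm (residual w s))\<^sup>2"
        by (simp add: residual_def)
    qed
    finally show "cost A S B C z T x0 (rep_l2 X) \<le> cost A S B C z T x0 w" using cost_eq[OF w] by simp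
  qed
  then show ?thesis by blast
qed

end

section \<open>The optimality system\<close>

text \<open>The local bound upgrades strong continuity to continuity with a moving argument, which
  makes the integral defining \<open>adjoint_state\<close> exist.\<close>

lemma Ss_continuous_on_joint:
  assumes "continuous_on {a..b} g"
  shows "continuous_on {a..b} (\<lambda>s. Ss (s - a) (g s))"
  unfolding continuous_on_def
proof
  fix t assume t: "t \<in> {a..b}"
  obtain M where M: "M \<ge> 1" "\<And>s. 0 \<le> s \<Longrightarrow> s \<le> b - a \<Longrightarrow> norm (S s) \<le> M"
    using S_locally_bounded[of "b - a"] by force
  have bound: "norm (Ss (s - a) (g s) - Ss (t - a) (g t))
      \<le> M * norm (g s - g t) + norm (Ss (s - a) (g t) - Ss (t - a) (g t))" if s: "s \<in> {a..b}" for s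
  proof -
    have eq: "Ss (s - a) (g s) - Ss (t - a) (g t) = Ss (s - a) (g s - g t) + (Ss (s - a) (g t) - Ss (t - a) (g t))"
      by (simp add: linear_diff[OF Ss_linear])
    have le: "norm (Ss (s - a) (g s - g t)) \<le> M * norm (g s - g t)"
      by (rule order.trans[OF norm_Ss_le]) (use M(2)[of "s - a"] s in \<open>auto intro: mult_right_mono\<close>)
    show ?thesis unfolding eq by (rule norm_triangle_mono[OF le order_refl])
  qed
  have "continuous_on {a..b} (\<lambda>s. Ss (s - a) (g t))"
    by (rule continuous_on_compose2[OF Ss_continuous_on]) (auto intro!: continuous_intros)
  then have "((\<lambda>s. M * norm (g s - g t) + norm (Ss (s - a) (g t) - Ss (t - a) (g t)))
      \<longlongrightarrow> M * norm (g t - g t) + norm (Ss (t - a) (g t) - Ss (t - a) (g t))) (at t within {a..b})"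
    using assms t unfolding continuous_on_def by (intro tendsto_intros) auto
  then have lim: "((\<lambda>s. M * norm (g s - g t) + norm (Ss (s - a) (g t) - Ss (t - a) (g t))) \<longlongrightarrow> 0) (at t within {a..b})"
    by simp
  have "\<forall>\<^sub>F s in at t within {a..b}. norm (Ss (s - a) (g s) - Ss (t - a) (g t))
      \<le> M * norm (g s - g t) + norm (Ss (s - a) (g t) - Ss (t - a) (g t))"
    using bound by (auto simp: eventually_at_filter)
  then have "((\<lambda>s. Ss (s - a) (g s) - Ss (t - a) (g t)) \<longlongrightarrow> 0) (at t within {a..b})"
    using lim by (rule Lim_null_comparison)
  then show "((\<lambda>s. Ss (s - a) (g s)) \<longlongrightarrow> Ss (t - a) (g t)) (at t within {a..b})"
    by (simp add: LIM_zero_iff)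
qed

context
  fixes C :: "'h \<Rightarrow>\<^sub>L 'h" and z x0 :: 'h and T :: real and u :: "real \<Rightarrow> 'u"
  assumes T: "T > 0" and opt: "optimal_control A S B C z T x0 u"
begin

abbreviation "res \<equiv> residual C z x0 u"
abbreviation "yopt \<equiv> adjoint_state S C z T (state A S B x0 u)"

lemma u_sqint: "sqint {0..T} u"
  using opt by (simp add: optimal_control_def L2_iff_sqint)

lemma res_cont: "0 \<le> a \<Longrightarrow> b \<le> T \<Longrightarrow> continuous_on {a..b} res"
  by (rule continuous_on_subset[OF residual_continuous_on[OF T u_sqint]]) auto

lemma inner_adjoint_state:
  assumes "0 \<le> a"
  shows "yopt a \<bullet> \<zeta> = integral {a..T} (\<lambda>s. res s \<bullet> C (S (s - a) \<zeta>))"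
proof -
  let ?C = "adjoint (blinfun_apply C)"
  have "continuous_on {a..T} (\<lambda>s. ?C (res s))"
    by (intro bounded_linear.continuous_on[OF bounded_linear_adjoint_blinfun(1)] res_cont assms) simp
  then have int: "(\<lambda>s. Ss (s - a) (?C (res s))) integrable_on {a..T}"
    by (intro integrable_continuous_real Ss_continuous_on_joint)
  have "yopt a = integral {a..T} (\<lambda>s. Ss (s - a) (?C (res s)))"
    by (simp add: adjoint_state_def state_eq residual_def[OF T])
  then have "yopt a \<bullet> \<zeta> = integral {a..T} (\<lambda>s. Ss (s - a) (?C (res s)) \<bullet> \<zeta>)"
    using integral_linear[OF int bounded_linear_inner_left[of \<zeta>]] by (simp add: o_def)
  also have "\<dots> = integral {a..T} (\<lambda>s. res s \<bullet> C (S (s - a) \<zeta>))"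
    by (intro integral_cong)
      (simp add: inner_commute[of "Ss _ _"] inner_commute[of "res _"] adjoint_blinfun flip: inner_Ss)
  finally show ?thesis .
qed

text \<open>The control \<open>w\<close> on \<open>[a, a + h]\<close>, extended by zero, is inserted into the stationarity condition.\<close>

lemma adjoint_state_step:
  assumes a: "0 \<le> a" and h: "0 \<le> h" and ah: "a + h \<le> T" and w: "sqint {0..h} w"
  shows "yopt a \<bullet> \<zeta> = yopt (a + h) \<bullet> traj \<zeta> w h
    + integral {0..h} (\<lambda>r. res (r + a) \<bullet> C (traj \<zeta> w r) + u (r + a) \<bullet> w r)"
proof -
  let ?b = "a + h"
  define \<omega> where "\<omega> = (\<lambda>s. if s \<in> {a..?b} then w (s + (- a)) else 0)"
  have \<omega>_UNIV: "sqint UNIV \<omega>"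
  proof -
    have "sqint {a + (- a)..?b + (- a)} w" using w by simp
    from sqint_shift[OF this] show ?thesis unfolding \<omega>_def by (rule iffD2[OF sqint_UNIV])
  qed
  have \<omega>: "sqint {c..d} \<omega>" for c d by (rule sqint_subset[OF \<omega>_UNIV]) auto
  have \<omega>_out: "\<omega> s = 0" if "s < a \<or> ?b < s" for s using that by (auto simp: \<omega>_def)
  have \<omega>_in: "\<omega> (r + a) = w r" if "0 \<le> r" "r \<le> h" for r using that by (simp add: \<omega>_def)
  have Phi_before: "Phi s \<omega> = 0" if "0 \<le> s" "s \<le> a" for s
  proof -
    \<comment> \<open>At \<open>a\<close> itself \<open>\<omega>\<close> takes the value
      \<open>w 0\<close>, which need not vanish; this single point is discarded as a null
      set.\<close>
    have "Phi s \<omega> = Phi s (\<lambda>_. 0)"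
      by (rule Phi_spike[OF that(1) sqint_zero, of "{a}"]) (use that in \<open>auto simp: \<omega>_def\<close>)
    then show ?thesis using Phi_zero[OF that(1)] by simp
  qed
  have Phi_during: "Phi (r + a) \<omega> = Phi r w" if r: "0 \<le> r" "r \<le> h" for r
  proof -
    have wr: "sqint {0..r} w" by (rule sqint_subset[OF w]) (use r in auto)
    have "Phi (a + r) \<omega> = S r (Phi a \<omega>) + Phi r (\<lambda>s. \<omega> (s + a))" by (rule Phi_cocycle[OF a r(1) \<omega>])
    also have "Phi r (\<lambda>s. \<omega> (s + a)) = Phi r w"
      by (rule Phi_cong[OF r(1) wr]) (use r in \<open>auto simp: \<omega>_def\<close>)
    finally show ?thesis using Phi_before[OF a order_refl] by (simp add: add.commute)
  qed
  have Phi_after: "Phi s \<omega> = S (s - ?b) (Phi h w)" if s: "?b \<le> s" for s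
  proof -
    have 0: "0 \<le> ?b" "0 \<le> s - ?b" using a h s by auto
    have "Phi (?b + (s - ?b)) \<omega> = S (s - ?b) (Phi ?b \<omega>) + Phi (s - ?b) (\<lambda>r. \<omega> (r + ?b))"
      by (rule Phi_cocycle[OF 0 \<omega>])
    also have "Phi (s - ?b) (\<lambda>r. \<omega> (r + ?b)) = Phi (s - ?b) (\<lambda>_. 0)"
      by (rule Phi_spike[OF 0(2) sqint_zero, of "{0}"]) (auto simp: \<omega>_def)
    finally show ?thesis using Phi_during[of h] h Phi_zero[OF 0(2)] by (simp add: add.commute)
  qed
  define g where "g s = res s \<bullet> C (Phi s \<omega>) + u s \<bullet> \<omega> s" for s
  define f where "f s = res s \<bullet> C (S (s - a) \<zeta>)" for s
  have u_sub: "sqint {c..d} u" if "0 \<le> c" "d \<le> T" for c d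
    by (rule sqint_subset[OF u_sqint]) (use that in auto)
  have resC: "(\<lambda>s. res s \<bullet> C (Phi s \<omega>)) integrable_on {c..d}" if "0 \<le> c" "d \<le> T" for c d
    by (intro integrable_continuous_real continuous_on_inner res_cont C_continuous_on that
        continuous_on_subset[OF Phi_continuous_on[OF \<omega>, of T]]) (use that in auto)
  have u\<omega>: "(\<lambda>s. u s \<bullet> \<omega> s) integrable_on {c..d}" if "0 \<le> c" "d \<le> T" for c d
    by (intro sqint_inner_integrable u_sub that \<omega>) auto
  have g_int: "g integrable_on {c..d}" if "0 \<le> c" "d \<le> T" for c d
    unfolding g_def by (intro integrable_add resC u\<omega> that)
  have f_int: "f integrable_on {c..d}" if "a \<le> c" "d \<le> T" for c d
    unfolding f_def
    by (intro integrable_continuous_real continuous_on_inner res_cont C_continuous_on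
        continuous_on_compose2[OF S_continuous_on] continuous_on_diff continuous_on_id continuous_on_const)
      (use that a in auto)
  \<comment> \<open>Stationarity is cut at \<open>a\<close> and \<open>a + h\<close>: nothing
    happens before \<open>a\<close>, the middle carries \<open>w\<close>, and afterwards
    \<open>Phi h w\<close> evolves freely and is absorbed into the pairing with
    \<open>yopt (a + h)\<close>.\<close>
  have "integral {0..T} g = 0"
    unfolding g_def using integral_add[OF resC[of 0 T] u\<omega>[of 0 T]] optimal_imp_stationary[OF T opt \<omega>]
    by simp
  moreover have "integral {0..T} g = integral {0..a} g + (integral {a..?b} g + integral {?b..T} g)"
    using Henstock_Kurzweil_Integration.integral_combine[of 0 a T g]
      Henstock_Kurzweil_Integration.integral_combine[of a ?b T g] a h ah g_int by simp
  moreover have "integral {0..a} g = 0"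
  proof -
    have "integral {0..a} g = integral {0..a} (\<lambda>s. 0)"
      by (rule integral_spike[of "{a}"]) (auto simp: g_def Phi_before \<omega>_out)
    then show ?thesis by simp
  qed
  moreover have "integral {?b..T} g = integral {?b..T} (\<lambda>s. res s \<bullet> C (S (s - ?b) (Phi h w)))"
    by (rule integral_spike[of "{?b}"]) (auto simp: g_def Phi_after \<omega>_out)
  moreover have "yopt a \<bullet> \<zeta> = integral {a..?b} f + integral {?b..T} f"
    using Henstock_Kurzweil_Integration.integral_combine[of a ?b T f] h ah f_int
    by (simp add: inner_adjoint_state[OF a] flip: f_def)
  moreover have "integral {?b..T} f = integral {?b..T} (\<lambda>s. res s \<bullet> C (S (s - ?b) (S h \<zeta>)))"
  proof (rule integral_cong)
    fix s assume "s \<in> {?b..T}"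
    then show "f s = res s \<bullet> C (S (s - ?b) (S h \<zeta>))"
      using S_add[of "s - ?b" h \<zeta>] h by (simp add: f_def)
  qed
  moreover have "yopt ?b \<bullet> traj \<zeta> w h = integral {?b..T} (\<lambda>s. res s \<bullet> C (S (s - ?b) (S h \<zeta>)))
      + integral {?b..T} (\<lambda>s. res s \<bullet> C (S (s - ?b) (Phi h w)))"
    using a h by (simp add: inner_add_right inner_adjoint_state)
  moreover have "integral {a..?b} f + integral {a..?b} g
      = integral {0..h} (\<lambda>r. res (r + a) \<bullet> C (traj \<zeta> w r) + u (r + a) \<bullet> w r)"
  proof -
    have "integral {a..?b} f + integral {a..?b} g = integral {a..?b} (\<lambda>s. f s + g s)"
      by (intro integral_add[symmetric] f_int g_int) (use a ah in auto)
    also have "\<dots> = integral {0..h} (\<lambda>r. f (r + a) + g (r + a))"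
      by (rule integral_shift_add[symmetric])
    also have "\<dots> = integral {0..h} (\<lambda>r. res (r + a) \<bullet> C (traj \<zeta> w r) + u (r + a) \<bullet> w r)"
      by (intro integral_cong)
        (simp add: f_def g_def Phi_during \<omega>_in blinfun.add_right inner_add_right)
    finally show ?thesis .
  qed
  ultimately show ?thesis by linarith
qed

text \<open>Both optimality conditions are written as the same duality identity and subtracted, so
  that \<open>z\<close> cancels: \<open>adjoint_state_step\<close> for the dynamic one, and for the
  static one the weak equation of the test trajectory paired with the constant \<open>yb\<close>,
  which is legitimate because \<open>yb\<close> lies in \<open>DA\<close>.\<close>

lemma optimal_imp_extremal:
  assumes "optimal_steady_triple A B C z (xb, ub, yb)"
  shows "extremal C T (x0 - xb) (\<lambda>s. u s - ub) (\<lambda>t. yopt t - yb)"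
    and "\<And>t. t \<in> {0..T} \<Longrightarrow> state A S B x0 u t - xb = traj (x0 - xb) (\<lambda>s. u s - ub) t"
proof -
  let ?C = "adjoint (blinfun_apply C)"
  let ?p = "traj (x0 - xb) (\<lambda>s. u s - ub)"
  have steady: "steady_state A B xb ub" and yb1: "yb \<in> DA" and eqs: "- As yb - ?C (C xb - z) = 0" "ub = - Bs yb"
    using assms unfolding optimal_steady_triple_def by auto
  have "As yb + ?C (C xb - z) = - (- As yb - ?C (C xb - z))" by simp
  then have "As yb = - ?C (C xb - z)" unfolding eqs(1) by (simp only: minus_zero eq_neg_iff_add_eq_0)
  with yb1 eqs(2) have yb: "yb \<in> DA" "As yb = - ?C (C xb - z)" "Bs yb = - ub" by auto
  show traj_diff: "state A S B x0 u t - xb = ?p t" if t: "t \<in> {0..T}" for t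
  proof -
    have "sqint {0..t} u" by (rule sqint_subset[OF u_sqint]) (use t in auto)
    then have "?p t = traj x0 u t - traj xb (\<lambda>s. ub) t"
      using t by (simp add: Phi_diff blinfun.diff_right)
    then show ?thesis using steady_state_trajectory[OF steady, of t] t by (simp add: state_eq)
  qed
  have v: "sqint {0..T} (\<lambda>s. u s - ub)" by (intro sqint_diff u_sqint sqint_const) auto
  show "extremal C T (x0 - xb) (\<lambda>s. u s - ub) (\<lambda>t. yopt t - yb)"
    unfolding extremal_def
  proof (intro conjI allI impI, rule v, elim conjE)
    fix a b :: real and \<zeta> :: 'h and w :: "real \<Rightarrow> 'u"
    assume ab: "0 \<le> a" "a \<le> b" "b \<le> T" and w: "sqint {0..b - a} w"
    define h where "h = b - a"
    have h: "0 \<le> h" "a + h \<le> T" "b = a + h" using ab by (auto simp: h_def)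
    have wh: "sqint {0..h} w" using w by (simp add: h_def)
    let ?f = "\<lambda>r. res (r + a) \<bullet> C (traj \<zeta> w r) + u (r + a) \<bullet> w r"
    let ?g = "\<lambda>r. (C xb - z) \<bullet> C (traj \<zeta> w r) + ub \<bullet> w r"
    have Ct: "continuous_on {0..h} (\<lambda>r. C (traj \<zeta> w r))"
      by (rule C_continuous_on[OF traj_continuous_on[OF wh]])
    have f_int: "?f integrable_on {0..h}"
    proof (rule integrable_add)
      have "continuous_on {0..h} (\<lambda>r. res (r + a))"
        by (rule continuous_on_compose2[OF res_cont[of 0 T]]) (use ab h in \<open>auto intro!: continuous_intros\<close>)
      then show "(\<lambda>r. res (r + a) \<bullet> C (traj \<zeta> w r)) integrable_on {0..h}"
        by (rule integrable_continuous_real[OF continuous_on_inner[OF _ Ct]])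
      have "sqint {0 + a..h + a} u" by (rule sqint_subset[OF u_sqint]) (use ab h in auto)
      then show "(\<lambda>r. u (r + a) \<bullet> w r) integrable_on {0..h}"
        by (intro sqint_inner_integrable sqint_shift wh) auto
    qed
    have g_int: "?g integrable_on {0..h}"
      by (intro integrable_add integrable_continuous_real[OF continuous_on_inner[OF continuous_on_const Ct]]
          sqint_inner_integrable sqint_const wh) auto
    have "yb \<bullet> traj \<zeta> w h = yb \<bullet> \<zeta> + integral {0..h} (\<lambda>r. - ?g r)"
    proof -
      have "integral {0..h} (\<lambda>r. traj \<zeta> w r \<bullet> As yb + w r \<bullet> Bs yb) = integral {0..h} (\<lambda>r. - ?g r)"
        by (intro integral_cong)
          (simp add: yb(2,3) inner_commute[of "C xb - z"] adjoint_blinfun inner_commute[of ub])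
      then show ?thesis using weak_solution[OF h(1) wh yb(1), of \<zeta>] by (simp add: inner_commute)
    qed
    then have "yb \<bullet> \<zeta> = yb \<bullet> traj \<zeta> w h + integral {0..h} ?g"
      unfolding Henstock_Kurzweil_Integration.integral_neg by linarith
    moreover have "yopt a \<bullet> \<zeta> = yopt (a + h) \<bullet> traj \<zeta> w h + integral {0..h} ?f"
      by (rule adjoint_state_step[OF ab(1) h(1,2) wh])
    ultimately have "(yopt a - yb) \<bullet> \<zeta> = (yopt b - yb) \<bullet> traj \<zeta> w h + (integral {0..h} ?f - integral {0..h} ?g)"
      by (simp add: inner_diff_left h(3))
    also have "integral {0..h} ?f - integral {0..h} ?g = integral {0..h} (\<lambda>r. ?f r - ?g r)"
      by (rule integral_diff[symmetric, OF f_int g_int])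
    also have "\<dots> = integral {0..h} (\<lambda>r. C (?p (r + a)) \<bullet> C (traj \<zeta> w r) + (u (r + a) - ub) \<bullet> w r)"
    proof (rule integral_cong)
      fix r assume r: "r \<in> {0..h}"
      have "C (?p (r + a)) = res (r + a) - (C xb - z)"
        using traj_diff[of "r + a"] r ab h
        by (simp add: residual_def[OF T] state_eq flip: blinfun.diff_right)
      then show "?f r - ?g r = C (?p (r + a)) \<bullet> C (traj \<zeta> w r) + (u (r + a) - ub) \<bullet> w r"
        by (simp add: inner_diff_left)
    qed
    finally show "(yopt a - yb) \<bullet> \<zeta> = (yopt b - yb) \<bullet> traj \<zeta> w (b - a)
        + integral {0..b - a} (\<lambda>r. C (?p (r + a)) \<bullet> C (traj \<zeta> w r) + (u (r + a) - ub) \<bullet> w r)"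
      by (simp only: h_def)
  qed
qed

end

end

theorem theorem1p1:
  fixes A :: "'h::{real_inner, banach} unbounded_op"
    and S :: "real \<Rightarrow> 'h \<Rightarrow>\<^sub>L 'h"
    and B :: "'u::{real_inner, banach} \<Rightarrow> 'h \<Rightarrow> real"
    and C :: "'h \<Rightarrow>\<^sub>L 'h"
    and T0 :: real
  assumes "generates A S"
    and "control_operator A B"
    and "admissible A S B"
    and "T0 > 0"
    and "observable S C T0"
    and "adj_observable A S B T0"
    and "{x \<in> op_dom A. op_app A x = 0} \<inter> {x. C x = 0} = {0}"
    and "{\<phi> \<in> op_dom (op_adjoint A). op_app (op_adjoint A) \<phi> = 0}
           \<inter> {\<phi> \<in> op_dom (op_adjoint A). ctrl_adjoint B \<phi> = 0} = {0}"
    and "\<exists>\<delta>>0. \<forall>\<eta>. (norm (C \<eta>))\<^sup>2 \<ge> \<delta> * (norm \<eta>)\<^sup>2"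
  shows "\<exists>c>0. \<exists>l>0. \<forall>T>T0. \<forall>x0 z.
    (\<exists>u. optimal_control A S B C z T x0 u) \<and>
    (\<forall>u v. optimal_control A S B C z T x0 u \<longrightarrow> optimal_control A S B C z T x0 v \<longrightarrow>
       (AE t in lebesgue_on {0<..<T}. u t = v t)) \<and>
    (\<exists>!p. optimal_steady_triple A B C z p) \<and>
    (\<forall>u xb ub yb.
       optimal_control A S B C z T x0 u \<longrightarrow>
       optimal_steady_triple A B C z (xb, ub, yb) \<longrightarrow>
       (\<forall>t\<in>{0..T}.
          norm (state A S B x0 u t - xb)
          + norm (adjoint_state S C z T (state A S B x0 u) t - yb)
          + L2_norm_on (turnpike_interval T t) (\<lambda>s. u s - ub)
          \<le> c * (norm (x0 - xb) + norm yb) * (exp (- l * t) + exp (- l * (T - t)))))"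
proof -
  interpret control_system A S B
    by unfold_locales (fact assms)+
  note T0 = \<open>T0 > 0\<close> and obs = \<open>adj_observable A S B T0\<close>
  obtain \<delta> where \<delta>: "\<delta> > 0" "\<And>\<eta>. \<delta> * (norm \<eta>)\<^sup>2 \<le> (norm (C \<eta>))\<^sup>2" using assms(9) by blast
  show ?thesis
  proof (rule extremal_turnpike[where C = C, OF obs T0 \<delta>])
    fix c l :: real
    assume c: "c > 0" and l: "l > 0"
      and turnpike: "\<And>T p v q t. T > T0 \<Longrightarrow> extremal C T p v q \<Longrightarrow> t \<in> {0..T} \<Longrightarrow>
        norm (traj p v t) + norm (q t) + sqrt (energy C p v (min t (T - t)) (max t (T - t)))
          \<le> c * (norm p + norm (q T)) * (exp (- l * t) + exp (- l * (T - t)))"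
    have bound: "norm (state A S B x0 u t - xb)
            + norm (adjoint_state S C z T (state A S B x0 u) t - yb)
            + L2_norm_on (turnpike_interval T t) (\<lambda>s. u s - ub)
            \<le> c * (norm (x0 - xb) + norm yb) * (exp (- l * t) + exp (- l * (T - t)))"
      if T: "T > T0" and opt: "optimal_control A S B C z T x0 u"
        and triple: "optimal_steady_triple A B C z (xb, ub, yb)" and t: "t \<in> {0..T}"
      for T x0 z u xb ub yb t
    proof -
      let ?v = "\<lambda>s. u s - ub" and ?q = "\<lambda>t. adjoint_state S C z T (state A S B x0 u) t - yb"
      have "T > 0" using T T0 by simp
      note ext = optimal_imp_extremal[OF \<open>T > 0\<close> opt triple]
      have v: "sqint {0..T} ?v" using ext(1) by (simp add: extremal_def)
      let ?a = "min t (T - t)" and ?b = "max t (T - t)"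
      have ab: "0 \<le> ?a" "?b \<le> T" using t by auto
      have "turnpike_interval T t = {?a<..<?b}"
        by (auto simp: turnpike_interval_def min_def max_def)
      then have "L2_norm_on (turnpike_interval T t) ?v = sqrt (sqnorm {?a..?b} ?v)"
        using L2_norm_on_Ioo[OF v_sub[OF v ab]] by simp
      also have "\<dots> \<le> sqrt (energy C (x0 - xb) ?v ?a ?b)"
        by (intro real_sqrt_le_mono energy_ge(2)[OF v ab])
      finally have L2: "L2_norm_on (turnpike_interval T t) ?v \<le> sqrt (energy C (x0 - xb) ?v ?a ?b)" .
      \<comment> \<open>The adjoint state vanishes at \<open>T\<close>, so its deviation there is
        \<open>- yb\<close>; together with the deviation \<open>x0 - xb\<close> of the state at time
        0 this gives the data on the right-hand side.\<close>
      have "?q T = - yb" by (simp add: adjoint_state_def)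
      then show ?thesis using turnpike[OF T ext(1) t] ext(2)[OF t] L2 by simp
    qed
    have exists: "\<exists>u. optimal_control A S B C z T x0 u" if "T > T0" for T x0 z
      using optimal_control_exists[of T C z x0] that T0 by simp
    have unique: "AE t in lebesgue_on {0<..<T}. u t = v t"
      if "T > T0" "optimal_control A S B C z T x0 u" "optimal_control A S B C z T x0 v" for T x0 z u v
      using optimal_control_ae_unique[OF _ that(2,3)] that(1) T0 by simp
    show ?thesis
      by (rule exI[of _ c], rule conjI[OF c], rule exI[of _ l], rule conjI[OF l],
          intro allI impI conjI ballI)
        (rule exists unique optimal_steady_triple_ex1[OF obs T0 \<delta>] bound; assumption)+
  qed
qed

end
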